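(* Let $\mathbb{K}$ be a field, let $1\le k\le n$ be integers, let $\beta\le\gamma$ be $k$-element subsets of $[n]$, and let $1\le t\le k-1$. If $\mathcal{P}_t$ is non-empty, then $\Delta_{\delta_t}$ is a prime element of $\mathring{A}_\beta^\gamma$.
   Context: $[n]=\{1,\dots,n\}$ and $\mathcal{S}(k,n)$ is the set of $k$-element subsets of $[n]$. For $\alpha\in\mathcal{S}(k,n)$, $\alpha(i)$ is the $i$-th smallest element of $\alpha$. Partial order: $\alpha\le\alpha'$ iff $\alpha(i)\le\alpha'(i)$ for all $i=1,\dots,k$; $[\beta,\gamma]=\{\alpha\in\mathcal{S}(k,n)\mid \beta\le\alpha\le\gamma\}$. For integers $a,b$, $[a,b]$ is the interval of integers from $a$ to $b$, empty if $a>b$. $A=\mathbb{K}[\Delta_\alpha\mid\alpha\in\mathcal{S}(k,n)]/I$ is the Plücker coordinate ring of $\mathrm{Gr}(k,n)=\mathrm{Proj}\,A$, where $I$ is the Plücker ideal, i.e. the ideal generated by the quadratic Plücker relations; equivalently, the kernel of the map $\Delta_\alpha\mapsto$ the maximal minor with column set $\alpha$ of a generic $k\times n$ matrix of indeterminates over $\mathbb{K}$. $A_\beta^\gamma=A/\langle\Delta_\alpha\mid\alpha\notin[\beta,\gamma]\rangle$ and $\mathring{A}_\beta^\gamma=A_\beta^\gamma[\Delta_\beta^{-1},\Delta_\gamma^{-1}]$. $\delta_t=\{\beta(1),\dots,\beta(t),\gamma(t+1),\dots,\gamma(k)\}\in\mathcal{S}(k,n)$ and $\mathcal{P}_t=\{\alpha\in[\beta,\gamma]\mid\alpha\cap[\beta(t+1),\gamma(t)]\ne\emptyset\}$.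 *)

theory Defs
  imports
    "HOL-Algebra.Ring_Divisibility"
    "HOL-Library.Poly_Mapping"
    "Jordan_Normal_Form.Determinant"
begin

section \<open>Polynomial rings in a set of indeterminates\<close>

type_synonym ('x, 'k) mpoly = "('x \<Rightarrow>\<^sub>0 nat) \<Rightarrow>\<^sub>0 'k"

definition mvar :: "'x \<Rightarrow> ('x, 'k::comm_ring_1) mpoly" where
  "mvar x = Poly_Mapping.single (Poly_Mapping.single x 1) 1"

definition mvars :: "('x, 'k::comm_ring_1) mpoly \<Rightarrow> 'x set" where
  "mvars p = (\<Union>m\<in>Poly_Mapping.keys p. Poly_Mapping.keys m)"

definition mpoly_ring :: "'x set \<Rightarrow> ('x, 'k::comm_ring_1) mpoly ring" where
  "mpoly_ring V = \<lparr>carrier = {p. mvars p \<subseteq> V}, mult = (*), one = 1, zero = 0, add = (+)\<rparr>"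

text \<open>The value at \<open>p\<close> of the \<open>'k\<close>-algebra homomorphism that sends each indeterminate \<open>x\<close> to \<open>f x\<close>.\<close>

definition msubst :: "('x \<Rightarrow> ('y, 'k) mpoly) \<Rightarrow> ('x, 'k::comm_ring_1) mpoly \<Rightarrow> ('y, 'k) mpoly" where
  "msubst f p = (\<Sum>m\<in>Poly_Mapping.keys p. Poly_Mapping.single 0 (Poly_Mapping.lookup p m) *
     (\<Prod>x\<in>Poly_Mapping.keys m. f x ^ Poly_Mapping.lookup m x))"


section \<open>Localization of a commutative ring\<close>

text \<open>The ring \<open>S\<inverse>R\<close> consists of classes of pairs \<open>(a, s)\<close>, read \<open>a / s\<close>. The factor \<open>u\<close> is needed
  because \<open>S\<close> may contain zero divisors.\<close>

definition loc_rel :: "('a, 'm) ring_scheme \<Rightarrow> 'a set \<Rightarrow> (('a \<times> 'a) \<times> ('a \<times> 'a)) set" where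
  "loc_rel R S = {((a, s), (b, t)). a \<in> carrier R \<and> b \<in> carrier R \<and> s \<in> S \<and> t \<in> S \<and>
     (\<exists>u\<in>S. u \<otimes>\<^bsub>R\<^esub> (a \<otimes>\<^bsub>R\<^esub> t) = u \<otimes>\<^bsub>R\<^esub> (b \<otimes>\<^bsub>R\<^esub> s))}"

definition loc_frac :: "('a, 'm) ring_scheme \<Rightarrow> 'a set \<Rightarrow> 'a \<Rightarrow> 'a \<Rightarrow> ('a \<times> 'a) set" where
  "loc_frac R S a s = loc_rel R S `` {(a, s)}"

definition localization :: "('a, 'm) ring_scheme \<Rightarrow> 'a set \<Rightarrow> ('a \<times> 'a) set ring" where
  "localization R S =
    \<lparr>carrier = (carrier R \<times> S) // loc_rel R S,
     mult = (\<lambda>X Y. \<Union>(a, s)\<in>X. \<Union>(b, t)\<in>Y. loc_frac R S (a \<otimes>\<^bsub>R\<^esub> b) (s \<otimes>\<^bsub>R\<^esub> t)),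
     one = loc_frac R S \<one>\<^bsub>R\<^esub> \<one>\<^bsub>R\<^esub>,
     zero = loc_frac R S \<zero>\<^bsub>R\<^esub> \<one>\<^bsub>R\<^esub>,
     add = (\<lambda>X Y. \<Union>(a, s)\<in>X. \<Union>(b, t)\<in>Y.
       loc_frac R S (a \<otimes>\<^bsub>R\<^esub> t \<oplus>\<^bsub>R\<^esub> b \<otimes>\<^bsub>R\<^esub> s) (s \<otimes>\<^bsub>R\<^esub> t))\<rparr>"


section \<open>Subsets of \<open>{1..n}\<close> of size \<open>k\<close>\<close>

definition ksubsets :: "nat \<Rightarrow> nat \<Rightarrow> nat set set" where
  "ksubsets k n = {\<alpha>. \<alpha> \<subseteq> {1..n} \<and> card \<alpha> = k}"

text \<open>The \<open>i\<close>-th smallest element of a finite set, counting from \<open>i = 1\<close>.\<close>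

definition elt :: "nat set \<Rightarrow> nat \<Rightarrow> nat" where
  "elt \<alpha> i = sorted_list_of_set \<alpha> ! (i - 1)"

definition ksub_le :: "nat \<Rightarrow> nat set \<Rightarrow> nat set \<Rightarrow> bool" where
  "ksub_le k \<alpha> \<alpha>' \<longleftrightarrow> (\<forall>i\<in>{1..k}. elt \<alpha> i \<le> elt \<alpha>' i)"

definition ksub_interval :: "nat \<Rightarrow> nat \<Rightarrow> nat set \<Rightarrow> nat set \<Rightarrow> nat set set" where
  "ksub_interval k n \<beta> \<gamma> = {\<alpha> \<in> ksubsets k n. ksub_le k \<beta> \<alpha> \<and> ksub_le k \<alpha> \<gamma>}"

definition delta :: "nat \<Rightarrow> nat set \<Rightarrow> nat set \<Rightarrow> nat \<Rightarrow> nat set" where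
  "delta k \<beta> \<gamma> t = elt \<beta> ` {1..t} \<union> elt \<gamma> ` {t+1..k}"

definition Pset :: "nat \<Rightarrow> nat \<Rightarrow> nat set \<Rightarrow> nat set \<Rightarrow> nat \<Rightarrow> nat set set" where
  "Pset k n \<beta> \<gamma> t = {\<alpha> \<in> ksub_interval k n \<beta> \<gamma>. \<alpha> \<inter> {elt \<beta> (t+1)..elt \<gamma> t} \<noteq> {}}"


section \<open>Coordinate rings of the Grassmannian and of Richardson varieties\<close>

text \<open>The maximal minor with column set \<open>\<alpha>\<close> of the generic \<open>k \<times> n\<close> matrix, whose entries are the
  indeterminates \<open>mvar (i, j)\<close> for \<open>i \<in> {1..k}\<close> and \<open>j \<in> {1..n}\<close>. Rows and columns of a
  \<open>mat\<close> are counted from 0.\<close>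

definition generic_minor :: "nat \<Rightarrow> nat set \<Rightarrow> (nat \<times> nat, 'k::comm_ring_1) mpoly" where
  "generic_minor k \<alpha> = det (mat k k (\<lambda>(i, j). mvar (i + 1, elt \<alpha> (j + 1))))"

text \<open>The indeterminates are now the sets \<open>\<alpha>\<close> themselves: \<open>mvar \<alpha>\<close> is the Pluecker coordinate of
  \<open>\<alpha>\<close>. The ideal generated by the quadratic Pluecker relations is the kernel of the map that sends
  each coordinate to its minor.\<close>

definition plucker_ideal :: "nat \<Rightarrow> nat \<Rightarrow> (nat set, 'k::field) mpoly set" where
  "plucker_ideal k n = a_kernel (mpoly_ring (ksubsets k n)) (mpoly_ring ({1..k} \<times> {1..n}))
     (msubst (generic_minor k))"

type_synonym 'k plucker_elt = "(nat set, 'k) mpoly set"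
type_synonym 'k richardson_elt = "'k plucker_elt set"
type_synonym 'k open_richardson_elt = "('k richardson_elt \<times> 'k richardson_elt) set"

definition plucker_ring :: "nat \<Rightarrow> nat \<Rightarrow> 'k::field plucker_elt ring" where
  "plucker_ring k n = mpoly_ring (ksubsets k n) Quot plucker_ideal k n"

definition plucker_coord :: "nat \<Rightarrow> nat \<Rightarrow> nat set \<Rightarrow> 'k::field plucker_elt" where
  "plucker_coord k n \<alpha> = plucker_ideal k n +>\<^bsub>mpoly_ring (ksubsets k n)\<^esub> mvar \<alpha>"

definition richardson_ideal ::
    "nat \<Rightarrow> nat \<Rightarrow> nat set \<Rightarrow> nat set \<Rightarrow> 'k::field plucker_elt set" where
  "richardson_ideal k n \<beta> \<gamma> =
     Idl\<^bsub>plucker_ring k n\<^esub> (plucker_coord k n ` (ksubsets k n - ksub_interval k n \<beta> \<gamma>))"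

definition richardson_ring ::
    "nat \<Rightarrow> nat \<Rightarrow> nat set \<Rightarrow> nat set \<Rightarrow> 'k::field richardson_elt ring" where
  "richardson_ring k n \<beta> \<gamma> = plucker_ring k n Quot richardson_ideal k n \<beta> \<gamma>"

definition richardson_coord ::
    "nat \<Rightarrow> nat \<Rightarrow> nat set \<Rightarrow> nat set \<Rightarrow> nat set \<Rightarrow> 'k::field richardson_elt" where
  "richardson_coord k n \<beta> \<gamma> \<alpha> =
     richardson_ideal k n \<beta> \<gamma> +>\<^bsub>plucker_ring k n\<^esub> plucker_coord k n \<alpha>"

definition extremal_monomials ::
    "nat \<Rightarrow> nat \<Rightarrow> nat set \<Rightarrow> nat set \<Rightarrow> 'k::field richardson_elt set" where
  "extremal_monomials k n \<beta> \<gamma> =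
     {richardson_coord k n \<beta> \<gamma> \<beta> [^]\<^bsub>richardson_ring k n \<beta> \<gamma>\<^esub> i
        \<otimes>\<^bsub>richardson_ring k n \<beta> \<gamma>\<^esub> richardson_coord k n \<beta> \<gamma> \<gamma> [^]\<^bsub>richardson_ring k n \<beta> \<gamma>\<^esub> j
      | (i::nat) (j::nat). True}"

definition open_richardson_ring ::
    "nat \<Rightarrow> nat \<Rightarrow> nat set \<Rightarrow> nat set \<Rightarrow> 'k::field open_richardson_elt ring" where
  "open_richardson_ring k n \<beta> \<gamma> =
     localization (richardson_ring k n \<beta> \<gamma>) (extremal_monomials k n \<beta> \<gamma>)"

definition open_richardson_coord ::
    "nat \<Rightarrow> nat \<Rightarrow> nat set \<Rightarrow> nat set \<Rightarrow> nat set \<Rightarrow> 'k::field open_richardson_elt" where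
  "open_richardson_coord k n \<beta> \<gamma> \<alpha> =
     loc_frac (richardson_ring k n \<beta> \<gamma>) (extremal_monomials k n \<beta> \<gamma>)
       (richardson_coord k n \<beta> \<gamma> \<alpha>) \<one>\<^bsub>richardson_ring k n \<beta> \<gamma>\<^esub>"

end

theory Submission
  imports Defs "HOL-Library.Product_Lexorder" "HOL-Computational_Algebra.Fraction_Field"
begin

text \<open>Write \<open>\<beta>(i)\<close> for the \<open>i\<close>-th smallest element of \<open>\<beta>\<close>, and \<open>\<delta>\<^sub>s\<close> for
\<open>{\<beta>(1), \<dots>, \<beta>(s), \<gamma>(s+1), \<dots>, \<gamma>(k)}\<close>, so that \<open>\<delta>\<^sub>0 = \<gamma>\<close> and \<open>\<delta>\<^sub>k = \<beta>\<close>. A generic point of the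
Richardson variety is the row space of a band matrix \<open>Z\<close>: row \<open>i\<close> has independent entries in the
columns from \<open>\<beta>(i)\<close> to \<open>\<gamma>(i)\<close> and zeros elsewhere. The minors of \<open>Z\<close> outside \<open>[\<beta>, \<gamma>]\<close> vanish, and the
minor at \<open>\<delta>\<^sub>s\<close> is a single monomial \<open>P s\<close>, because its columns are triangular.

The first step identifies the Richardson ring with the subring \<open>Q\<close> that the minors of \<open>Z\<close> generate
in a polynomial ring (\<open>\<eta>_kernel\<close>). This is standard monomial theory: by the straightening relation
(\<open>garnir_relation\<close>) the monomials in chains \<open>\<alpha>\<^sub>1 \<le> \<dots> \<le> \<alpha>\<^sub>d\<close> of \<open>[\<beta>, \<gamma>]\<close> span the ring (\<open>straight_all\<close>),
and on \<open>Z\<close> the product of the minors of a chain has as its leading term the product of the diagonals,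
from which the chain can be read off (\<open>list_exp_inj\<close>). Hence evaluation on \<open>Z\<close> is injective, and the leading
exponent of every nonzero element of \<open>Q\<close> comes from a chain.

On the divisor \<open>\<Delta>\<^bsub>\<delta>\<^sub>t\<^esub> = 0\<close> the subspace contains a vector supported in the columns from \<open>\<beta>(t+1)\<close> to
\<open>\<gamma>(t)\<close>. Accordingly the divisor is parametrized by the band matrix in which rows \<open>t\<close> and \<open>t+1\<close> have exchanged
their right ends. Evaluation on that matrix is a homomorphism \<open>Phi swap\<close> from the Richardson ring into a
domain which kills \<open>\<Delta>\<^bsub>\<delta>\<^sub>t\<^esub>\<close>; it does not kill \<open>\<Delta>\<^sub>\<beta>\<close> and \<open>\<Delta>\<^sub>\<gamma>\<close>, since \<open>\<beta>(t+1) \<le> \<gamma>(t)\<close>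
when \<open>\<P>\<^sub>t\<close> is not empty. So \<open>\<Delta>\<^bsub>\<delta>\<^sub>t\<^esub>\<close> is prime as soon as it generates the kernel of this homomorphism once
\<open>\<Delta>\<^sub>\<beta>\<close> and \<open>\<Delta>\<^sub>\<gamma>\<close> are inverted. That is shown in two steps.

After inverting all \<open>P s\<close> with \<open>s \<noteq> t\<close>, row operations turn \<open>Z\<close> into a matrix with the same minors
whose entries lie in the localized ring and which modulo \<open>P t\<close> has the shape of the exchanged band
matrix. Substituting its entries into \<open>Phi swap F = 0\<close> gives that a product of the \<open>P s\<close> with \<open>s \<noteq> t\<close> times \<open>F\<close>
is a multiple of \<open>P t\<close> (\<open>Phi_swap_zero\<close>).

It remains to trade that product for a power of \<open>P 0 * P k\<close> (\<open>divide_by_other_monomials\<close>). The leading exponents of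
\<open>Q\<close> are cut out by linear inequalities. Those that involve rows \<open>t\<close> and \<open>t+1\<close> and survive the inversion of \<open>P 0\<close> and \<open>P k\<close>
are strict on \<open>P t\<close> and equalities on the other \<open>P s\<close>. So if such a product times \<open>x\<close> is divisible by \<open>P t\<close>, the
inequalities are strict on the leading exponent of \<open>x\<close>, which therefore, up to \<open>P 0 * P k\<close>, is that of a multiple of \<open>P t\<close>;
subtract that multiple and repeat.\<close>

section \<open>Evaluation of polynomials\<close>

abbreviation "lookup \<equiv> Poly_Mapping.lookup"
abbreviation "keys \<equiv> Poly_Mapping.keys"
abbreviation "single \<equiv> Poly_Mapping.single"

definition pmon :: "('x \<Rightarrow> 'r::comm_ring_1) \<Rightarrow> ('x \<Rightarrow>\<^sub>0 nat) \<Rightarrow> 'r" where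
  "pmon f m = (\<Prod>x\<in>keys m. f x ^ lookup m x)"

text \<open>The map \<open>h\<close> acts on coefficients. It embeds them as constants when the
  target is a polynomial ring, and is followed by a further embedding when the target is a field of
  fractions.\<close>

definition peval :: "('k \<Rightarrow> 'r) \<Rightarrow> ('x \<Rightarrow> 'r) \<Rightarrow> ('x, 'k::comm_ring_1) mpoly \<Rightarrow> 'r::comm_ring_1" where
  "peval h f p = (\<Sum>m\<in>keys p. h (lookup p m) * pmon f m)"

lemma pmon_superset:
  assumes "finite A" "keys m \<subseteq> A"
  shows "pmon f m = (\<Prod>x\<in>A. f x ^ lookup m x)"
  unfolding pmon_def
  by (rule prod.mono_neutral_left) (use assms in \<open>auto simp: in_keys_iff\<close>)

lemma pmon_0 [simp]: "pmon f 0 = 1"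
  by (simp add: pmon_def)

lemma pmon_add: "pmon f (a + b) = pmon f a * pmon f b"
proof -
  let ?A = "keys a \<union> keys b"
  have "pmon f (a + b) = (\<Prod>x\<in>?A. f x ^ lookup (a + b) x)"
    by (rule pmon_superset) (use Poly_Mapping.keys_add[of a b] in auto)
  also have "\<dots> = (\<Prod>x\<in>?A. f x ^ lookup a x) * (\<Prod>x\<in>?A. f x ^ lookup b x)"
    by (simp add: lookup_add power_add prod.distrib)
  also have "\<dots> = pmon f a * pmon f b"
    by (subst (1 2) pmon_superset[of ?A]) auto
  finally show ?thesis .
qed

lemma pmon_single [simp]: "pmon f (single x n) = f x ^ n"
  by (cases "n = 0") (simp_all add: pmon_def)

lemma poly_mapping_sum_singles:
  "p = (\<Sum>m\<in>keys p. single m (lookup p m))"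
  by (rule poly_mapping_eqI)
     (simp add: lookup_sum lookup_single when_def sum.delta' in_keys_iff)

lemma peval_superset:
  assumes "h 0 = 0" "finite A" "keys p \<subseteq> A"
  shows "peval h f p = (\<Sum>m\<in>A. h (lookup p m) * pmon f m)"
  unfolding peval_def
  by (rule sum.mono_neutral_left) (use assms in \<open>auto simp: in_keys_iff\<close>)

lemma peval_single:
  assumes "h 0 = 0"
  shows "peval h f (single m c) = h c * pmon f m"
  by (subst peval_superset[of h "{m}"]) (use assms in auto)

lemma peval_add:
  assumes "comm_ring_hom h"
  shows "peval h f (p + q) = peval h f p + peval h f q"
proof -
  interpret comm_ring_hom h by fact
  let ?A = "keys p \<union> keys q"
  have "peval h f (p + q) = (\<Sum>m\<in>?A. h (lookup (p + q) m) * pmon f m)"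
    by (rule peval_superset) (use Poly_Mapping.keys_add[of p q] in auto)
  also have "\<dots> = (\<Sum>m\<in>?A. h (lookup p m) * pmon f m)
      + (\<Sum>m\<in>?A. h (lookup q m) * pmon f m)"
    by (simp add: lookup_add hom_distribs algebra_simps sum.distrib)
  also have "\<dots> = peval h f p + peval h f q"
    by (subst (1 2) peval_superset[of h ?A]) auto
  finally show ?thesis .
qed

lemma peval_0: "peval h f 0 = 0"
  by (simp add: peval_def)

lemma peval_sum:
  assumes "comm_ring_hom h"
  shows "peval h f (sum g A) = (\<Sum>i\<in>A. peval h f (g i))"
  by (induction A rule: infinite_finite_induct) (simp_all add: peval_0 peval_add[OF assms])

lemma peval_hom:
  assumes "comm_ring_hom h"
  shows "comm_ring_hom (peval h f)"
proof -
  interpret comm_ring_hom h by fact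
  have "peval h f (p * q) = peval h f p * peval h f q" for p q
  proof -
    let ?s = "\<lambda>p m. single m (lookup p m)"
    have "p * q = (\<Sum>m\<in>keys p. ?s p m) * (\<Sum>m\<in>keys q. ?s q m)"
      using poly_mapping_sum_singles[of p] poly_mapping_sum_singles[of q] by simp
    also have "\<dots> = (\<Sum>a\<in>keys p. \<Sum>b\<in>keys q. ?s p a * ?s q b)"
      by (simp add: sum_product)
    finally have "peval h f (p * q) = (\<Sum>a\<in>keys p. \<Sum>b\<in>keys q.
        peval h f (?s p a * ?s q b))"
      by (simp add: peval_sum[OF assms])
    also have "\<dots> = (\<Sum>a\<in>keys p. \<Sum>b\<in>keys q.
        (h (lookup p a) * pmon f a) * (h (lookup q b) * pmon f b))"
      by (simp add: mult_single peval_single hom_distribs pmon_add algebra_simps)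
    also have "\<dots> = peval h f p * peval h f q"
      by (simp add: peval_def sum_product)
    finally show ?thesis .
  qed
  moreover have "peval h f 1 = 1"
    using peval_single[of h f 0 1] by simp
  ultimately show ?thesis
    by unfold_locales (simp_all add: peval_add[OF assms] peval_0)
qed

lemma peval_mvar:
  assumes "comm_ring_hom h"
  shows "peval h f (mvar x) = f x"
proof -
  interpret comm_ring_hom h by fact
  show ?thesis unfolding mvar_def by (subst peval_single) simp_all
qed

lemma peval_const:
  assumes "comm_ring_hom h"
  shows "peval h f (single 0 c) = h c"
proof -
  interpret comm_ring_hom h by fact
  show ?thesis by (subst peval_single) simp_all
qed

lemma const_hom: "comm_ring_hom (\<lambda>c. single 0 c :: ('x, 'k::comm_ring_1) mpoly)"
  by unfold_locales (simp_all add: single_add mult_single)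

lemma msubst_eq_peval: "msubst f = peval (\<lambda>c. single 0 c) f"
  by (rule ext) (simp add: msubst_def peval_def pmon_def)

lemma msubst_hom: "comm_ring_hom (msubst f)"
  unfolding msubst_eq_peval by (rule peval_hom[OF const_hom])

lemma msubst_mvar [simp]: "msubst f (mvar x) = f x"
  unfolding msubst_eq_peval by (rule peval_mvar[OF const_hom])

lemma msubst_const [simp]: "msubst f (single 0 c) = single 0 c"
  unfolding msubst_eq_peval by (rule peval_const[OF const_hom])

lemma hom_pmon:
  assumes "comm_ring_hom g"
  shows "g (pmon f m) = pmon (\<lambda>x. g (f x)) m"
proof -
  interpret comm_ring_hom g by fact
  show ?thesis by (simp add: pmon_def hom_distribs)
qed

lemma hom_peval:
  assumes "comm_ring_hom g"
  shows "g (peval h f p) = peval (\<lambda>c. g (h c)) (\<lambda>x. g (f x)) p"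
proof -
  interpret comm_ring_hom g by fact
  show ?thesis by (simp add: peval_def hom_distribs hom_pmon[OF assms])
qed

lemma peval_cong:
  assumes "\<And>x. x \<in> mvars p \<Longrightarrow> f x = g x"
  shows "peval h f p = peval h g p"
  unfolding peval_def pmon_def
proof (rule sum.cong[OF refl], rule arg_cong2[where f = "(*)"], rule refl, rule prod.cong[OF refl])
  fix m x assume "m \<in> keys p" "x \<in> keys m"
  hence "x \<in> mvars p" by (auto simp: mvars_def)
  thus "f x ^ lookup m x = g x ^ lookup m x" using assms by simp
qed

section \<open>Polynomials in a given set of indeterminates\<close>

lemma mvars_0 [simp]: "mvars 0 = {}"
  by (simp add: mvars_def)

lemma mvars_const [simp]: "mvars (single 0 c) = {}"
  by (simp add: mvars_def)

lemma mvars_1 [simp]: "mvars 1 = {}"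
  by (simp add: mvars_def)

lemma mvars_mvar [simp]: "mvars (mvar x :: ('x, 'k::comm_ring_1) mpoly) = {x}"
  by (simp add: mvars_def mvar_def)

lemma mvars_add: "mvars (p + q) \<subseteq> mvars p \<union> mvars q"
  using Poly_Mapping.keys_add[of p q] unfolding mvars_def by fastforce

lemma mvars_uminus [simp]: "mvars (- p) = mvars p"
  unfolding mvars_def by (simp add: in_keys_iff set_eq_iff Poly_Mapping.keys_def)

lemma keys_add_nat: "keys (a + b :: 'x \<Rightarrow>\<^sub>0 nat) = keys a \<union> keys b"
  by (auto simp: in_keys_iff lookup_add)

lemma mvars_mult: "mvars (p * q) \<subseteq> mvars p \<union> mvars q"
proof
  fix x assume "x \<in> mvars (p * q)"
  then obtain m where m: "m \<in> keys (p * q)" "x \<in> keys m"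
    by (auto simp: mvars_def)
  then obtain a b where "a \<in> keys p" "b \<in> keys q" "m = a + b"
    using Poly_Mapping.keys_mult[of p q] by blast
  with m show "x \<in> mvars p \<union> mvars q" by (auto simp: mvars_def keys_add_nat)
qed

lemma mvars_sum: "(\<And>i. i \<in> A \<Longrightarrow> mvars (g i) \<subseteq> V) \<Longrightarrow> mvars (sum g A) \<subseteq> V"
proof (induction A rule: infinite_finite_induct)
  case (insert x F)
  then show ?case using mvars_add[of "g x" "sum g F"] by auto
qed auto


lemma mpoly_ring_simps [simp]:
  "carrier (mpoly_ring V) = {p. mvars p \<subseteq> V}"
  "p \<otimes>\<^bsub>mpoly_ring V\<^esub> q = p * q" "p \<oplus>\<^bsub>mpoly_ring V\<^esub> q = p + q"
  "\<one>\<^bsub>mpoly_ring V\<^esub> = 1" "\<zero>\<^bsub>mpoly_ring V\<^esub> = 0"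
  by (simp_all add: mpoly_ring_def)

lemma mpoly_ring_cring: "cring (mpoly_ring V :: ('x, 'k::comm_ring_1) mpoly ring)"
proof (rule cringI)
  show "abelian_group (mpoly_ring V :: ('x, 'k) mpoly ring)"
  proof (rule abelian_groupI)
    fix x :: "('x, 'k) mpoly" assume "x \<in> carrier (mpoly_ring V)"
    hence "- x \<in> carrier (mpoly_ring V)" "- x \<oplus>\<^bsub>mpoly_ring V\<^esub> x = \<zero>\<^bsub>mpoly_ring V\<^esub>" by auto
    thus "\<exists>y\<in>carrier (mpoly_ring V). y \<oplus>\<^bsub>mpoly_ring V\<^esub> x = \<zero>\<^bsub>mpoly_ring V\<^esub>" by blast
  qed (use mvars_add in \<open>fastforce simp: algebra_simps\<close>)+
  show "comm_monoid (mpoly_ring V :: ('x, 'k) mpoly ring)"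
    by (rule comm_monoidI) (use mvars_mult in \<open>fastforce simp: algebra_simps\<close>)+
qed (simp add: algebra_simps)

lemma mpoly_ring_induct [consumes 1, case_names const mvar add mult]:
  fixes p :: "('x, 'k::comm_ring_1) mpoly"
  assumes "mvars p \<subseteq> V"
    and const: "\<And>c. P (single 0 c)"
    and var: "\<And>x. x \<in> V \<Longrightarrow> P (mvar x)"
    and add: "\<And>p q. P p \<Longrightarrow> P q \<Longrightarrow> P (p + q)"
    and mult: "\<And>p q. P p \<Longrightarrow> P q \<Longrightarrow> P (p * q)"
  shows "P p"
proof -
  have P0: "P 0" and P1: "P 1" using const[of 0] const[of 1] by simp_all
  have pow: "P (mvar x ^ n)" if "x \<in> V" for x n
    by (induction n) (use P1 var[OF that] mult in auto)
  have sum: "P (sum g A)" if "\<And>i. i \<in> A \<Longrightarrow> P (g i)" for g and A :: "('x \<Rightarrow>\<^sub>0 nat) set"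
    using that by (induction A rule: infinite_finite_induct) (use P0 add in auto)
  have prod: "P (prod g A)" if "\<And>i. i \<in> A \<Longrightarrow> P (g i)" for g and A :: "'x set"
    using that by (induction A rule: infinite_finite_induct) (use P1 mult in auto)
  have "p = peval (\<lambda>c. single 0 c) mvar p"
  proof -
    have m: "pmon mvar m = (single m 1 :: ('x, 'k) mpoly)" for m
    proof (induction m rule: Poly_Mapping.update_induct)
      case const
      then show ?case by simp
    next
      case (update m x n)
      have "Poly_Mapping.update x n m = m + single x n"
        using update(1) by (intro poly_mapping_eqI)
          (auto simp: lookup_update lookup_add lookup_single in_keys_iff when_def)
      moreover have "mvar x ^ n = (single (single x n) 1 :: ('x, 'k) mpoly)"
        by (induction n) (simp_all add: mvar_def mult_single flip: single_add)
      ultimately show ?case using update by (simp add: pmon_add mult_single)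
    qed
    have "peval (\<lambda>c. single 0 c) mvar p
        = (\<Sum>m\<in>keys p. single m (lookup p m))"
      by (simp add: peval_def m mult_single)
    thus ?thesis using poly_mapping_sum_singles[of p] by simp
  qed
  also have "P \<dots>"
    unfolding peval_def pmon_def
  proof (intro sum mult const prod pow)
    fix m x assume "m \<in> keys p" "x \<in> keys m"
    thus "x \<in> V" using assms(1) by (auto simp: mvars_def)
  qed
  finally show ?thesis .
qed

section \<open>Subsets as increasing sequences\<close>

lemma ksubset_finite: "\<alpha> \<in> ksubsets k n \<Longrightarrow> finite \<alpha>"
  by (auto simp: ksubsets_def intro: finite_subset)

lemma ksubset_length: "\<alpha> \<in> ksubsets k n \<Longrightarrow> length (sorted_list_of_set \<alpha>) = k"
  by (simp add: ksubsets_def)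

lemma elt_less:
  assumes "\<alpha> \<in> ksubsets k n" "1 \<le> i" "i < j" "j \<le> k"
  shows "elt \<alpha> i < elt \<alpha> j"
proof -
  have "sorted_wrt (<) (sorted_list_of_set \<alpha>)" by simp
  thus ?thesis
    unfolding elt_def using assms(2-) ksubset_length[OF assms(1)]
    by (intro sorted_wrt_nth_less[of "(<)"]) auto
qed

lemma elt_image: 
  assumes "\<alpha> \<in> ksubsets k n"
  shows "elt \<alpha> ` {1..k} = \<alpha>"
proof -
  have "elt \<alpha> ` {1..k} = (\<lambda>j. sorted_list_of_set \<alpha> ! j) ` {0..<k}"
  proof -
    have "{0..<k} = (\<lambda>i. i - 1) ` {1..k}"
      by (force simp: image_iff Bex_def intro: exI[of _ "Suc _"])
    thus ?thesis by (simp add: elt_def image_image)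
  qed
  also have "\<dots> = set (sorted_list_of_set \<alpha>)"
    using ksubset_length[OF assms] by (metis map_nth set_map set_upt)
  finally show ?thesis using ksubset_finite[OF assms] by simp
qed

lemma elt_mem:
  assumes "\<alpha> \<in> ksubsets k n" "1 \<le> i" "i \<le> k"
  shows "elt \<alpha> i \<in> \<alpha>" "1 \<le> elt \<alpha> i" "elt \<alpha> i \<le> n"
proof -
  show *: "elt \<alpha> i \<in> \<alpha>" using elt_image[OF assms(1)] assms by (metis atLeastAtMost_iff imageI)
  show "1 \<le> elt \<alpha> i" "elt \<alpha> i \<le> n" using * assms(1) by (auto simp: ksubsets_def)
qed

lemma elt_inj:
  assumes "\<alpha> \<in> ksubsets k n" "1 \<le> i" "i \<le> k" "1 \<le> j" "j \<le> k"
  shows "elt \<alpha> i = elt \<alpha> j \<longleftrightarrow> i = j"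
  using elt_less[OF assms(1), of i j] elt_less[OF assms(1), of j i] assms
  by (metis less_irrefl linorder_neqE_nat)

lemma elt_le:
  assumes "\<alpha> \<in> ksubsets k n" "1 \<le> i" "i \<le> j" "j \<le> k"
  shows "elt \<alpha> i \<le> elt \<alpha> j"
  using elt_less[OF assms(1), of i j] assms by (cases "i = j") auto

lemma ksubset_eqI:
  assumes "\<alpha> \<in> ksubsets k n" "\<alpha>' \<in> ksubsets k n" "\<And>i. 1 \<le> i \<Longrightarrow> i \<le> k \<Longrightarrow> elt \<alpha> i = elt \<alpha>' i"
  shows "\<alpha> = \<alpha>'"
proof -
  have "elt \<alpha> ` {1..k} = elt \<alpha>' ` {1..k}" using assms(3) by (intro image_cong) auto
  thus ?thesis using elt_image assms(1,2) by metis
qed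

text \<open>Subsets built from two others are given by their increasing enumeration; this recovers
  the enumeration from the set.\<close>

lemma elt_of_image:
  assumes "\<And>i j. 1 \<le> i \<Longrightarrow> i < j \<Longrightarrow> j \<le> k \<Longrightarrow> c i < c j"
    and "\<And>i. 1 \<le> i \<Longrightarrow> i \<le> k \<Longrightarrow> 1 \<le> c i \<and> c i \<le> n"
  shows "c ` {1..k} \<in> ksubsets k n" and "\<And>i. 1 \<le> i \<Longrightarrow> i \<le> k \<Longrightarrow> elt (c ` {1..k}) i = c i"
proof -
  have inj: "inj_on c {1..k}"
    by (rule inj_onI) (metis assms(1) atLeastAtMost_iff less_irrefl linorder_neqE_nat)
  show "c ` {1..k} \<in> ksubsets k n"
    using assms(2) inj by (auto simp: ksubsets_def card_image)
  have "sorted_wrt (<) (map c [1..<Suc k])"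
    using assms(1) by (auto simp: sorted_wrt_map sorted_wrt_iff_nth_less simp del: upt_Suc)
  moreover have "set (map c [1..<Suc k]) = c ` {1..k}" by auto
  ultimately have *: "sorted_list_of_set (c ` {1..k}) = map c [1..<Suc k]"
    by (intro strict_sorted_equal) simp_all
  show "elt (c ` {1..k}) i = c i" if "1 \<le> i" "i \<le> k" for i
    unfolding elt_def * using that by (simp del: upt_Suc)
qed

section \<open>Minors\<close>

text \<open>The columns are given by an arbitrary function, because exchanging columns between two
  minors produces unsorted and repeated columns. Rows and columns are counted from 1.\<close>

definition cminor :: "nat \<Rightarrow> (nat \<Rightarrow> nat \<Rightarrow> 'r::comm_ring_1) \<Rightarrow> (nat \<Rightarrow> nat) \<Rightarrow> 'r" where
  "cminor k X c = det (mat k k (\<lambda>(i, j). X (i + 1) (c (j + 1))))"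

definition minor :: "nat \<Rightarrow> (nat \<Rightarrow> nat \<Rightarrow> 'r::comm_ring_1) \<Rightarrow> nat set \<Rightarrow> 'r" where
  "minor k X \<alpha> = cminor k X (elt \<alpha>)"

lemma generic_minor_eq: "generic_minor k \<alpha> = minor k (\<lambda>i j. mvar (i, j)) \<alpha>"
  by (simp add: generic_minor_def minor_def cminor_def)

lemma cminor_cong:
  assumes "\<And>i j. 1 \<le> i \<Longrightarrow> i \<le> k \<Longrightarrow> 1 \<le> j \<Longrightarrow> j \<le> k \<Longrightarrow> X i (c j) = Y i (d j)"
  shows "cminor k X c = cminor k Y d"
  unfolding cminor_def by (rule arg_cong[of _ _ det], rule eq_matI) (use assms in auto)

lemma hom_cminor:
  assumes "comm_ring_hom h"
  shows "h (cminor k X c) = cminor k (\<lambda>i j. h (X i j)) c"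
proof -
  interpret comm_ring_hom h by fact
  have "mat k k (\<lambda>(i, j). h (X (i + 1) (c (j + 1)))) = map_mat h (mat k k (\<lambda>(i, j). X (i + 1) (c (j + 1))))"
    by (rule eq_matI) auto
  thus ?thesis by (simp add: cminor_def)
qed

lemma hom_minor:
  "comm_ring_hom h \<Longrightarrow> h (minor k X \<alpha>) = minor k (\<lambda>i j. h (X i j)) \<alpha>"
  unfolding minor_def by (rule hom_cminor)

lemma cminor_not_inj:
  assumes "\<not> inj_on c {1..k}"
  shows "cminor k X c = 0"
proof -
  obtain a b where ab: "1 \<le> a" "a \<le> k" "1 \<le> b" "b \<le> k" "a \<noteq> b" "c a = c b"
    using assms by (auto simp: inj_on_def)
  let ?A = "mat k k (\<lambda>(i, j). X (i + 1) (c (j + 1)))"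
  have "det ?A = 0"
  proof (rule Determinant.det_identical_columns[of ?A k "a - 1" "b - 1"])
    show "col ?A (a - 1) = col ?A (b - 1)"
      using ab by (intro eq_vecI) auto
  qed (use ab in auto)
  thus ?thesis by (simp add: cminor_def)
qed

lemma det_zero_column:
  assumes "A \<in> carrier_mat N N" "j < N" "\<And>i. i < N \<Longrightarrow> A $$ (i, j) = 0"
  shows "det A = 0"
proof -
  have "(\<Prod>l<N. A $$ (p l, l)) = 0" if "p permutes {0..<N}" for p
  proof (rule prod_zero)
    show "\<exists>l\<in>{..<N}. A $$ (p l, l) = 0"
      using assms permutes_in_image[OF that, of j] by auto
  qed simp
  thus ?thesis by (subst det_col[OF assms(1)]) (auto intro!: sum.neutral)
qed


lemma cminor_eq_minor:
  fixes X :: "nat \<Rightarrow> nat \<Rightarrow> 'r::comm_ring_1"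
  assumes inj: "inj_on c {1..k}" and sub: "c ` {1..k} \<subseteq> {1..n}"
  shows "c ` {1..k} \<in> ksubsets k n"
    and "\<exists>s::int. (s = 1 \<or> s = -1) \<and> cminor k X c = of_int s * minor k X (c ` {1..k})"
proof -
  let ?S = "c ` {1..k}"
  show S: "?S \<in> ksubsets k n" using assms by (simp add: ksubsets_def card_image)
  define g where "g j = elt ?S (j + 1)" for j
  have "inj_on g {0..<k}"
    by (rule inj_onI) (use elt_inj[OF S] in \<open>auto simp: g_def\<close>)
  moreover have "g ` {0..<k} = ?S"
  proof -
    have "g ` {0..<k} = elt ?S ` (Suc ` {0..<k})" unfolding image_image by (simp add: g_def)
    also have "Suc ` {0..<k} = {1..k}" by (simp add: atLeastLessThanSuc_atLeastAtMost)
    finally show ?thesis using elt_image[OF S] by simp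
  qed
  ultimately have g: "bij_betw g {0..<k} ?S" by (simp add: bij_betw_def)
  have c': "bij_betw (\<lambda>j. c (j + 1)) {0..<k} ?S"
  proof -
    have "bij_betw Suc {0..<k} {1..k}"
      by (simp add: bij_betw_def atLeastLessThanSuc_atLeastAtMost)
    from bij_betw_trans[OF this, of c ?S] show ?thesis
      using inj by (simp add: bij_betw_def comp_def)
  qed
  define p where "p j = (if j < k then inv_into {0..<k} g (c (j + 1)) else j)" for j
  have "bij_betw (\<lambda>j. inv_into {0..<k} g (c (j + 1))) {0..<k} {0..<k}"
    using bij_betw_trans[OF c' bij_betw_inv_into[OF g]] by (simp add: comp_def)
  hence "bij_betw p {0..<k} {0..<k}"
    by (rule bij_betw_cong[THEN iffD1, rotated]) (simp add: p_def)
  hence p: "p permutes {0..<k}"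
    by (rule bij_imp_permutes) (simp add: p_def)
  have gp: "g (p j) = c (j + 1)" if "j < k" for j
  proof -
    have "c (j + 1) \<in> g ` {0..<k}" using that g c' by (metis atLeastLessThan_iff bij_betw_def image_eqI zero_le)
    thus ?thesis using that by (simp add: p_def f_inv_into_f)
  qed
  let ?A = "mat k k (\<lambda>(i, j). X (i + 1) (elt ?S (j + 1)))"
  have "mat k k (\<lambda>(i, j). X (i + 1) (c (j + 1)))
      = transpose_mat (mat k k (\<lambda>(i, j). transpose_mat ?A $$ (p i, j)))"
  proof (rule eq_matI)
    fix i j assume *: "i < dim_row (transpose_mat (mat k k (\<lambda>(i, j). transpose_mat ?A $$ (p i, j))))"
      "j < dim_col (transpose_mat (mat k k (\<lambda>(i, j). transpose_mat ?A $$ (p i, j))))"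
    have "p j < k" using * permutes_in_image[OF p, of j] by simp
    thus "mat k k (\<lambda>(i, j). X (i + 1) (c (j + 1))) $$ (i, j) =
      transpose_mat (mat k k (\<lambda>(i, j). transpose_mat ?A $$ (p i, j))) $$ (i, j)"
      using * gp[of j] by (simp add: g_def)
  qed auto
  hence "cminor k X c = det (mat k k (\<lambda>(i, j). transpose_mat ?A $$ (p i, j)))"
    unfolding cminor_def by (simp add: det_transpose[of _ k])
  also have "\<dots> = signof p * det (transpose_mat ?A)"
    by (rule det_permute_rows[OF _ p]) simp
  also have "det (transpose_mat ?A) = minor k X ?S"
    by (simp add: det_transpose[of _ k] minor_def cminor_def)
  finally have "cminor k X c = signof p * minor k X ?S" .
  moreover have "sign p = 1 \<or> sign p = -1" by (simp add: sign_def)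
  ultimately show "\<exists>s::int. (s = 1 \<or> s = -1) \<and> cminor k X c = of_int s * minor k X ?S"
    by blast
qed

section \<open>Laplace expansion along half of the rows\<close>

text \<open>Any bijection between subsets of equal size, joined with one between the
  complements.\<close>

lemma permutation_extending:
  assumes "finite S" "A \<subseteq> S" "B \<subseteq> S" "card A = card B"
  shows "\<exists>q. q permutes S \<and> q ` A = B"
proof -
  have fin: "finite A" "finite B" using assms finite_subset by auto
  obtain f where f: "bij_betw f A B"
    using finite_same_card_bij[OF fin assms(4)] by auto
  have "card (S - A) = card (S - B)"
    using assms fin by (simp add: card_Diff_subset)
  then obtain g where g: "bij_betw g (S - A) (S - B)"
    using finite_same_card_bij[of "S - A" "S - B"] assms(1) by auto
  define q where "q x = (if x \<in> A then f x else if x \<in> S then g x else x)" for x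
  have "bij_betw q A B" using f by (rule bij_betw_cong[THEN iffD1, rotated]) (simp add: q_def)
  moreover have "bij_betw q (S - A) (S - B)"
    using g by (rule bij_betw_cong[THEN iffD1, rotated]) (simp add: q_def)
  ultimately have "bij_betw q (A \<union> (S - A)) (B \<union> (S - B))"
    by (rule bij_betw_combine) auto
  hence "bij_betw q S S" using assms by (simp add: Un_absorb1)
  hence "q permutes S" by (rule bij_imp_permutes) (use assms in \<open>auto simp: q_def\<close>)
  moreover have "q ` A = B" using \<open>bij_betw q A B\<close> by (simp add: bij_betw_def)
  ultimately show ?thesis by blast
qed

text \<open>A permutation is determined by the set \<open>B\<close> of columns that it assigns to
  the upper rows and by a permutation that keeps the upper half. For fixed \<open>B\<close> the sum
  over the latter is the determinant of a block diagonal matrix, and no sign needs to be computed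
  beyond that of one chosen \<open>q B\<close>.\<close>

lemma laplace_half:
  fixes A :: "'r::idom mat"
  assumes A: "A \<in> carrier_mat (k + k) (k + k)"
    and q: "\<And>B. B \<subseteq> {0..<k + k} \<Longrightarrow> card B = k \<Longrightarrow> q B permutes {0..<k + k} \<and> q B ` {0..<k} = B"
  shows "det A = (\<Sum>B | B \<subseteq> {0..<k + k} \<and> card B = k. signof (q B)
      * (det (mat k k (\<lambda>(i, j). A $$ (i, q B j))) * det (mat k k (\<lambda>(i, j). A $$ (k + i, q B (k + j))))))"
proof -
  let ?N = "k + k"
  let ?P = "{p. p permutes {0..<?N}}"
  let ?Bs = "{B. B \<subseteq> {0..<?N} \<and> card B = k}"
  let ?t = "\<lambda>p. signof p * (\<Prod>i = 0..<?N. A $$ (i, p i))"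
  have finP: "finite ?P" by (simp add: finite_permutations)
  have finB: "finite ?Bs" by (rule finite_subset[of _ "Pow {0..<?N}"]) auto
  have inB: "(\<lambda>p. p ` {0..<k}) ` ?P \<subseteq> ?Bs"
  proof (clarify, intro conjI)
    fix p assume p: "p permutes {0..<?N}"
    have "p x < ?N" if "x < k" for x
      using permutes_in_image[OF p, of x] that by simp
    thus "p ` {0..<k} \<subseteq> {0..<?N}" by auto
    show "card (p ` {0..<k}) = k"
      by (subst card_image) (auto intro: inj_on_subset[OF permutes_inj[OF p]])
  qed
  have "det A = (\<Sum>p\<in>?P. ?t p)" using A by (simp add: det_def')
  also have "\<dots> = (\<Sum>B\<in>?Bs. \<Sum>p | p \<in> ?P \<and> p ` {0..<k} = B. ?t p)"
    by (rule sum.group[OF finP finB inB, symmetric])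
  also have "\<dots> = (\<Sum>B\<in>?Bs. signof (q B)
      * (det (mat k k (\<lambda>(i, j). A $$ (i, q B j))) * det (mat k k (\<lambda>(i, j). A $$ (k + i, q B (k + j))))))"
  proof (rule sum.cong[OF refl])
    fix B assume "B \<in> ?Bs"
    hence B: "q B permutes {0..<?N}" "q B ` {0..<k} = B" using q by auto
    let ?q = "q B"
    let ?A1 = "mat k k (\<lambda>(i, j). A $$ (i, ?q j))"
    let ?A4 = "mat k k (\<lambda>(i, j). A $$ (k + i, ?q (k + j)))"
    \<comment> \<open>Its permutation terms are those of the permutations that preserve the two
      halves.\<close>
    let ?AB = "mat ?N ?N (\<lambda>(i, j). if (i < k) = (j < k) then A $$ (i, ?q j) else 0)"
    have "?AB = four_block_mat ?A1 (0\<^sub>m k k) (0\<^sub>m k k) ?A4"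
    proof (rule eq_matI)
      fix i j assume "i < dim_row (four_block_mat ?A1 (0\<^sub>m k k) (0\<^sub>m k k) ?A4)"
        "j < dim_col (four_block_mat ?A1 (0\<^sub>m k k) (0\<^sub>m k k) ?A4)"
      hence ij: "i < k + k" "j < k + k" by simp_all
      show "?AB $$ (i, j) = four_block_mat ?A1 (0\<^sub>m k k) (0\<^sub>m k k) ?A4 $$ (i, j)"
        using ij by (cases "i < k"; cases "j < k") (simp_all add: index_mat_four_block)
    qed (simp_all add: index_mat_four_block)
    hence "det ?A1 * det ?A4 = det ?AB"
      by (simp add: det_four_block_mat_upper_right_zero[of _ k _ k])
    also have "\<dots> = (\<Sum>p\<in>?P. signof p * (\<Prod>i = 0..<?N. ?AB $$ (i, p i)))"
      by (rule det_def') simp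
    also have "\<dots> = (\<Sum>p | p \<in> ?P \<and> p ` {0..<k} = {0..<k}. signof p * (\<Prod>i = 0..<?N. A $$ (i, ?q (p i))))"
    proof (rule sum.mono_neutral_cong_right)
      show "finite ?P" by (rule finP)
      show "\<forall>p\<in>?P - {p. p \<in> ?P \<and> p ` {0..<k} = {0..<k}}. signof p * (\<Prod>i = 0..<?N. ?AB $$ (i, p i)) = 0"
      proof
        fix p assume p: "p \<in> ?P - {p. p \<in> ?P \<and> p ` {0..<k} = {0..<k}}"
        hence pp: "p permutes {0..<?N}" "p ` {0..<k} \<noteq> {0..<k}" by auto
        have "\<not> p ` {0..<k} \<subseteq> {0..<k}"
        proof
          assume "p ` {0..<k} \<subseteq> {0..<k}"
          moreover have "card (p ` {0..<k}) = card {0..<k}"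
            by (rule card_image) (auto intro: inj_on_subset[OF permutes_inj[OF pp(1)]])
          ultimately show False using pp(2) by (metis card_subset_eq finite_atLeastLessThan)
        qed
        then obtain y where "y \<in> p ` {0..<k}" "y \<notin> {0..<k}" by blast
        then obtain i where i: "i < k" "\<not> p i < k" by auto
        have "p i < ?N" using permutes_in_image[OF pp(1), of i] i by auto
        hence "(\<Prod>i = 0..<?N. ?AB $$ (i, p i)) = 0"
          using i by (intro prod_zero) (auto intro!: bexI[of _ i])
        thus "signof p * (\<Prod>i = 0..<?N. ?AB $$ (i, p i)) = 0" by simp
      qed
    next
      fix p assume p: "p \<in> {p. p \<in> ?P \<and> p ` {0..<k} = {0..<k}}"
      hence pp: "p permutes {0..<?N}" "p ` {0..<k} = {0..<k}" by auto
      have iff: "p i < k \<longleftrightarrow> i < k" for i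
      proof
        assume "p i < k"
        hence "p i \<in> p ` {0..<k}" unfolding pp(2) by simp
        thus "i < k" using permutes_inj[OF pp(1)] by (simp add: inj_image_mem_iff)
      next
        assume "i < k"
        hence "p i \<in> p ` {0..<k}" by simp
        thus "p i < k" unfolding pp(2) by simp
      qed
      have "?AB $$ (i, p i) = A $$ (i, ?q (p i))" if "i < ?N" for i
        using that permutes_in_image[OF pp(1), of i] iff[of i] by simp
      thus "signof p * (\<Prod>i = 0..<?N. ?AB $$ (i, p i)) = signof p * (\<Prod>i = 0..<?N. A $$ (i, ?q (p i)))"
        by simp
    qed auto
    finally have *: "signof ?q * (det ?A1 * det ?A4)
        = (\<Sum>p | p \<in> ?P \<and> p ` {0..<k} = {0..<k}. signof ?q * (signof p * (\<Prod>i = 0..<?N. A $$ (i, ?q (p i)))))"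
      by (simp add: sum_distrib_left)
    have inv: "Hilbert_Choice.inv ?q permutes {0..<?N}" by (rule permutes_inv[OF B(1)])
    have qi: "?q (Hilbert_Choice.inv ?q x) = x" "Hilbert_Choice.inv ?q (?q x) = x" for x
      using permutes_inverses[OF B(1)] by auto
    have "(\<Sum>p | p \<in> ?P \<and> p ` {0..<k} = {0..<k}. signof ?q * (signof p * (\<Prod>i = 0..<?N. A $$ (i, ?q (p i)))))
        = (\<Sum>p | p \<in> ?P \<and> p ` {0..<k} = B. ?t p)"
    proof (rule sum.reindex_bij_witness[where i = "\<lambda>p. Hilbert_Choice.inv ?q \<circ> p" and j = "\<lambda>p. ?q \<circ> p"])
      fix p assume "p \<in> {p. p \<in> ?P \<and> p ` {0..<k} = {0..<k}}"
      hence pp: "p permutes {0..<?N}" "p ` {0..<k} = {0..<k}" by auto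
      show "Hilbert_Choice.inv ?q \<circ> (?q \<circ> p) = p" by (auto simp: qi)
      have "(?q \<circ> p) ` {0..<k} = B" by (metis image_comp B(2) pp(2))
      thus "?q \<circ> p \<in> {p. p \<in> ?P \<and> p ` {0..<k} = B}"
        using permutes_compose[OF pp(1) B(1)] by simp
      have "permutation ?q" "permutation p"
        using B(1) pp(1) by (auto simp: permutation_permutes)
      hence "sign (?q \<circ> p) = sign ?q * sign p" by (rule sign_compose)
      thus "?t (?q \<circ> p) = signof ?q * (signof p * (\<Prod>i = 0..<?N. A $$ (i, ?q (p i))))"
        by simp
    next
      fix p assume "p \<in> {p. p \<in> ?P \<and> p ` {0..<k} = B}"
      hence pp: "p permutes {0..<?N}" "p ` {0..<k} = B" by auto
      show "?q \<circ> (Hilbert_Choice.inv ?q \<circ> p) = p" by (auto simp: qi)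
      have "Hilbert_Choice.inv ?q ` (?q ` {0..<k}) = {0..<k}" by (simp only: image_image qi) simp
      hence "Hilbert_Choice.inv ?q ` B = {0..<k}" by (simp only: B(2))
      hence "(Hilbert_Choice.inv ?q \<circ> p) ` {0..<k} = {0..<k}" by (metis image_comp pp(2))
      thus "Hilbert_Choice.inv ?q \<circ> p \<in> {p. p \<in> ?P \<and> p ` {0..<k} = {0..<k}}"
        using permutes_compose[OF pp(1) inv] by simp
    qed
    with * show "(\<Sum>p | p \<in> ?P \<and> p ` {0..<k} = B. ?t p) = signof ?q * (det ?A1 * det ?A4)"
      by simp
  qed
  finally show ?thesis .
qed

section \<open>The straightening relation\<close>

text \<open>Comparing these numbers is comparing sets by the largest element of their symmetric
  difference.\<close>

definition colex_weight :: "nat set \<Rightarrow> nat" where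
  "colex_weight S = (\<Sum>a\<in>S. 2 ^ a)"

lemma colex_weight_less:
  assumes "finite S" "\<And>a. a \<in> S \<Longrightarrow> a \<le> m"
  shows "colex_weight S < 2 ^ Suc m"
proof -
  have "colex_weight S \<le> (\<Sum>a\<in>{0..<Suc m}. 2 ^ a)"
    unfolding colex_weight_def by (rule sum_mono2) (use assms in \<open>auto simp: less_Suc_eq_le\<close>)
  also have "\<dots> = 2 ^ Suc m - 1" by (rule sum_power2)
  also have "\<dots> < 2 ^ Suc m" by simp
  finally show ?thesis .
qed

text \<open>The \<open>k + 1\<close> columns \<open>\<alpha>'(1) < \<dots> < \<alpha>'(r+1) <
  \<alpha>(r+1) < \<dots> < \<alpha>(k)\<close> are linearly dependent in dimension
  \<open>k\<close>, so the alternating sum over the ways of distributing them to the two minors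
  vanishes. It arises as the Laplace expansion of a singular \<open>2k \<times> 2k\<close>
  determinant. In every term except the original one some \<open>\<alpha>(l)\<close> with \<open>l >
  r\<close> has replaced a smaller element of \<open>\<alpha>'\<close>, which makes the second set
  larger.\<close>

lemma garnir_relation:
  fixes X :: "nat \<Rightarrow> nat \<Rightarrow> 'r::idom"
  assumes a: "\<alpha> \<in> ksubsets k n" and a': "\<alpha>' \<in> ksubsets k n"
    and r: "r < k" and gt: "elt \<alpha>' (r + 1) < elt \<alpha> (r + 1)"
  shows "\<exists>(I :: nat set set) \<mu> \<nu> (s :: nat set \<Rightarrow> int). finite I
    \<and> (\<forall>B\<in>I. \<mu> B \<in> ksubsets k n \<and> \<nu> B \<in> ksubsets k n \<and> colex_weight \<alpha>' < colex_weight (\<nu> B))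
    \<and> minor k X \<alpha> * minor k X \<alpha>' = (\<Sum>B\<in>I. of_int (s B) * (minor k X (\<mu> B) * minor k X (\<nu> B)))"
proof -
  \<comment> \<open>The columns of the large matrix: \<open>\<alpha>(1..r)\<close> on top, the
    \<open>k + 1\<close> dependent columns in both halves, \<open>\<alpha>'(r+2..k)\<close>
    below.\<close>
  define cl where "cl j = (if j < r then elt \<alpha> (j + 1) else if j < 2 * r + 1 then elt \<alpha>' (j - r + 1)
    else if j < r + k + 1 then elt \<alpha> (j - r) else elt \<alpha>' (j - k + 1))" for j
  let ?N = "k + k"
  let ?Bs = "{B. B \<subseteq> {0..<?N} \<and> card B = k}"
  define A where "A = mat ?N ?N (\<lambda>(i, j). if i < k then (if j < r + k + 1 then X (i + 1) (cl j) else 0)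
    else (if r \<le> j then X (i - k + 1) (cl j) else 0))"
  have cl_range: "1 \<le> cl j \<and> cl j \<le> n" if "j < ?N" for j
    unfolding cl_def using that r elt_mem[OF a] elt_mem[OF a'] by auto
  have "\<forall>B. \<exists>q. B \<in> ?Bs \<longrightarrow> q permutes {0..<?N} \<and> q ` {0..<k} = B"
    using permutation_extending[of "{0..<?N}" "{0..<k}"] by fastforce
  then obtain q where q: "\<And>B. B \<in> ?Bs \<Longrightarrow> q B permutes {0..<?N} \<and> q B ` {0..<k} = B"
    by metis
  have qless: "q B j < ?N" if "B \<in> ?Bs" "j < ?N" for B j
    using permutes_in_image[of "q B" "{0..<?N}" j] q[OF that(1)] that(2) by simp
  have qinj: "inj (q B)" if "B \<in> ?Bs" for B
    using permutes_inj q[OF that] by blast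
  have qmem: "q B j \<in> B" if "B \<in> ?Bs" "j < k" for B j
  proof -
    have "q B j \<in> q B ` {0..<k}" using that(2) by simp
    thus ?thesis using q[OF that(1)] by blast
  qed
  have qpre: "\<exists>j<k. x = q B j" if "B \<in> ?Bs" "x \<in> B" for B x
  proof -
    have "x \<in> q B ` {0..<k}" using q[OF that(1)] that(2) by blast
    thus ?thesis by auto
  qed
  have qcompl: "q B ` {k..<?N} = {0..<?N} - B" if "B \<in> ?Bs" for B
  proof -
    have "q B ` ({0..<?N} - {0..<k}) = q B ` {0..<?N} - q B ` {0..<k}"
      by (rule image_set_diff[OF qinj[OF that]])
    moreover have "{0..<?N} - {0..<k} = {k..<?N}" by auto
    ultimately show ?thesis using q[OF that] permutes_image by metis
  qed
  define D1 where "D1 M B = det (mat k k (\<lambda>(i, j). M $$ (i, q B j)))" for M :: "'r mat" and B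
  define D2 where "D2 M B = det (mat k k (\<lambda>(i, j). M $$ (k + i, q B (k + j))))" for M :: "'r mat" and B
  have laplace: "det M = (\<Sum>B\<in>?Bs. signof (q B) * (D1 M B * D2 M B))"
    if "M \<in> carrier_mat ?N ?N" for M :: "'r mat"
    unfolding D1_def D2_def using laplace_half[OF that, of q] q by simp

  text \<open>Subtracting the upper block row from the lower one leaves only \<open>k - 1\<close> columns with a
    nonzero lower part, too few for a nonzero minor.\<close>
  have detA: "det A = 0"
  proof -
    let ?L = "four_block_mat (1\<^sub>m k) (0\<^sub>m k k) (- 1\<^sub>m k) (1\<^sub>m k) :: 'r mat"
    have L: "?L \<in> carrier_mat ?N ?N" by simp
    have A: "A \<in> carrier_mat ?N ?N" by (simp add: A_def)
    have "det ?L = 1" by (subst det_four_block_mat_upper_right_zero[of _ k _ k]) simp_all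
    hence "det A = det (?L * A)" by (simp add: det_mult[OF L A])
    also have "\<dots> = (\<Sum>B\<in>?Bs. signof (q B) * (D1 (?L * A) B * D2 (?L * A) B))"
      by (rule laplace[OF mult_carrier_mat[OF L A]])
    also have "\<dots> = 0"
    proof (rule sum.neutral, rule ballI)
      fix B assume B: "B \<in> ?Bs"
      let ?J = "{0..<r} \<union> {r + k + 1..<?N}"
      have "\<not> q B ` {k..<?N} \<subseteq> ?J"
      proof
        assume "q B ` {k..<?N} \<subseteq> ?J"
        hence "card (q B ` {k..<?N}) \<le> card ?J" by (rule card_mono[rotated]) simp
        moreover have "card (q B ` {k..<?N}) = k"
          using qinj[OF B] by (simp add: card_image inj_on_subset)
        moreover have "card ?J \<le> r + (?N - (r + k + 1))"
          using card_Un_le[of "{0..<r}" "{r + k + 1..<?N}"] by simp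
        ultimately show False using r by simp
      qed
      then obtain j where j: "j < k" "q B (k + j) \<notin> ?J"
        by (metis (no_types, lifting) add_less_cancel_left atLeastLessThan_iff image_subsetI le_Suc_ex)
      have qj: "r \<le> q B (k + j)" "q B (k + j) < r + k + 1" "q B (k + j) < ?N"
        using j qless[OF B, of "k + j"] by auto
      have "(?L * A) $$ (k + i, q B (k + j)) = 0" if "i < k" for i
      proof -
        let ?c = "q B (k + j)"
        have "(?L * A) $$ (k + i, ?c) = (\<Sum>l\<in>{0..<?N}. ?L $$ (k + i, l) * A $$ (l, ?c))"
          using that qj L A by (simp add: scalar_prod_def)
        also have "\<dots> = (\<Sum>l\<in>{0..<?N}. (if l = k + i then A $$ (l, ?c) else 0)
            - (if l = i then A $$ (l, ?c) else 0))"
          by (rule sum.cong) (use that in auto)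
        also have "\<dots> = A $$ (k + i, ?c) - A $$ (i, ?c)"
          using that by (simp add: sum_subtractf)
        also have "\<dots> = 0" using that qj by (simp add: A_def)
        finally show ?thesis .
      qed
      hence "D2 (?L * A) B = 0"
        unfolding D2_def using j(1) by (intro det_zero_column[where N = k and j = j]) simp_all
      thus "signof (q B) * (D1 (?L * A) B * D2 (?L * A) B) = 0" by simp
    qed
    finally show ?thesis .
  qed

  define c1 where "c1 B j = cl (q B (j - 1))" for B j
  define c2 where "c2 B j = cl (q B (k + j - 1))" for B j
  have im1: "c1 B ` {1..k} = cl ` B" if "B \<in> ?Bs" for B
  proof -
    have "(\<lambda>j. j - 1) ` {1..k} = {0..<k}"
      by (force simp: image_iff Bex_def intro: exI[of _ "Suc _"])
    hence "c1 B ` {1..k} = cl ` (q B ` {0..<k})" by (metis (no_types, lifting) c1_def image_cong image_image)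
    thus ?thesis using q[OF that] by simp
  qed
  have im2: "c2 B ` {1..k} = cl ` ({0..<?N} - B)" if "B \<in> ?Bs" for B
  proof -
    have "(\<lambda>j. k + j - 1) ` {1..k} = {k..<?N}"
    proof (intro equalityI subsetI)
      fix x assume "x \<in> {k..<?N}"
      thus "x \<in> (\<lambda>j. k + j - 1) ` {1..k}" by (intro image_eqI[of _ _ "x - k + 1"]) auto
    qed auto
    hence "c2 B ` {1..k} = cl ` (q B ` {k..<?N})" by (metis (no_types, lifting) c2_def image_cong image_image)
    thus ?thesis using qcompl[OF that] by simp
  qed
  have D1: "D1 A B = cminor k X (c1 B) \<and> B \<subseteq> {0..<r + k + 1} \<or> D1 A B = 0" if B: "B \<in> ?Bs" for B
  proof (cases "B \<subseteq> {0..<r + k + 1}")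
    case True
    have "q B j < r + k + 1" if "j < k" for j
      using True qmem[OF B that] by auto
    hence "D1 A B = cminor k X (c1 B)"
      unfolding D1_def cminor_def c1_def using qless[OF B]
      by (intro arg_cong[of _ _ det] eq_matI) (auto simp: A_def)
    with True show ?thesis by simp
  next
    case False
    then obtain x where "x \<in> B" "x \<notin> {0..<r + k + 1}" by blast
    hence x: "x \<in> B" "\<not> x < r + k + 1" by simp_all
    then obtain j where "j < k" "\<not> q B j < r + k + 1" using qpre[OF B] by metis
    hence "D1 A B = 0"
      unfolding D1_def using qless[OF B, of j]
      by (intro det_zero_column[where N = k and j = j]) (auto simp: A_def)
    thus ?thesis by simp
  qed
  have D2: "D2 A B = cminor k X (c2 B) \<and> {0..<r} \<subseteq> B \<or> D2 A B = 0" if B: "B \<in> ?Bs" for B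
  proof (cases "{0..<r} \<subseteq> B")
    case True
    have "r \<le> q B (k + j)" if "j < k" for j
    proof (rule ccontr)
      assume "\<not> r \<le> q B (k + j)"
      hence "q B (k + j) \<in> B" using True by auto
      moreover have "q B (k + j) \<in> q B ` {k..<?N}" using that by auto
      ultimately show False using qcompl[OF B] by auto
    qed
    hence "D2 A B = cminor k X (c2 B)"
      unfolding D2_def cminor_def c2_def using qless[OF B]
      by (intro arg_cong[of _ _ det] eq_matI) (auto simp: A_def)
    with True show ?thesis by simp
  next
    case False
    then obtain x where "x \<in> {0..<r}" "x \<notin> B" by blast
    hence x: "x < r" "x \<notin> B" by simp_all
    hence "x \<in> q B ` {k..<?N}" using qcompl[OF B] r by auto
    then obtain y where y: "k \<le> y" "y < ?N" "q B y = x" by auto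
    define j where "j = y - k"
    have "j < k" "q B (k + j) = x" using y by (auto simp: j_def)
    hence "D2 A B = 0"
      unfolding D2_def using x(1) r
      by (intro det_zero_column[where N = k and j = j]) (auto simp: A_def)
    thus ?thesis by simp
  qed

  \<comment> \<open>The distribution that gives back the two original minors.\<close>
  define B0 where "B0 = {0..<r} \<union> {2 * r + 1..<r + k + 1}"
  have B0: "B0 \<in> ?Bs"
  proof -
    have "card B0 = r + (k - r)"
      unfolding B0_def by (subst card_Un_disjoint) (use r in auto)
    thus ?thesis using r by (auto simp: B0_def)
  qed
  have clB0: "cl ` B0 = \<alpha>"
  proof -
    have "\<alpha> \<subseteq> cl ` B0"
    proof
      fix x assume "x \<in> \<alpha>"
      then obtain i where i: "1 \<le> i" "i \<le> k" "x = elt \<alpha> i" using elt_image[OF a] by (metis atLeastAtMost_iff imageE)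
      show "x \<in> cl ` B0"
      proof (cases "i \<le> r")
        case True
        then show ?thesis using i by (intro image_eqI[of _ _ "i - 1"]) (auto simp: cl_def B0_def)
      next
        case False
        then show ?thesis using i by (intro image_eqI[of _ _ "i + r"]) (auto simp: cl_def B0_def)
      qed
    qed
    moreover have "cl ` B0 \<subseteq> \<alpha>"
      using elt_mem(1)[OF a] r by (auto simp: cl_def B0_def)
    ultimately show ?thesis by blast
  qed
  have clB0': "cl ` ({0..<?N} - B0) = \<alpha>'"
  proof -
    have "\<alpha>' \<subseteq> cl ` ({0..<?N} - B0)"
    proof
      fix x assume "x \<in> \<alpha>'"
      then obtain i where i: "1 \<le> i" "i \<le> k" "x = elt \<alpha>' i" using elt_image[OF a'] by (metis atLeastAtMost_iff imageE)
      show "x \<in> cl ` ({0..<?N} - B0)"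
      proof (cases "i \<le> r + 1")
        case True
        then show ?thesis using i r by (intro image_eqI[of _ _ "i - 1 + r"]) (auto simp: cl_def B0_def)
      next
        case False
        then show ?thesis using i by (intro image_eqI[of _ _ "i - 1 + k"]) (auto simp: cl_def B0_def)
      qed
    qed
    moreover have "cl ` ({0..<?N} - B0) \<subseteq> \<alpha>'"
      using elt_mem(1)[OF a'] r by (auto simp: cl_def B0_def)
    ultimately show ?thesis by blast
  qed
  have sgn: "signof p = (1 :: 'r) \<or> signof p = (-1 :: 'r)" for p :: "nat \<Rightarrow> nat"
    by (simp add: sign_def)
  have fin: "finite ?Bs" by (rule finite_subset[of _ "Pow {0..<?N}"]) auto
  have cases: "(\<exists>s :: int. (s = 1 \<or> s = -1) \<and>
        signof (q B) * (D1 A B * D2 A B) = of_int s * (minor k X (cl ` B) * minor k X (cl ` ({0..<?N} - B))))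
      \<and> cl ` B \<in> ksubsets k n \<and> cl ` ({0..<?N} - B) \<in> ksubsets k n"
    if B: "B \<in> ?Bs" and *: "{0..<r} \<subseteq> B" "B \<subseteq> {0..<r + k + 1}"
      "D1 A B = cminor k X (c1 B)" "D2 A B = cminor k X (c2 B)"
      and inj: "inj_on (c1 B) {1..k}" "inj_on (c2 B) {1..k}" for B
  proof -
    have sub: "c1 B ` {1..k} \<subseteq> {1..n}" "c2 B ` {1..k} \<subseteq> {1..n}"
      using cl_range qless[OF B] by (auto simp: c1_def c2_def)
    obtain s1 :: int where s1: "s1 = 1 \<or> s1 = -1" "D1 A B = of_int s1 * minor k X (cl ` B)"
      using cminor_eq_minor(2)[OF inj(1) sub(1), of X] *(3) im1[OF B] by auto
    obtain s2 :: int where s2: "s2 = 1 \<or> s2 = -1" "D2 A B = of_int s2 * minor k X (cl ` ({0..<?N} - B))"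
      using cminor_eq_minor(2)[OF inj(2) sub(2), of X] *(4) im2[OF B] by auto
    have "sign (q B) * s1 * s2 = 1 \<or> sign (q B) * s1 * s2 = -1"
      using s1(1) s2(1) by (auto simp: sign_def)
    moreover have "signof (q B) * (D1 A B * D2 A B)
        = of_int (sign (q B) * s1 * s2) * (minor k X (cl ` B) * minor k X (cl ` ({0..<?N} - B)))"
      by (simp add: s1(2) s2(2))
    ultimately show ?thesis
      using cminor_eq_minor(1)[OF inj(1) sub(1)] cminor_eq_minor(1)[OF inj(2) sub(2)] im1[OF B] im2[OF B]
      by metis
  qed

  define I where "I = {B \<in> ?Bs - {B0}. D1 A B * D2 A B \<noteq> 0}"
  have I: "\<exists>s :: int. signof (q B) * (D1 A B * D2 A B)
        = of_int s * (minor k X (cl ` B) * minor k X (cl ` ({0..<?N} - B)))"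
      "cl ` B \<in> ksubsets k n" "cl ` ({0..<?N} - B) \<in> ksubsets k n"
      "colex_weight \<alpha>' < colex_weight (cl ` ({0..<?N} - B))" if "B \<in> I" for B
  proof -
    have B: "B \<in> ?Bs" "B \<noteq> B0" "D1 A B \<noteq> 0" "D2 A B \<noteq> 0" using that by (auto simp: I_def)
    have *: "{0..<r} \<subseteq> B" "B \<subseteq> {0..<r + k + 1}" "D1 A B = cminor k X (c1 B)" "D2 A B = cminor k X (c2 B)"
      using D1[OF B(1)] D2[OF B(1)] B(3,4) by auto
    have inj1: "inj_on (c1 B) {1..k}" using cminor_not_inj[of "c1 B" k X] B(3) *(3) by auto
    have inj2: "inj_on (c2 B) {1..k}" using cminor_not_inj[of "c2 B" k X] B(4) *(4) by auto
    note inj = inj1 inj2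
    from cases[OF B(1) * inj] show "\<exists>s :: int. signof (q B) * (D1 A B * D2 A B)
        = of_int s * (minor k X (cl ` B) * minor k X (cl ` ({0..<?N} - B)))"
      "cl ` B \<in> ksubsets k n" "cl ` ({0..<?N} - B) \<in> ksubsets k n" by auto
    let ?\<nu> = "cl ` ({0..<?N} - B)"
    have "\<not> B0 \<subseteq> B"
    proof
      assume "B0 \<subseteq> B"
      moreover have "finite B" using B(1) finite_subset by auto
      moreover have "card B0 = card B" using B(1) B0 by simp
      ultimately show False using card_subset_eq B(2) by blast
    qed
    then obtain x where x: "x \<in> B0" "x \<notin> B" by auto
    hence x': "2 * r + 1 \<le> x" "x < r + k + 1" using *(1) by (auto simp: B0_def)
    have clx: "elt \<alpha> (r + 1) \<le> cl x"
      using elt_le[OF a, of "r + 1" "x - r"] x' by (simp add: cl_def)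
    let ?b = "cl ` {r + k + 1..<?N}"
    have \<nu>: "?\<nu> \<in> ksubsets k n" by fact
    have inj2: "inj_on cl ({0..<?N} - B)"
    proof (rule eq_card_imp_inj_on)
      have "finite B" using B(1) finite_subset by auto
      hence "card ({0..<?N} - B) = k" using B(1) by (simp add: card_Diff_subset)
      thus "card ?\<nu> = card ({0..<?N} - B)" using \<nu> by (simp add: ksubsets_def)
    qed simp
    have notb: "cl x \<notin> ?b"
    proof
      assume "cl x \<in> ?b"
      then obtain y where y: "cl x = cl y" "r + k + 1 \<le> y" "y < ?N" by auto
      have "y \<notin> B" using *(2) y(2) by auto
      hence "y \<in> {0..<?N} - B" "x \<in> {0..<?N} - B" using y x(2) x' r by simp_all
      hence "x = y" using inj_onD[OF inj2 y(1)] by simp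
      thus False using x' y by simp
    qed
    have "insert x {r + k + 1..<?N} \<subseteq> {0..<?N} - B" using *(2) x(2) x' r by auto
    from image_mono[OF this, of cl] have sub: "insert (cl x) ?b \<subseteq> ?\<nu>" by simp
    have "\<alpha>' = elt \<alpha>' ` {1..r + 1} \<union> ?b"
    proof (intro equalityI subsetI)
      fix y assume "y \<in> \<alpha>'"
      then obtain i where i: "1 \<le> i" "i \<le> k" "y = elt \<alpha>' i" using elt_image[OF a'] by (metis atLeastAtMost_iff imageE)
      show "y \<in> elt \<alpha>' ` {1..r + 1} \<union> ?b"
      proof (cases "i \<le> r + 1")
        case False
        then show ?thesis using i by (intro UnI2 image_eqI[of _ _ "i - 1 + k"]) (auto simp: cl_def)
      qed (use i in auto)
    next
      fix y assume "y \<in> elt \<alpha>' ` {1..r + 1} \<union> ?b"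
      thus "y \<in> \<alpha>'" using elt_mem(1)[OF a'] r by (auto simp: cl_def)
    qed
    hence "colex_weight \<alpha>' \<le> colex_weight (elt \<alpha>' ` {1..r + 1}) + colex_weight ?b"
      unfolding colex_weight_def
      by (metis (no_types, lifting) finite_atLeastAtMost finite_atLeastLessThan finite_imageI le_add1 sum.union_inter)
    also have "colex_weight (elt \<alpha>' ` {1..r + 1}) < 2 ^ Suc (elt \<alpha>' (r + 1))"
      by (rule colex_weight_less) (use elt_le[OF a'] r in auto)
    also have "(2 :: nat) ^ Suc (elt \<alpha>' (r + 1)) \<le> 2 ^ cl x"
      by (rule power_increasing) (use gt clx in auto)
    also have "2 ^ cl x + colex_weight ?b = colex_weight (insert (cl x) ?b)"
      unfolding colex_weight_def using notb by simp
    also have "\<dots> \<le> colex_weight ?\<nu>"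
      unfolding colex_weight_def by (rule sum_mono2) (use sub in auto)
    finally show "colex_weight \<alpha>' < colex_weight ?\<nu>" by simp
  qed
  have "\<exists>s :: int. (s = 1 \<or> s = -1) \<and>
      signof (q B0) * (D1 A B0 * D2 A B0) = of_int s * (minor k X \<alpha> * minor k X \<alpha>')"
  proof -
    have "inj_on (c1 B0) {1..k}" "inj_on (c2 B0) {1..k}"
      using im1[OF B0] im2[OF B0] clB0 clB0' a a' by (auto intro!: eq_card_imp_inj_on simp: ksubsets_def)
    moreover have "D1 A B0 = cminor k X (c1 B0)"
    proof -
      have "q B0 j < r + k + 1" if "j < k" for j
        using qmem[OF B0 that] r by (auto simp: B0_def)
      thus ?thesis unfolding D1_def cminor_def c1_def using qless[OF B0]
        by (intro arg_cong[of _ _ det] eq_matI) (auto simp: A_def)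
    qed
    moreover have "D2 A B0 = cminor k X (c2 B0)"
    proof -
      have "r \<le> q B0 (k + j)" if "j < k" for j
      proof -
        have "q B0 (k + j) \<in> q B0 ` {k..<?N}" using that by auto
        thus ?thesis using qcompl[OF B0] by (auto simp: B0_def)
      qed
      thus ?thesis unfolding D2_def cminor_def c2_def using qless[OF B0]
        by (intro arg_cong[of _ _ det] eq_matI) (auto simp: A_def)
    qed
    ultimately show ?thesis using cases[OF B0] clB0 clB0' r by (auto simp: B0_def)
  qed
  then obtain s0 :: int where s0: "s0 = 1 \<or> s0 = -1"
    "signof (q B0) * (D1 A B0 * D2 A B0) = of_int s0 * (minor k X \<alpha> * minor k X \<alpha>')" by blast
  obtain s :: "nat set \<Rightarrow> int" where s: "\<And>B. B \<in> I \<Longrightarrow> signof (q B) * (D1 A B * D2 A B)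
      = of_int (s B) * (minor k X (cl ` B) * minor k X (cl ` ({0..<?N} - B)))"
    using I(1) by metis
  have "0 = (\<Sum>B\<in>?Bs. signof (q B) * (D1 A B * D2 A B))"
    using laplace[of A] detA by (simp add: A_def)
  also have "\<dots> = signof (q B0) * (D1 A B0 * D2 A B0) + (\<Sum>B\<in>?Bs - {B0}. signof (q B) * (D1 A B * D2 A B))"
    by (rule sum.remove[OF fin B0])
  also have "(\<Sum>B\<in>?Bs - {B0}. signof (q B) * (D1 A B * D2 A B)) = (\<Sum>B\<in>I. signof (q B) * (D1 A B * D2 A B))"
    by (rule sum.mono_neutral_right) (use fin in \<open>auto simp: I_def\<close>)
  also have "\<dots> = (\<Sum>B\<in>I. of_int (s B) * (minor k X (cl ` B) * minor k X (cl ` ({0..<?N} - B))))"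
    by (rule sum.cong) (use s in auto)
  finally have sum0: "of_int s0 * (minor k X \<alpha> * minor k X \<alpha>')
      = - (\<Sum>B\<in>I. of_int (s B) * (minor k X (cl ` B) * minor k X (cl ` ({0..<?N} - B))))"
    by (simp add: s0(2) add_eq_0_iff)
  have "minor k X \<alpha> * minor k X \<alpha>' = of_int s0 * (of_int s0 * (minor k X \<alpha> * minor k X \<alpha>'))"
    using s0(1) by auto
  also have "\<dots> = (\<Sum>B\<in>I. of_int (- s0 * s B) * (minor k X (cl ` B) * minor k X (cl ` ({0..<?N} - B))))"
    unfolding sum0 by (simp add: sum_distrib_left sum_negf mult.assoc)
  finally have "minor k X \<alpha> * minor k X \<alpha>'
      = (\<Sum>B\<in>I. of_int (- s0 * s B) * (minor k X (cl ` B) * minor k X (cl ` ({0..<?N} - B))))" .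
  moreover have "finite I" using fin by (auto simp: I_def)
  ultimately show ?thesis using I(2-4)
    by (intro exI[of _ I] exI[of _ "\<lambda>B. cl ` B"] exI[of _ "\<lambda>B. cl ` ({0..<?N} - B)"]
        exI[of _ "\<lambda>B. - s0 * s B"]) auto
qed

section \<open>Standard monomials span\<close>

lemma plucker_ideal_iff:
  "p \<in> plucker_ideal k n \<longleftrightarrow> mvars p \<subseteq> ksubsets k n \<and> msubst (generic_minor k) p = 0"
  by (auto simp: plucker_ideal_def a_kernel_def kernel_def mpoly_ring_def)

lemma ksub_le_refl: "ksub_le k \<alpha> \<alpha>"
  by (simp add: ksub_le_def)


lemma interval_ksubset: "\<alpha> \<in> ksub_interval k n \<beta> \<gamma> \<Longrightarrow> \<alpha> \<in> ksubsets k n"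
  by (simp add: ksub_interval_def)

text \<open>Chains may repeat elements; they encode the standard monomials.\<close>

definition standard_list :: "nat \<Rightarrow> nat \<Rightarrow> nat set \<Rightarrow> nat set \<Rightarrow> nat set list \<Rightarrow> bool" where
  "standard_list k n \<beta> \<gamma> xs \<longleftrightarrow> sorted_wrt (ksub_le k) xs \<and> set xs \<subseteq> ksub_interval k n \<beta> \<gamma>"

definition coord_prod :: "nat set list \<Rightarrow> (nat set, 'k::comm_ring_1) mpoly" where
  "coord_prod xs = prod_list (map mvar xs)"

lemma coord_prod_simps [simp]: "coord_prod [] = 1" "coord_prod (x # xs) = mvar x * coord_prod xs"
  by (simp_all add: coord_prod_def)

lemma coord_prod_mset_cong: "mset xs = mset ys \<Longrightarrow> coord_prod xs = coord_prod ys"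
  unfolding coord_prod_def by (metis mset_map prod_mset_prod_list)

lemma coord_prod_remove1: "x \<in> set xs \<Longrightarrow> coord_prod xs = mvar x * coord_prod (remove1 x xs)"
  using coord_prod_mset_cong[of xs "x # remove1 x xs"] by simp

lemma mvars_coord_prod: "mvars (coord_prod xs :: (nat set, 'k::comm_ring_1) mpoly) \<subseteq> set xs"
proof (induction xs)
  case (Cons x xs)
  then show ?case using mvars_mult[of "mvar x :: (nat set, 'k) mpoly" "coord_prod xs"] by auto
qed simp

text \<open>Sorting by the sum of the elements refines the partial order.\<close>

lemma comparable_sort:
  assumes "set xs \<subseteq> ksubsets k n"
    and comp: "\<And>a b. a \<in> set xs \<Longrightarrow> b \<in> set xs \<Longrightarrow> ksub_le k a b \<or> ksub_le k b a"
  shows "\<exists>ys. mset ys = mset xs \<and> sorted_wrt (ksub_le k) ys"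
proof -
  define f where "f a = (\<Sum>i=1..k. elt a i)" for a
  have "sorted_wrt (\<lambda>a b. f a \<le> f b) (sort_key f xs)"
    using sorted_sort_key[of f xs] by (simp add: sorted_map)
  hence "sorted_wrt (ksub_le k) (sort_key f xs)"
  proof (rule sorted_wrt_mono_rel[rotated])
    fix a b assume ab: "a \<in> set (sort_key f xs)" "b \<in> set (sort_key f xs)" "f a \<le> f b"
    show "ksub_le k a b"
    proof (rule ccontr)
      assume "\<not> ksub_le k a b"
      moreover from this have le: "ksub_le k b a" using comp ab by auto
      ultimately obtain i where i: "i \<in> {1..k}" "elt b i < elt a i"
        by (auto simp: ksub_le_def not_le)
      have "f b < f a"
        unfolding f_def by (rule sum_strict_mono_ex1) (use le i in \<open>auto simp: ksub_le_def\<close>)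
      thus False using ab by simp
    qed
  qed
  thus ?thesis by (intro exI[of _ "sort_key f xs"]) simp
qed

definition combination :: "nat set list set \<Rightarrow> (nat set list \<Rightarrow> 'k::comm_ring_1) \<Rightarrow> (nat set, 'k) mpoly" where
  "combination L c = (\<Sum>xs\<in>L. single 0 (c xs) * coord_prod xs)"

text \<open>The ideal \<open>N\<close> is left open because two instances are needed: the kernel of
  the evaluation on band matrices, which yields leading exponents, and the polynomials that vanish
  in the Richardson ring, which yields the presentation of that ring.\<close>

locale straightening =
  fixes k n :: nat and \<beta> \<gamma> :: "nat set" and N :: "(nat set, 'k::field) mpoly set"
  assumes N_0: "0 \<in> N"
    and N_add: "\<And>p q. p \<in> N \<Longrightarrow> q \<in> N \<Longrightarrow> p + q \<in> N"
    and N_mult: "\<And>p q. mvars p \<subseteq> ksubsets k n \<Longrightarrow> q \<in> N \<Longrightarrow> p * q \<in> N"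
    and N_plucker: "\<And>p. p \<in> plucker_ideal k n \<Longrightarrow> p \<in> N"
    and N_outside: "\<And>\<alpha>. \<alpha> \<in> ksubsets k n - ksub_interval k n \<beta> \<gamma> \<Longrightarrow> mvar \<alpha> \<in> N"
begin

abbreviation "std_list \<equiv> standard_list k n \<beta> \<gamma>"

definition straight :: "(nat set, 'k) mpoly \<Rightarrow> bool" where
  "straight p \<longleftrightarrow> (\<exists>L c. finite L \<and> L \<subseteq> Collect std_list \<and> p - combination L c \<in> N)"

lemma straight_mod: "p - q \<in> N \<Longrightarrow> straight q \<Longrightarrow> straight p"
proof -
  assume *: "p - q \<in> N" "straight q"
  then obtain L c where L: "finite L" "L \<subseteq> Collect std_list" "q - combination L c \<in> N"
    by (auto simp: straight_def)
  have "p - combination L c = (p - q) + (q - combination L c)" by simp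
  hence "p - combination L c \<in> N" using N_add *(1) L(3) by metis
  thus ?thesis using L by (auto simp: straight_def)
qed

lemma straight_N: "p \<in> N \<Longrightarrow> straight p"
  unfolding straight_def by (rule exI[of _ "{}"]) (simp add: combination_def)

lemma straight_coord_prod: "std_list xs \<Longrightarrow> straight (coord_prod xs)"
  unfolding straight_def
  by (rule exI[of _ "{xs}"], rule exI[of _ "\<lambda>_. 1"]) (simp add: combination_def N_0)

lemma straight_scale: "straight p \<Longrightarrow> straight (single 0 a * p)"
proof -
  assume "straight p"
  then obtain L c where L: "finite L" "L \<subseteq> Collect std_list" "p - combination L c \<in> N"
    by (auto simp: straight_def)
  have "single 0 a * combination L c = combination L (\<lambda>xs. a * c xs)"
    by (simp add: combination_def sum_distrib_left mult.assoc[symmetric] mult_single)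
  hence "single 0 a * p - combination L (\<lambda>xs. a * c xs)
      = single 0 a * (p - combination L c)"
    by (simp add: algebra_simps)
  also have "\<dots> \<in> N" by (rule N_mult) (use L in simp_all)
  finally show ?thesis using L by (auto simp: straight_def)
qed

lemma straight_add: "straight p \<Longrightarrow> straight q \<Longrightarrow> straight (p + q)"
proof -
  assume "straight p" "straight q"
  then obtain L c M d where L: "finite L" "L \<subseteq> Collect std_list" "p - combination L c \<in> N"
    and M: "finite M" "M \<subseteq> Collect std_list" "q - combination M d \<in> N"
    by (auto simp: straight_def)
  define e where "e xs = (if xs \<in> L then c xs else 0) + (if xs \<in> M then d xs else 0)" for xs
  have ext: "(\<Sum>xs\<in>L \<union> M. single 0 (if xs \<in> K then f xs else 0) * coord_prod xs) = combination K f"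
    if "K \<subseteq> L \<union> M" for K f
    unfolding combination_def using L(1) M(1) that by (intro sum.mono_neutral_cong_right) auto
  have "combination (L \<union> M) e = combination L c + combination M d"
    unfolding ext[of L c, symmetric, simplified] ext[of M d, symmetric, simplified]
    by (simp add: combination_def e_def single_add distrib_right sum.distrib)
  hence "p + q - combination (L \<union> M) e = (p - combination L c) + (q - combination M d)"
    by (simp add: algebra_simps)
  also have "\<dots> \<in> N" by (rule N_add) (use L M in auto)
  finally show ?thesis unfolding straight_def using L M by (intro exI[of _ "L \<union> M"] exI[of _ e]) auto
qed

lemma straight_sum: "(\<And>i. i \<in> I \<Longrightarrow> straight (f i)) \<Longrightarrow> straight (sum f I)"
  by (induction I rule: infinite_finite_induct) (auto intro: straight_add straight_N N_0)

text \<open>Base 3 makes a single set outweigh any two smaller ones, so that replacing two factors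
  by a pair with a larger member increases the total weight.\<close>

definition weight :: "nat set \<Rightarrow> nat" where
  "weight a = 3 ^ colex_weight a"

definition max_weight :: nat where
  "max_weight = 3 ^ (2 ^ Suc n)"

definition deficit :: "nat set list \<Rightarrow> nat" where
  "deficit xs = length xs * max_weight - (\<Sum>a\<leftarrow>xs. weight a)"

lemma weight_le_max: "a \<in> ksubsets k n \<Longrightarrow> weight a \<le> max_weight"
proof -
  assume a: "a \<in> ksubsets k n"
  hence "colex_weight a < 2 ^ Suc n"
    using ksubset_finite[OF a] by (intro colex_weight_less) (auto simp: ksubsets_def)
  thus ?thesis unfolding weight_def max_weight_def by (intro power_increasing less_imp_le) simp_all
qed

lemma sum_weight_le:
  "set xs \<subseteq> ksubsets k n \<Longrightarrow> (\<Sum>a\<leftarrow>xs. weight a) \<le> length xs * max_weight"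
proof (induction xs)
  case (Cons a xs)
  then show ?case using weight_le_max[of a] by simp
qed simp

text \<open>A monomial with incomparable factors is rewritten by the straightening relation. Naming
  the colexicographically larger factor \<open>\<alpha>'\<close> makes one factor of each new term
  larger than both old ones, so the total weight grows; for a fixed number of factors it is
  bounded.\<close>

lemma straight_coord_prod_all:
  assumes "set xs \<subseteq> ksubsets k n"
  shows "straight (coord_prod xs)"
  using assms
proof (induction "deficit xs" arbitrary: xs rule: less_induct)
  case less
  note sub = less.prems
  consider (out) \<alpha> where "\<alpha> \<in> set xs" "\<alpha> \<notin> ksub_interval k n \<beta> \<gamma>"
    | (comp) "set xs \<subseteq> ksub_interval k n \<beta> \<gamma>"
        "\<And>a b. a \<in> set xs \<Longrightarrow> b \<in> set xs \<Longrightarrow> ksub_le k a b \<or> ksub_le k b a"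
    | (incomp) a b where "a \<in> set xs" "b \<in> set xs" "\<not> ksub_le k a b" "\<not> ksub_le k b a"
    by blast
  then show ?case
  proof cases
    case out
    have "mvars (coord_prod (remove1 \<alpha> xs) :: (nat set, 'k) mpoly) \<subseteq> ksubsets k n"
      using mvars_coord_prod[of "remove1 \<alpha> xs"] set_remove1_subset[of \<alpha> xs] sub by blast
    hence "coord_prod (remove1 \<alpha> xs) * mvar \<alpha> \<in> N"
      by (rule N_mult) (use N_outside out sub in auto)
    thus ?thesis
      using coord_prod_remove1[OF out(1), where ?'a = 'k] by (intro straight_N) (simp add: mult.commute)
  next
    case comp
    obtain ys where ys: "mset ys = mset xs" "sorted_wrt (ksub_le k) ys"
      using comparable_sort[OF sub comp(2)] by auto
    hence "std_list ys" using comp(1) mset_eq_setD[OF ys(1)] by (simp add: standard_list_def)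
    thus ?thesis using straight_coord_prod coord_prod_mset_cong[OF ys(1)] by metis
  next
    case incomp
    obtain \<alpha> \<alpha>' where \<alpha>: "\<alpha> \<in> set xs" "\<alpha>' \<in> set xs" "\<not> ksub_le k \<alpha> \<alpha>'" "\<alpha> \<noteq> \<alpha>'"
      "colex_weight \<alpha> \<le> colex_weight \<alpha>'"
      using incomp ksub_le_refl by (metis linear)
    obtain i where i: "1 \<le> i" "i \<le> k" "elt \<alpha>' i < elt \<alpha> i"
      using \<alpha>(3) by (auto simp: ksub_le_def not_le)
    have V: "\<alpha> \<in> ksubsets k n" "\<alpha>' \<in> ksubsets k n" using \<alpha> sub by auto
    have i': "i - 1 < k" "elt \<alpha>' (i - 1 + 1) < elt \<alpha> (i - 1 + 1)" using i by simp_all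
    obtain I :: "nat set set" and \<mu> \<nu> and s :: "nat set \<Rightarrow> int" where I: "finite I"
      "\<And>B. B \<in> I \<Longrightarrow> \<mu> B \<in> ksubsets k n \<and> \<nu> B \<in> ksubsets k n \<and> colex_weight \<alpha>' < colex_weight (\<nu> B)"
      "generic_minor k \<alpha> * generic_minor k \<alpha>'
        = (\<Sum>B\<in>I. of_int (s B) * (generic_minor k (\<mu> B) * generic_minor k (\<nu> B) :: (nat \<times> nat, 'k) mpoly))"
      using garnir_relation[OF V i', of "\<lambda>i j. mvar (i, j) :: (nat \<times> nat, 'k) mpoly"]
      unfolding generic_minor_eq by blast
    let ?zs = "remove1 \<alpha>' (remove1 \<alpha> xs)"
    have zs: "set ?zs \<subseteq> ksubsets k n"
      using sub set_remove1_subset[of \<alpha>' "remove1 \<alpha> xs"] set_remove1_subset[of \<alpha> xs] by blast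
    have \<alpha>'': "\<alpha>' \<in> set (remove1 \<alpha> xs)" using \<alpha> by simp
    have coord_prod: "coord_prod xs = mvar \<alpha> * (mvar \<alpha>' * (coord_prod ?zs :: (nat set, 'k) mpoly))"
      using coord_prod_remove1[OF \<alpha>(1), where ?'a = 'k] coord_prod_remove1[OF \<alpha>'', where ?'a = 'k] by simp
    define g where "g = mvar \<alpha> * mvar \<alpha>' - (\<Sum>B\<in>I. of_int (s B) * (mvar (\<mu> B) * (mvar (\<nu> B) :: (nat set, 'k) mpoly)))"
    have "g \<in> plucker_ideal k n"
    proof -
      interpret comm_ring_hom "msubst (generic_minor k) :: (nat set, 'k) mpoly \<Rightarrow> _" by (rule msubst_hom)
      have "msubst (generic_minor k) g = 0"
        unfolding g_def by (simp add: hom_distribs I(3))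
      moreover have "mvars g \<subseteq> ksubsets k n"
      proof -
        have "mvars (mvar a * mvar b :: (nat set, 'k) mpoly) \<subseteq> {a, b}" for a b
          using mvars_mult[of "mvar a :: (nat set, 'k) mpoly" "mvar b"] by auto
        moreover have "mvars (of_int z * q :: (nat set, 'k) mpoly) \<subseteq> mvars q" for z q
          using mvars_mult[of "of_int z" q] by (simp flip: single_of_int)
        ultimately have "mvars (\<Sum>B\<in>I. of_int (s B) * (mvar (\<mu> B) * (mvar (\<nu> B) :: (nat set, 'k) mpoly))) \<subseteq> ksubsets k n"
          using I(2) by (intro mvars_sum) blast
        thus ?thesis
          using mvars_add[of "mvar \<alpha> * mvar \<alpha>'" "- (\<Sum>B\<in>I. of_int (s B) * (mvar (\<mu> B) * (mvar (\<nu> B) :: (nat set, 'k) mpoly)))"]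
            mvars_mult[of "mvar \<alpha> :: (nat set, 'k) mpoly" "mvar \<alpha>'"] V
          unfolding g_def by auto
      qed
      ultimately show ?thesis by (simp add: plucker_ideal_iff)
    qed
    moreover have "mvars (coord_prod ?zs :: (nat set, 'k) mpoly) \<subseteq> ksubsets k n"
      using mvars_coord_prod[of ?zs] zs by blast
    ultimately have "coord_prod ?zs * g \<in> N" using N_plucker N_mult by blast
    also have "coord_prod ?zs * g = coord_prod xs - (\<Sum>B\<in>I. single 0 (of_int (s B)) * coord_prod (\<mu> B # \<nu> B # ?zs))"
      unfolding g_def coord_prod by (simp add: right_diff_distrib sum_distrib_left ac_simps)
    finally have diff: "coord_prod xs - (\<Sum>B\<in>I. single 0 (of_int (s B)) * coord_prod (\<mu> B # \<nu> B # ?zs)) \<in> N" .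
    have "straight (\<Sum>B\<in>I. single 0 (of_int (s B)) * coord_prod (\<mu> B # \<nu> B # ?zs))"
    proof (intro straight_sum straight_scale less.hyps)
      fix B assume B: "B \<in> I"
      show "set (\<mu> B # \<nu> B # ?zs) \<subseteq> ksubsets k n" using I(2)[OF B] zs by auto
      let ?S = "\<lambda>xs. \<Sum>a\<leftarrow>xs. weight a"
      have "mset xs = add_mset \<alpha> (mset (remove1 \<alpha> xs))" using \<alpha>(1) by simp
      also have "mset (remove1 \<alpha> xs) = add_mset \<alpha>' (mset ?zs)"
        unfolding mset_remove1[of \<alpha>'] using \<alpha>'' by (intro insert_DiffM[symmetric]) (simp del: mset_remove1)
      finally have xs: "mset xs = mset (\<alpha> # \<alpha>' # ?zs)" by simp
      have len: "length xs = length (\<mu> B # \<nu> B # ?zs)" using mset_eq_length[OF xs] by simp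
      have "?S xs = ?S (\<alpha> # \<alpha>' # ?zs)" by (simp only: sum_mset_sum_list[symmetric] mset_map xs)
      moreover have "weight \<alpha> \<le> weight \<alpha>'"
        unfolding weight_def using \<alpha>(5) by (intro power_increasing) auto
      moreover have "3 * weight \<alpha>' \<le> weight (\<nu> B)"
        unfolding weight_def power_Suc[symmetric] using I(2)[OF B] by (intro power_increasing) auto
      moreover have "0 < weight \<alpha>'" by (simp add: weight_def)
      ultimately have "?S xs < ?S (\<mu> B # \<nu> B # ?zs)" by simp
      moreover have "?S (\<mu> B # \<nu> B # ?zs) \<le> length xs * max_weight"
        unfolding len using sum_weight_le I(2)[OF B] zs by (metis insert_subset list.simps(15))
      ultimately show "deficit (\<mu> B # \<nu> B # ?zs) < deficit xs"
        unfolding deficit_def len by linarith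
    qed
    with diff show ?thesis by (rule straight_mod)
  qed
qed

theorem straight_all:
  assumes "mvars p \<subseteq> ksubsets k n"
  shows "straight p"
proof -
  have "\<forall>q. straight q \<longrightarrow> straight (p * q)"
    using assms
  proof (induction rule: mpoly_ring_induct)
    case (mvar x)
    show ?case
    proof (intro allI impI)
      fix q assume "straight q"
      then obtain L c where L: "finite L" "L \<subseteq> Collect std_list" "q - combination L c \<in> N"
        by (auto simp: straight_def)
      have "mvar x * q - mvar x * combination L c = mvar x * (q - combination L c)"
        by (simp add: algebra_simps)
      also have "\<dots> \<in> N" by (rule N_mult) (use mvar L in auto)
      finally have *: "mvar x * q - mvar x * combination L c \<in> N" .
      have "mvar x * combination L c = (\<Sum>xs\<in>L. single 0 (c xs) * coord_prod (x # xs))"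
        by (simp add: combination_def sum_distrib_left ac_simps)
      also have "straight \<dots>"
      proof (intro straight_sum straight_scale straight_coord_prod_all)
        fix xs assume "xs \<in> L"
        hence "std_list xs" using L by auto
        thus "set (x # xs) \<subseteq> ksubsets k n"
          using mvar by (auto simp: standard_list_def dest: interval_ksubset)
      qed
      finally show "straight (mvar x * q)" using straight_mod[OF *] by simp
    qed
  next
    case (add p q)
    then show ?case by (auto simp: distrib_right intro: straight_add)
  next
    case (mult p q)
    then show ?case by (auto simp: mult.assoc)
  qed (auto intro: straight_scale)
  moreover have "straight 1" using straight_coord_prod[of "[]"] by (simp add: standard_list_def)
  ultimately show ?thesis by (metis mult.right_neutral)
qed

end

section \<open>Leading monomials\<close>

text \<open>The order on exponents is lexicographic with the smallest indeterminate first; on pairs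
  this reads the matrix row by row.\<close>

definition lead_at :: "('a::linorder \<Rightarrow>\<^sub>0 'b::zero) \<Rightarrow> 'a \<Rightarrow> bool" where
  "lead_at p e \<longleftrightarrow> lookup p e \<noteq> 0 \<and> (\<forall>m\<in>keys p. m \<le> e)"

lemma lead_at_exists: "p \<noteq> 0 \<Longrightarrow> \<exists>e. lead_at p e"
  unfolding lead_at_def
  by (rule exI[of _ "Max (keys p)"])
     (metis Max_ge Max_in finite_keys keys_eq_empty in_keys_iff)

lemma lead_at_unique: "lead_at p e \<Longrightarrow> lead_at p e' \<Longrightarrow> e = e'"
  unfolding lead_at_def by (meson antisym in_keys_iff)

lemma lookup_mult_sum:
  "lookup (p * q) e = (\<Sum>a\<in>keys p. \<Sum>b\<in>keys q.
    if a + b = e then lookup p a * lookup q b else 0)"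
proof -
  let ?s = "\<lambda>p m. single m (lookup p m)"
  have "p * q = (\<Sum>m\<in>keys p. ?s p m) * (\<Sum>m\<in>keys q. ?s q m)"
    using poly_mapping_sum_singles[of p] poly_mapping_sum_singles[of q] by simp
  also have "\<dots> = (\<Sum>a\<in>keys p. \<Sum>b\<in>keys q. ?s p a * ?s q b)"
    by (simp add: sum_product)
  finally show ?thesis
    by (simp add: lookup_sum mult_single lookup_single when_def)
qed

text \<open>Only the two top exponents can add up to \<open>e + f\<close>. The hypotheses allow
  \<open>e\<close> and \<open>f\<close> to be mere upper bounds.\<close>

lemma lead_at_mult_coeff:
  fixes p q :: "('a::{linorder, linordered_cancel_ab_semigroup_add, comm_monoid_add}) \<Rightarrow>\<^sub>0 'b::semiring_0"
  assumes "\<And>m. m \<in> keys p \<Longrightarrow> m \<le> e" "\<And>m. m \<in> keys q \<Longrightarrow> m \<le> f"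
  shows "lookup (p * q) (e + f) = lookup p e * lookup q f"
proof -
  have *: "a + b = e + f \<longleftrightarrow> a = e \<and> b = f" if "a \<in> keys p" "b \<in> keys q" for a b
    using assms(1)[OF that(1)] assms(2)[OF that(2)]
    by (metis add_less_le_mono add_le_less_mono less_irrefl order.not_eq_order_implies_strict)
  have "lookup (p * q) (e + f) = (\<Sum>a\<in>keys p. \<Sum>b\<in>keys q.
      if a = e then if b = f then lookup p a * lookup q b else 0 else 0)"
    unfolding lookup_mult_sum using * by (intro sum.cong refl) auto
  also have "\<dots> = (\<Sum>a\<in>keys p. if a = e then (\<Sum>b\<in>keys q.
      if b = f then lookup p a * lookup q b else 0) else 0)"
    by (intro sum.cong refl) simp
  also have "\<dots> = lookup p e * lookup q f"
    by (simp add: in_keys_iff)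
  finally show ?thesis .
qed

lemma lead_at_mult:
  fixes p q :: "('a::{linorder, linordered_cancel_ab_semigroup_add, comm_monoid_add}) \<Rightarrow>\<^sub>0 'b::semiring_no_zero_divisors"
  assumes "lead_at p e" "lead_at q f"
  shows "lead_at (p * q) (e + f)"
  unfolding lead_at_def
proof
  show "lookup (p * q) (e + f) \<noteq> 0"
    using assms lead_at_mult_coeff[of p e q f] by (auto simp: lead_at_def)
  show "\<forall>m\<in>keys (p * q). m \<le> e + f"
    using Poly_Mapping.keys_mult[of p q] assms unfolding lead_at_def by (fastforce intro: add_mono)
qed

section \<open>The band matrix\<close>

type_synonym 'k band_poly = "(nat \<times> nat, 'k) mpoly"

lemma sum_delta_pair:
  assumes "1 \<le> a" "a \<le> (k::nat)"
  shows "(\<Sum>i=1..k. if (i, c i) = (a, b) then x else 0) = (if c a = b then x else (0::nat))"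
proof -
  have "(\<Sum>i=1..k. if (i, c i) = (a, b) then x else 0) = (\<Sum>i=1..k. if i = a then if c a = b then x else 0 else 0)"
    by (intro sum.cong) auto
  thus ?thesis using assms by (simp add: sum.delta')
qed

text \<open>The exponent of the monomial \<open>x\<^bsub>1, c 1\<^esub> \<cdots> x\<^bsub>k, c
  k\<^esub>\<close>.\<close>

definition diag_exp :: "nat \<Rightarrow> (nat \<Rightarrow> nat) \<Rightarrow> (nat \<times> nat) \<Rightarrow>\<^sub>0 nat" where
  "diag_exp k c = (\<Sum>i=1..k. single (i, c i) 1)"

lemma lookup_diag_exp:
  "lookup (diag_exp k c) (a, b) = (if 1 \<le> a \<and> a \<le> k \<and> c a = b then 1 else 0)"
proof -
  have "lookup (diag_exp k c) (a, b) = (\<Sum>i=1..k. if (i, c i) = (a, b) then 1 else 0)"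
    by (simp add: diag_exp_def lookup_sum lookup_single when_def del: One_nat_def)
  moreover have "\<dots> = 0" if "\<not> (1 \<le> a \<and> a \<le> k)"
    using that by (intro sum.neutral) auto
  ultimately show ?thesis using sum_delta_pair[of a k c b 1] by auto
qed

abbreviation set_exp :: "nat \<Rightarrow> nat set \<Rightarrow> (nat \<times> nat) \<Rightarrow>\<^sub>0 nat" where
  "set_exp k \<alpha> \<equiv> diag_exp k (elt \<alpha>)"

definition list_exp :: "nat \<Rightarrow> nat set list \<Rightarrow> (nat \<times> nat) \<Rightarrow>\<^sub>0 nat" where
  "list_exp k xs = sum_list (map (set_exp k) xs)"

lemma list_exp_simps [simp]: "list_exp k [] = 0" "list_exp k (x # xs) = set_exp k x + list_exp k xs"
  by (simp_all add: list_exp_def)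

lemma lookup_list_exp:
  "lookup (list_exp k xs) (i, j) = (if 1 \<le> i \<and> i \<le> k then length (filter (\<lambda>\<alpha>. elt \<alpha> i = j) xs) else 0)"
  by (induction xs) (auto simp: lookup_add lookup_diag_exp)

text \<open>The smallest column used in row \<open>i\<close> is the \<open>i\<close>-th element of
  the first set of the chain, so the chain is recovered from the front.\<close>

lemma list_exp_inj:
  assumes "1 \<le> k" "sorted_wrt (ksub_le k) xs" "sorted_wrt (ksub_le k) ys"
    "set xs \<subseteq> ksubsets k n" "set ys \<subseteq> ksubsets k n" "list_exp k xs = list_exp k ys"
  shows "xs = ys"
  using assms
proof (induction xs arbitrary: ys)
  case Nil
  show ?case
  proof (cases ys)
    case (Cons y ys')
    have "lookup (list_exp k ys) (1, elt y 1) = 0" using Nil by (metis list_exp_simps(1) lookup_zero)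
    thus ?thesis using Cons Nil(1) by (simp add: lookup_list_exp del: list_exp_simps)
  qed simp
next
  case (Cons x xs)
  show ?case
  proof (cases ys)
    case Nil
    have "lookup (list_exp k (x # xs)) (1, elt x 1) = 0"
      using Cons.prems Nil by (metis list_exp_simps(1) lookup_zero)
    thus ?thesis using Cons.prems(1) by (simp add: lookup_list_exp del: list_exp_simps)
  next
    case ys: (Cons y ys')
    have head: "elt v i \<le> elt u i"
      if "list_exp k (u # us) = list_exp k (v # vs)" "sorted_wrt (ksub_le k) (v # vs)" "1 \<le> i" "i \<le> k"
      for u us v vs i
    proof -
      have "lookup (list_exp k (v # vs)) (i, elt u i) \<noteq> 0"
        using that by (simp add: lookup_list_exp flip: that(1) del: list_exp_simps)
      hence "filter (\<lambda>\<alpha>. elt \<alpha> i = elt u i) (v # vs) \<noteq> []"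
        using that unfolding lookup_list_exp by (metis length_0_conv)
      then obtain w where "w \<in> set (v # vs)" "elt w i = elt u i"
        unfolding filter_empty_conv by blast
      moreover from this have "ksub_le k v w" using that(2) ksub_le_refl by auto
      ultimately show ?thesis using that(3,4) unfolding ksub_le_def by (metis atLeastAtMost_iff)
    qed
    have "x = y"
    proof (rule ksubset_eqI)
      show "x \<in> ksubsets k n" "y \<in> ksubsets k n" using Cons.prems ys by auto
      fix i assume "1 \<le> i" "i \<le> k"
      thus "elt x i = elt y i"
        using head[of x xs y ys' i] head[of y ys' x xs i] Cons.prems ys by (metis antisym)
    qed
    moreover have "xs = ys'"
      using Cons.prems ys \<open>x = y\<close> by (intro Cons.IH) auto
    ultimately show ?thesis using ys by simp
  qed
qed

definition band :: "(nat \<Rightarrow> nat) \<Rightarrow> (nat \<Rightarrow> nat) \<Rightarrow> nat \<Rightarrow> nat \<Rightarrow> 'k::comm_ring_1 band_poly" where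
  "band l u i j = (if l i \<le> j \<and> j \<le> u i then mvar (i, j) else 0)"

lemma less_poly_mapping_iff:
  "p < q \<longleftrightarrow> (\<exists>x. lookup p x < lookup q x \<and> (\<forall>y<x. lookup p y = lookup q y))"
  by transfer (simp add: less_fun_def)

text \<open>At the first row in which a permutation moves, it picks a later column than the diagonal
  does.\<close>

lemma diag_exp_less:
  assumes \<alpha>: "\<alpha> \<in> ksubsets k n" and p: "p permutes {0..<k}" and "p \<noteq> id"
  shows "diag_exp k (\<lambda>i. elt \<alpha> (p (i - 1) + 1)) < set_exp k \<alpha>"
proof -
  define i where "i = (LEAST i. p i \<noteq> i)"
  have ex: "\<exists>i. p i \<noteq> i" using \<open>p \<noteq> id\<close> by auto
  have i1: "p i \<noteq> i" unfolding i_def by (rule LeastI_ex[OF ex])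
  have i2: "p j = j" if "j < i" for j using not_less_Least that unfolding i_def by blast
  note i = i1 i2
  have ik: "i < k" using i(1) permutes_not_in[OF p, of i] by auto
  have pk: "p i < k" using permutes_in_image[OF p, of i] ik by simp
  have "i < p i"
  proof (rule ccontr)
    assume "\<not> i < p i"
    hence "p i < i" using i1 by simp
    hence "p (p i) = p i" by (rule i2)
    thus False using permutes_inj[OF p] i(1) by (metis injD)
  qed
  hence lt: "elt \<alpha> (i + 1) < elt \<alpha> (p i + 1)"
    using pk by (intro elt_less[OF \<alpha>]) auto
  show ?thesis
    unfolding less_poly_mapping_iff
  proof (intro exI[of _ "(i + 1, elt \<alpha> (i + 1))"] conjI allI impI)
    show "lookup (diag_exp k (\<lambda>i. elt \<alpha> (p (i - 1) + 1))) (i + 1, elt \<alpha> (i + 1))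
      < lookup (set_exp k \<alpha>) (i + 1, elt \<alpha> (i + 1))"
      using ik lt by (simp add: lookup_diag_exp)
    fix y assume y: "y < (i + 1, elt \<alpha> (i + 1))"
    obtain a b where ab: "y = (a, b)" by force
    show "lookup (diag_exp k (\<lambda>i. elt \<alpha> (p (i - 1) + 1))) y = lookup (set_exp k \<alpha>) y"
    proof (cases "1 \<le> a \<and> a < i + 1")
      case True
      hence "p (a - 1) = a - 1" by (intro i2) (use True in auto)
      thus ?thesis using True ab by (simp add: lookup_diag_exp)
    next
      case False
      thus ?thesis using y ab lt by (auto simp: lookup_diag_exp)
    qed
  qed
qed

lemma prod_mvar_diag:
  "(\<Prod>i=1..k. mvar (i, c i) :: 'k::comm_ring_1 band_poly) = single (diag_exp k c) 1"
proof -
  have "(\<Prod>i\<in>A. mvar (i, c i) :: 'k band_poly) = single (\<Sum>i\<in>A. single (i, c i) 1) 1"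
    if "finite A" for A
    using that by (induction A) (simp_all add: mvar_def mult_single)
  thus ?thesis by (simp add: diag_exp_def)
qed

text \<open>All other terms of the determinant have smaller exponents than the diagonal one, which
  survives because it stays inside the band. The exponents that occur are recorded for the
  gradings.\<close>

lemma lead_minor_band:
  fixes l u :: "nat \<Rightarrow> nat"
  assumes \<alpha>: "\<alpha> \<in> ksubsets k n" and lu: "\<And>i. 1 \<le> i \<Longrightarrow> i \<le> k \<Longrightarrow> l i \<le> elt \<alpha> i \<and> elt \<alpha> i \<le> u i"
  shows "lookup (minor k (band l u) \<alpha> :: 'k::comm_ring_1 band_poly) (set_exp k \<alpha>) = 1"
    and "\<And>m. m \<in> keys (minor k (band l u) \<alpha> :: 'k::comm_ring_1 band_poly) \<Longrightarrow> m \<le> set_exp k \<alpha>"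
    and "\<And>m. m \<in> keys (minor k (band l u) \<alpha> :: 'k::comm_ring_1 band_poly) \<Longrightarrow>
      \<exists>p. p permutes {0..<k} \<and> (\<forall>i<k. l (i + 1) \<le> elt \<alpha> (p i + 1) \<and> elt \<alpha> (p i + 1) \<le> u (i + 1)) \<and>
        m = diag_exp k (\<lambda>i. elt \<alpha> (p (i - 1) + 1))"
proof -
  let ?P = "{p. p permutes {0..<k}}"
  let ?e = "\<lambda>p. diag_exp k (\<lambda>i. elt \<alpha> (p (i - 1) + 1))"
  define b where "b p = (if \<forall>i<k. l (i + 1) \<le> elt \<alpha> (p i + 1) \<and> elt \<alpha> (p i + 1) \<le> u (i + 1) then 1 else 0 :: 'k)" for p
  have prod: "(\<Prod>i = 0..<k. band l u (i + 1) (elt \<alpha> (p i + 1))) = single (?e p) (b p)" for p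
  proof (cases "\<forall>i<k. l (i + 1) \<le> elt \<alpha> (p i + 1) \<and> elt \<alpha> (p i + 1) \<le> u (i + 1)")
    case True
    have "(\<Prod>i = 0..<k. band l u (i + 1) (elt \<alpha> (p i + 1)) :: 'k band_poly) = (\<Prod>i = 0..<k. mvar (i + 1, elt \<alpha> (p i + 1)))"
      using True by (intro prod.cong) (auto simp: band_def)
    also have "\<dots> = (\<Prod>i=1..k. mvar (i, elt \<alpha> (p (i - 1) + 1)))"
      by (rule prod.reindex_bij_witness[where i = "\<lambda>i. i - 1" and j = "\<lambda>i. i + 1"]) auto
    also have "\<dots> = single (?e p) 1" by (rule prod_mvar_diag)
    also have "1 = b p" unfolding b_def using True by (rule if_P[symmetric])
    finally show ?thesis .
  next
    case False
    hence "(\<Prod>i = 0..<k. band l u (i + 1) (elt \<alpha> (p i + 1)) :: 'k band_poly) = 0"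
      by (intro prod_zero) (auto simp: band_def)
    moreover have "b p = 0" using False by (simp only: b_def if_False)
    ultimately show ?thesis by simp
  qed
  have minor: "minor k (band l u) \<alpha> = (\<Sum>p\<in>?P. single (?e p) (signof p * b p))"
  proof -
    have "minor k (band l u) \<alpha> = (\<Sum>p\<in>?P. signof p * (\<Prod>i = 0..<k. band l u (i + 1) (elt \<alpha> (p i + 1))) :: 'k band_poly)"
    proof -
      have "(\<Prod>i = 0..<k. mat k k (\<lambda>(i, j). band l u (i + 1) (elt \<alpha> (j + 1)) :: 'k band_poly) $$ (i, p i))
          = (\<Prod>i = 0..<k. band l u (i + 1) (elt \<alpha> (p i + 1)))" if "p permutes {0..<k}" for p
      proof (rule prod.cong[OF refl])
        fix i assume "i \<in> {0..<k}"
        moreover from this have "p i < k" using permutes_in_image[OF that, of i] by simp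
        ultimately show "mat k k (\<lambda>(i, j). band l u (i + 1) (elt \<alpha> (j + 1)) :: 'k band_poly) $$ (i, p i)
          = band l u (i + 1) (elt \<alpha> (p i + 1))" by simp
      qed
      thus ?thesis unfolding minor_def cminor_def by (subst det_def'[of _ k]) auto
    qed
    moreover have "signof p * single (?e p) (b p) = single (?e p) (signof p * b p)" for p :: "nat \<Rightarrow> nat"
      by (simp add: sign_def single_uminus)
    ultimately show ?thesis unfolding prod by simp
  qed
  have id: "?e id = set_exp k \<alpha>"
    unfolding diag_exp_def by (rule sum.cong) auto
  have fin: "finite ?P" by (simp add: finite_permutations)
  have idP: "id \<in> ?P" by (simp add: permutes_id)
  have le: "?e p \<le> set_exp k \<alpha>" if "p \<in> ?P" for p
    using diag_exp_less[OF \<alpha>, of p] that id by (cases "p = id") auto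
  have b1: "b id = 1" using lu by (auto simp: b_def)
  have "lookup (minor k (band l u) \<alpha>) (set_exp k \<alpha>) = (\<Sum>p\<in>?P. if p = id then 1 else 0 :: 'k)"
    unfolding minor lookup_sum
  proof (rule sum.cong[OF refl])
    fix p assume p: "p \<in> ?P"
    show "lookup (single (?e p) (signof p * b p)) (set_exp k \<alpha>) = (if p = id then 1 else 0)"
    proof (cases "p = id")
      case True
      then show ?thesis using b1 id by (simp add: lookup_single)
    next
      case False
      hence "?e p \<noteq> set_exp k \<alpha>" using diag_exp_less[OF \<alpha>, of p] p by auto
      then show ?thesis using False by (simp add: lookup_single when_def)
    qed
  qed
  also have "\<dots> = 1" using fin idP by (simp add: sum.delta')
  finally show "lookup (minor k (band l u) \<alpha> :: 'k band_poly) (set_exp k \<alpha>) = 1" .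
  fix m assume "m \<in> keys (minor k (band l u) \<alpha> :: 'k band_poly)"
  hence "\<exists>p\<in>?P. m \<in> keys (single (?e p) (signof p * b p))"
    unfolding minor using Poly_Mapping.keys_sum[of "\<lambda>p. single (?e p) (signof p * b p)" ?P] by blast
  then obtain p where p: "p \<in> ?P" "m \<in> keys (single (?e p) (signof p * b p))" ..
  hence p: "p \<in> ?P" "m = ?e p" "b p \<noteq> 0" by (cases "b p = 0"; simp split: if_splits)+
  show "m \<le> set_exp k \<alpha>" using le p by simp
  have "\<forall>i<k. l (i + 1) \<le> elt \<alpha> (p i + 1) \<and> elt \<alpha> (p i + 1) \<le> u (i + 1)"
    using p(3) unfolding b_def by presburger
  thus "\<exists>p. p permutes {0..<k} \<and> (\<forall>i<k. l (i + 1) \<le> elt \<alpha> (p i + 1) \<and> elt \<alpha> (p i + 1) \<le> u (i + 1)) \<and>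
        m = diag_exp k (\<lambda>i. elt \<alpha> (p (i - 1) + 1))" using p by blast
qed

section \<open>The evaluation on band matrices\<close>

lemma cminor_zeroI:
  assumes "\<And>p. bij_betw p {1..k} {1..k} \<Longrightarrow> \<exists>i\<in>{1..k}. X i (c (p i)) = 0"
  shows "cminor k X c = 0"
proof -
  let ?A = "mat k k (\<lambda>(i, j). X (i + 1) (c (j + 1)))"
  have "(\<Prod>i = 0..<k. ?A $$ (i, p i)) = 0" if p: "p permutes {0..<k}" for p
  proof -
    define q where "q i = p (i - 1) + 1" for i
    have "bij_betw (\<lambda>i. i - 1) {1..k} {0..<k}"
      by (rule bij_betw_byWitness[where f' = Suc]) auto
    moreover have "bij_betw Suc {0..<k} {1..k}"
      by (rule bij_betw_byWitness[where f' = "\<lambda>i. i - 1"]) auto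
    ultimately have "bij_betw (Suc \<circ> (p \<circ> (\<lambda>i. i - 1))) {1..k} {1..k}"
      using permutes_imp_bij[OF p] by (blast intro: bij_betw_trans)
    moreover have "Suc \<circ> (p \<circ> (\<lambda>i. i - 1)) = q" by (auto simp: q_def)
    ultimately have "bij_betw q {1..k} {1..k}" by simp
    then obtain i where i: "i \<in> {1..k}" "X i (c (q i)) = 0" using assms by blast
    have "p (i - 1) < k" using permutes_in_image[OF p, of "i - 1"] i(1) by auto
    hence "?A $$ (i - 1, p (i - 1)) = 0" using i by (auto simp: q_def)
    thus ?thesis using i(1) by (intro prod_zero) (auto intro!: bexI[of _ "i - 1"])
  qed
  thus ?thesis unfolding cminor_def by (subst det_def'[of _ k]) (auto intro!: sum.neutral)
qed

lemma bij_betw_ident: "bij_betw (\<lambda>i. i) A A"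
  by (simp add: bij_betw_def)

text \<open>More than \<open>m - 1\<close> rows satisfy \<open>\<sigma> i \<le> m\<close>, but only
  \<open>m - 1\<close> rows satisfy \<open>p i < m\<close>.\<close>

lemma bij_pigeonhole:
  assumes "bij_betw \<sigma> {1..k} {1..k}" "bij_betw p {1..k} {1..k}" "1 \<le> m" "m \<le> (k::nat)"
  shows "\<exists>i\<in>{1..k}. \<sigma> i \<le> m \<and> m \<le> p i"
proof (rule ccontr)
  assume *: "\<not> ?thesis"
  have card: "card {i \<in> {1..k}. f i \<in> A} = card A" if f: "bij_betw f {1..k} {1..k}" and A: "A \<subseteq> {1..k}" for f A
  proof -
    have "f ` {i \<in> {1..k}. f i \<in> A} = A"
    proof (intro equalityI subsetI)
      fix x assume "x \<in> A"
      moreover from this have "x \<in> f ` {1..k}" using f A unfolding bij_betw_def by blast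
      ultimately show "x \<in> f ` {i \<in> {1..k}. f i \<in> A}" by blast
    qed blast
    moreover have "inj_on f {i \<in> {1..k}. f i \<in> A}"
      using f unfolding bij_betw_def by (auto intro: inj_on_subset)
    ultimately show ?thesis by (metis card_image)
  qed
  have "{i \<in> {1..k}. \<sigma> i \<in> {1..m}} \<subseteq> {i \<in> {1..k}. p i \<in> {1..<m}}"
  proof
    fix i assume i: "i \<in> {i \<in> {1..k}. \<sigma> i \<in> {1..m}}"
    hence "p i \<in> {1..k}" using assms(2) unfolding bij_betw_def by auto
    thus "i \<in> {i \<in> {1..k}. p i \<in> {1..<m}}" using * i by auto
  qed
  hence "card {i \<in> {1..k}. \<sigma> i \<in> {1..m}} \<le> card {i \<in> {1..k}. p i \<in> {1..<m}}"
    by (rule card_mono[rotated]) simp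
  moreover have "card {i \<in> {1..k}. \<sigma> i \<in> {1..m}} = m"
    using assms by (subst card[OF assms(1)]) (auto simp: subset_eq)
  moreover have "card {i \<in> {1..k}. p i \<in> {1..<m}} = m - 1"
    using assms by (subst card[OF assms(2)]) (auto simp: subset_eq)
  ultimately show False using assms by simp
qed

locale richardson =
  fixes k n :: nat and \<beta> \<gamma> :: "nat set"
  assumes k_pos: "1 \<le> k" and \<beta>: "\<beta> \<in> ksubsets k n" and \<gamma>: "\<gamma> \<in> ksubsets k n"
    and le: "ksub_le k \<beta> \<gamma>"
begin

abbreviation "V \<equiv> ksubsets k n"
abbreviation "\<I> \<equiv> ksub_interval k n \<beta> \<gamma>"
abbreviation "std \<equiv> standard_list k n \<beta> \<gamma>"

text \<open>Only the identity and the exchange of \<open>t\<close> and \<open>t + 1\<close> are used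
  for \<open>\<sigma>\<close>: the generic point of the Richardson variety and that of the
  divisor.\<close>

definition Z :: "(nat \<Rightarrow> nat) \<Rightarrow> nat \<Rightarrow> nat \<Rightarrow> 'k::field band_poly" where
  "Z \<sigma> = band (elt \<beta>) (\<lambda>i. elt \<gamma> (\<sigma> i))"

definition Phi :: "(nat \<Rightarrow> nat) \<Rightarrow> (nat set, 'k::field) mpoly \<Rightarrow> 'k band_poly" where
  "Phi \<sigma> = msubst (minor k (Z \<sigma>))"

abbreviation "Z0 \<equiv> Z (\<lambda>i. i)"
abbreviation "Phi0 \<equiv> Phi (\<lambda>i. i)"

lemma Phi_hom: "comm_ring_hom (Phi \<sigma>)"
  unfolding Phi_def by (rule msubst_hom)

sublocale Phi: comm_ring_hom "Phi \<sigma>" for \<sigma>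
  by (rule Phi_hom)

lemma Phi_mvar [simp]: "Phi \<sigma> (mvar \<alpha>) = minor k (Z \<sigma>) \<alpha>"
  by (simp add: Phi_def)

lemma Phi_const [simp]: "Phi \<sigma> (single 0 c) = single 0 c"
  by (simp add: Phi_def)

lemma \<beta>_le_\<gamma>: "1 \<le> i \<Longrightarrow> i \<le> k \<Longrightarrow> elt \<beta> i \<le> elt \<gamma> i"
  using le by (simp add: ksub_le_def)

lemma interval_iff:
  "\<alpha> \<in> \<I> \<longleftrightarrow> \<alpha> \<in> V \<and> (\<forall>i. 1 \<le> i \<and> i \<le> k \<longrightarrow> elt \<beta> i \<le> elt \<alpha> i \<and> elt \<alpha> i \<le> elt \<gamma> i)"
  by (auto simp: ksub_interval_def ksub_le_def)

text \<open>If \<open>\<alpha>(m) < \<beta>(m)\<close>, the first \<open>m\<close> columns live in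
  the first \<open>m - 1\<close> rows; if \<open>\<alpha>(m) > \<gamma>(m)\<close>, the last
  \<open>k - m + 1\<close> columns live in \<open>k - m\<close> rows.\<close>

lemma minor_outside:
  assumes \<alpha>: "\<alpha> \<in> V - \<I>" and \<sigma>: "bij_betw \<sigma> {1..k} {1..k}"
  shows "minor k (Z \<sigma>) \<alpha> = 0"
  unfolding minor_def
proof (rule cminor_zeroI)
  fix p assume p: "bij_betw p {1..k} {1..k}"
  obtain m where m: "1 \<le> m" "m \<le> k" "elt \<alpha> m < elt \<beta> m \<or> elt \<gamma> m < elt \<alpha> m"
    using \<alpha> by (auto simp: interval_iff not_le)
  have \<alpha>V: "\<alpha> \<in> V" using \<alpha> by simp
  from m(3) show "\<exists>i\<in>{1..k}. Z \<sigma> i (elt \<alpha> (p i)) = 0"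
  proof
    assume lt: "elt \<alpha> m < elt \<beta> m"
    obtain i where i: "i \<in> {1..k}" "p i \<le> m" "m \<le> i"
      using bij_pigeonhole[OF p bij_betw_ident m(1,2)] by auto
    have "p i \<in> {1..k}" using p i(1) unfolding bij_betw_def by auto
    hence "elt \<alpha> (p i) \<le> elt \<alpha> m" using elt_le[OF \<alpha>V, of "p i" m] i m by auto
    also note lt
    also have "elt \<beta> m \<le> elt \<beta> i" using elt_le[OF \<beta>, of m i] i m by auto
    finally show ?thesis using i(1) by (intro bexI[of _ i]) (auto simp: Z_def band_def)
  next
    assume gt: "elt \<gamma> m < elt \<alpha> m"
    obtain i where i: "i \<in> {1..k}" "\<sigma> i \<le> m" "m \<le> p i"
      using bij_pigeonhole[OF \<sigma> p m(1,2)] by auto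
    have "p i \<in> {1..k}" "\<sigma> i \<in> {1..k}" using p \<sigma> i(1) unfolding bij_betw_def by auto
    hence "elt \<gamma> (\<sigma> i) \<le> elt \<gamma> m" "elt \<alpha> m \<le> elt \<alpha> (p i)"
      using elt_le[OF \<gamma>, of "\<sigma> i" m] elt_le[OF \<alpha>V, of m "p i"] i m by auto
    thus ?thesis using i(1) gt by (intro bexI[of _ i]) (auto simp: Z_def band_def)
  qed
qed

text \<open>The evaluation factors through the generic matrix.\<close>

lemma Phi_plucker:
  fixes p :: "(nat set, 'k::field) mpoly"
  assumes "p \<in> plucker_ideal k n"
  shows "Phi \<sigma> p = 0"
proof -
  let ?s = "msubst (\<lambda>(i, j). Z \<sigma> i j) :: (nat \<times> nat, 'k) mpoly \<Rightarrow> 'k band_poly"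
  interpret s: comm_ring_hom ?s by (rule msubst_hom)
  have "?s (generic_minor k \<alpha>) = minor k (Z \<sigma>) \<alpha>" for \<alpha>
    unfolding generic_minor_eq by (simp add: hom_minor[OF msubst_hom])
  hence "?s (msubst (generic_minor k) p) = Phi \<sigma> p"
    unfolding Phi_def msubst_eq_peval[of "generic_minor k"] hom_peval[OF s.comm_ring_hom_axioms]
    by (simp add: msubst_eq_peval peval_const[OF const_hom])
  thus ?thesis using assms by (simp add: plucker_ideal_iff)
qed

definition kerPhi :: "(nat set, 'k::field) mpoly set" where
  "kerPhi = {p. mvars p \<subseteq> V \<and> Phi0 p = 0}"

lemma straightening_kerPhi: "straightening k n \<beta> \<gamma> (kerPhi :: (nat set, 'k::field) mpoly set)"
proof
  fix p q :: "(nat set, 'k) mpoly"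
  show "p \<in> kerPhi \<Longrightarrow> q \<in> kerPhi \<Longrightarrow> p + q \<in> kerPhi"
    using mvars_add[of p q] by (auto simp: kerPhi_def Phi.hom_add)
  show "mvars p \<subseteq> V \<Longrightarrow> q \<in> kerPhi \<Longrightarrow> p * q \<in> kerPhi"
    using mvars_mult[of p q] by (auto simp: kerPhi_def Phi.hom_mult)
  show "p \<in> plucker_ideal k n \<Longrightarrow> p \<in> kerPhi"
    using Phi_plucker[of p "\<lambda>i. i"] by (simp add: kerPhi_def plucker_ideal_iff)
next
  fix \<alpha> assume "\<alpha> \<in> V - \<I>"
  thus "mvar \<alpha> \<in> (kerPhi :: (nat set, 'k) mpoly set)"
    using minor_outside[of \<alpha> "\<lambda>i. i"] by (simp add: kerPhi_def bij_betw_def)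
qed (simp add: kerPhi_def)

lemma lead_coord_prod:
  assumes "set xs \<subseteq> \<I>"
  shows "lookup (Phi0 (coord_prod xs) :: 'k::field band_poly) (list_exp k xs) = 1 \<and>
    (\<forall>m\<in>keys (Phi0 (coord_prod xs) :: 'k band_poly). m \<le> list_exp k xs)"
  using assms
proof (induction xs)
  case Nil
  then show ?case by simp
next
  case (Cons x xs)
  let ?p = "minor k (Z0) x :: 'k band_poly" and ?q = "Phi0 (coord_prod xs) :: 'k band_poly"
  have x: "x \<in> V" "\<And>i. 1 \<le> i \<Longrightarrow> i \<le> k \<Longrightarrow> elt \<beta> i \<le> elt x i \<and> elt x i \<le> elt \<gamma> i"
    using Cons.prems by (auto simp: interval_iff)
  have p1: "lookup ?p (set_exp k x) = 1"
    unfolding Z_def by (rule lead_minor_band(1)[OF x(1)]) (use x(2) in simp)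
  have p2: "m \<le> set_exp k x" if "m \<in> keys ?p" for m
    using that unfolding Z_def by (rule lead_minor_band(2)[OF x(1), rotated]) (use x(2) in simp)
  note p = p1 p2
  have q: "lookup ?q (list_exp k xs) = 1" "\<And>m. m \<in> keys ?q \<Longrightarrow> m \<le> list_exp k xs"
    using Cons by auto
  have "lookup (?p * ?q) (set_exp k x + list_exp k xs) = 1"
    using lead_at_mult_coeff[of ?p "set_exp k x" ?q "list_exp k xs"] p q by simp
  moreover have "m \<le> set_exp k x + list_exp k xs" if "m \<in> keys (?p * ?q)" for m
  proof -
    from subsetD[OF Poly_Mapping.keys_mult that]
    obtain a b where "a \<in> keys ?p" "b \<in> keys ?q" "m = a + b" by auto
    thus ?thesis using p(2) q(2) by (auto intro: add_mono)
  qed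
  ultimately show ?case by (simp add: Phi.hom_mult)
qed

lemma standardD:
  assumes "std xs"
  shows "set xs \<subseteq> V" "sorted_wrt (ksub_le k) xs" "set xs \<subseteq> \<I>"
  using assms by (auto simp: standard_list_def dest: interval_ksubset)

text \<open>Chains have distinct leading exponents, each with coefficient 1, so the largest of them
  cannot cancel.\<close>

lemma lead_combination:
  fixes c :: "nat set list \<Rightarrow> 'k::field"
  assumes L: "finite L" "L \<subseteq> Collect std" and ex: "\<exists>xs\<in>L. c xs \<noteq> 0"
  shows "\<exists>xs\<in>L. lead_at (Phi0 (combination L c)) (list_exp k xs)"
proof -
  define M where "M = {xs \<in> L. c xs \<noteq> 0}"
  have M: "finite M" "M \<noteq> {}" using L ex by (auto simp: M_def)
  define e where "e = Max (list_exp k ` M)"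
  have "e \<in> list_exp k ` M" unfolding e_def using M by (intro Max_in) auto
  then obtain x where x: "x \<in> M" "e = list_exp k x" by auto
  have max: "list_exp k y \<le> e" if "y \<in> M" for y
    unfolding e_def using M that by (intro Max_ge) auto
  let ?t = "\<lambda>xs. Phi0 (single 0 (c xs) * coord_prod xs) :: 'k band_poly"
  have lk: "lookup (?t xs) m = c xs * lookup (Phi0 (coord_prod xs) :: 'k band_poly) m" for xs m
  proof -
    have "lookup (single 0 a * p) m = a * lookup p m" for a and p :: "'k band_poly"
      by (simp add: lookup_mult_sum in_keys_iff)
    thus ?thesis by (simp add: Phi.hom_mult)
  qed
  have std: "std xs" if "xs \<in> L" for xs using that L by auto
  have other: "lookup (?t xs) e = (if xs = x then c x else 0)" if "xs \<in> L" for xs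
  proof (cases "xs = x")
    case True
    then show ?thesis using lead_coord_prod[OF standardD(3)[OF std[OF that]], where ?'k = 'k] x by (simp add: lk)
  next
    case False
    show ?thesis
    proof (cases "xs \<in> M")
      case True
      have "list_exp k xs \<noteq> e"
        using list_exp_inj[OF k_pos, of xs x n] standardD[OF std[OF that]] standardD[OF std, of x] x False
        by (auto simp: M_def)
      hence "\<not> e \<le> list_exp k xs" using max[OF True] by auto
      hence "lookup (Phi0 (coord_prod xs) :: 'k band_poly) e = 0"
        using lead_coord_prod[OF standardD(3)[OF std[OF that]], where ?'k = 'k] by (metis in_keys_iff)
      thus ?thesis using False by (simp add: lk)
    next
      case False
      then show ?thesis using \<open>xs \<noteq> x\<close> that by (simp add: lk M_def)
    qed
  qed
  have comb: "Phi0 (combination L c) = (\<Sum>xs\<in>L. ?t xs)"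
    by (simp add: combination_def Phi.hom_sum)
  have "lead_at (Phi0 (combination L c)) e"
    unfolding lead_at_def
  proof
    have "lookup (Phi0 (combination L c)) e = (\<Sum>xs\<in>L. if xs = x then c x else 0)"
      unfolding comb lookup_sum using other by (rule sum.cong[OF refl])
    also have "\<dots> = c x" using x L by (simp add: M_def)
    finally show "lookup (Phi0 (combination L c)) e \<noteq> 0" using x by (simp add: M_def)
    show "\<forall>m\<in>keys (Phi0 (combination L c)). m \<le> e"
    proof
      fix m assume "m \<in> keys (Phi0 (combination L c))"
      then obtain xs where xs: "xs \<in> L" "m \<in> keys (?t xs)"
        unfolding comb using Poly_Mapping.keys_sum[of ?t L] by blast
      hence "c xs \<noteq> 0" "m \<in> keys (Phi0 (coord_prod xs) :: 'k band_poly)"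
        by (auto simp: in_keys_iff lk)
      hence "m \<le> list_exp k xs" "list_exp k xs \<le> e"
        using lead_coord_prod[OF standardD(3)[OF std[OF xs(1)]], where ?'k = 'k] max[of xs] xs(1) by (auto simp: M_def)
      thus "m \<le> e" by simp
    qed
  qed
  thus ?thesis using x by (auto simp: M_def)
qed

lemma lead_Phi:
  fixes p :: "(nat set, 'k::field) mpoly"
  assumes "mvars p \<subseteq> V" "Phi0 p \<noteq> 0"
  shows "\<exists>xs. std xs \<and> lead_at (Phi0 p) (list_exp k xs)"
proof -
  interpret straightening k n \<beta> \<gamma> "kerPhi :: (nat set, 'k) mpoly set"
    by (rule straightening_kerPhi)
  obtain L c where L: "finite L" "L \<subseteq> Collect std" "p - combination L c \<in> kerPhi"
    using straight_all[OF assms(1)] by (auto simp: straight_def)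
  hence eq: "Phi0 p = Phi0 (combination L c)"
    by (simp add: kerPhi_def Phi.hom_minus)
  have "\<exists>xs\<in>L. c xs \<noteq> 0"
  proof (rule ccontr)
    assume "\<not> ?thesis"
    hence "combination L c = 0" by (simp add: combination_def)
    thus False using assms(2) eq by simp
  qed
  from lead_combination[OF L(1,2) this] show ?thesis using eq L(2) by auto
qed

text \<open>Modulo \<open>N\<close> a polynomial is a combination of standard monomials, and these
  stay linearly independent on the band matrix.\<close>

theorem Phi_kernel:
  fixes p :: "(nat set, 'k::field) mpoly"
  assumes N: "straightening k n \<beta> \<gamma> N" and "\<And>q. q \<in> N \<Longrightarrow> Phi0 q = 0"
    and "mvars p \<subseteq> V" "Phi0 p = 0"
  shows "p \<in> N"
proof -
  interpret straightening k n \<beta> \<gamma> N by (rule N)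
  obtain L c where L: "finite L" "L \<subseteq> Collect std" "p - combination L c \<in> N"
    using straight_all[OF assms(3)] by (auto simp: straight_def)
  have "Phi0 (p - combination L c) = 0" using assms(2) L(3) by blast
  hence "Phi0 (combination L c) = 0" using assms(4) by (simp add: Phi.hom_minus)
  hence "\<not> (\<exists>xs\<in>L. c xs \<noteq> 0)"
    using lead_combination[OF L(1,2), of c] by (auto simp: lead_at_def)
  hence "combination L c = 0" by (simp add: combination_def)
  thus ?thesis using L(3) by simp
qed

end

section \<open>Gradings of the band polynomials\<close>

text \<open>The value at \<open>(True, j)\<close> is the degree in column \<open>j\<close>, the value at \<open>(False, i)\<close> the degree in row \<open>i\<close>.\<close>

definition grade :: "nat \<Rightarrow> nat \<Rightarrow> ((nat \<times> nat) \<Rightarrow>\<^sub>0 nat) \<Rightarrow> bool \<times> nat \<Rightarrow> nat" where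
  "grade k n e = (\<lambda>(b, a). if b then \<Sum>i=1..k. lookup e (i, a)
    else \<Sum>j=0..n. lookup e (a, j))"

lemma grade_add: "grade k n (a + b) x = grade k n a x + grade k n b x"
  by (simp add: grade_def lookup_add sum.distrib split: prod.split)

definition homogeneous :: "nat \<Rightarrow> nat \<Rightarrow> (bool \<times> nat \<Rightarrow> nat) \<Rightarrow> 'k::comm_ring_1 band_poly \<Rightarrow> bool" where
  "homogeneous k n g x \<longleftrightarrow> (\<forall>e\<in>keys x. grade k n e = g)"

definition part :: "nat \<Rightarrow> nat \<Rightarrow> (bool \<times> nat \<Rightarrow> nat) \<Rightarrow> 'k::comm_ring_1 band_poly \<Rightarrow> 'k band_poly" where
  "part k n g x = (\<Sum>e | e \<in> keys x \<and> grade k n e = g. single e (lookup x e))"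

lemma lookup_part: "lookup (part k n g x) e = (if grade k n e = g then lookup x e else 0)"
  by (simp add: part_def lookup_sum lookup_single when_def sum.delta' in_keys_iff)

lemma part_add: "part k n g (x + y) = part k n g x + part k n g y"
  by (rule poly_mapping_eqI) (simp add: lookup_part lookup_add)

lemma part_sum: "part k n g (sum f A) = (\<Sum>i\<in>A. part k n g (f i))"
proof -
  have zero: "part k n g 0 = 0" by (rule poly_mapping_eqI) (simp add: lookup_part)
  show ?thesis by (induction A rule: infinite_finite_induct) (simp_all add: part_add zero)
qed

lemma homogeneous_part: "homogeneous k n g (part k n g x)"
  by (auto simp: homogeneous_def in_keys_iff lookup_part split: if_splits)

lemma part_homogeneous:
  assumes "homogeneous k n h x"
  shows "part k n g x = (if g = h then x else 0)"
  by (rule poly_mapping_eqI) (use assms in \<open>auto simp: lookup_part homogeneous_def in_keys_iff\<close>)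

lemma sum_parts: "x = (\<Sum>g\<in>grade k n ` keys x. part k n g x)"
proof (rule poly_mapping_eqI)
  fix e
  have "lookup (\<Sum>g\<in>grade k n ` keys x. part k n g x) e
      = (\<Sum>g\<in>grade k n ` keys x. if g = grade k n e then lookup x e else 0)"
    unfolding lookup_sum lookup_part by (rule sum.cong) auto
  also have "\<dots> = lookup x e"
    by (auto simp: sum.delta' in_keys_iff image_iff)
  finally show "lookup x e = lookup (\<Sum>g\<in>grade k n ` keys x. part k n g x) e" ..
qed

lemma homogeneous_mult:
  assumes "homogeneous k n g x" "homogeneous k n h y"
  shows "homogeneous k n (\<lambda>a. g a + h a) (x * y)"
  unfolding homogeneous_def
proof
  fix e assume "e \<in> keys (x * y)"
  from subsetD[OF Poly_Mapping.keys_mult this]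
  obtain a b where "a \<in> keys x" "b \<in> keys y" "e = a + b" by auto
  thus "grade k n e = (\<lambda>a. g a + h a)"
    using assms by (auto simp: homogeneous_def grade_add fun_eq_iff)
qed

lemma homogeneous_add:
  assumes "homogeneous k n g x" "homogeneous k n g y"
  shows "homogeneous k n g (x + y)"
  using assms Poly_Mapping.keys_add[of x y] unfolding homogeneous_def by blast

lemma homogeneous_uminus: "homogeneous k n g x \<Longrightarrow> homogeneous k n g (- x)"
  by (auto simp: homogeneous_def in_keys_iff)

lemma homogeneous_scale: "homogeneous k n g x \<Longrightarrow> homogeneous k n g (single 0 c * x)"
proof -
  have "lookup (single 0 c * x) m = c * lookup x m" for m
    by (simp add: lookup_mult_sum in_keys_iff)
  thus "homogeneous k n g x \<Longrightarrow> homogeneous k n g (single 0 c * x)"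
    by (auto simp: homogeneous_def in_keys_iff)
qed

lemma part_mult:
  assumes m: "homogeneous k n h m"
  shows "part k n (\<lambda>a. h a + g a) (m * x) = m * part k n g x"
proof -
  let ?G = "grade k n ` keys x"
  have *: "(\<lambda>a. h a + g a) = (\<lambda>a. h a + g' a) \<longleftrightarrow> g = g'" for g' by (auto simp: fun_eq_iff)
  have "m * x = (\<Sum>g'\<in>?G. m * part k n g' x)"
    using sum_parts[of x k n] by (simp add: sum_distrib_left[symmetric])
  hence "part k n (\<lambda>a. h a + g a) (m * x) = (\<Sum>g'\<in>?G. part k n (\<lambda>a. h a + g a) (m * part k n g' x))"
    by (simp add: part_sum)
  also have "\<dots> = (\<Sum>g'\<in>?G. if g = g' then m * part k n g' x else 0)"
    by (simp add: part_homogeneous[OF homogeneous_mult[OF m homogeneous_part]] *)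
  also have "\<dots> = m * part k n g x"
  proof (cases "g \<in> ?G")
    case False
    have "part k n g x = 0"
      using False by (intro poly_mapping_eqI) (auto simp: lookup_part in_keys_iff image_iff)
    thus ?thesis using False by (simp add: sum.delta)
  qed (simp add: sum.delta)
  finally show ?thesis .
qed

text \<open>Every term of a minor uses each row and each chosen column once.\<close>

lemma grade_diag_exp_permuted:
  assumes \<alpha>: "\<alpha> \<in> ksubsets k n" and p: "p permutes {0..<k}"
  shows "grade k n (diag_exp k (\<lambda>i. elt \<alpha> (p (i - 1) + 1))) = grade k n (set_exp k \<alpha>)"
proof (rule ext, clarify)
  fix b a
  show "grade k n (diag_exp k (\<lambda>i. elt \<alpha> (p (i - 1) + 1))) (b, a) = grade k n (set_exp k \<alpha>) (b, a)"
  proof (cases b)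
    case True
    have "(\<Sum>i=1..k. if elt \<alpha> (p (i - 1) + 1) = a then 1 else 0 :: nat) = (\<Sum>i\<in>{0..<k}. if elt \<alpha> (p i + 1) = a then 1 else 0)"
      by (rule sum.reindex_bij_witness[where i = "\<lambda>i. i + 1" and j = "\<lambda>i. i - 1"]) auto
    also have "\<dots> = (\<Sum>i\<in>{0..<k}. if elt \<alpha> (i + 1) = a then 1 else 0)"
      using sum.permute[OF p, of "\<lambda>i. if elt \<alpha> (i + 1) = a then 1 else 0 :: nat"] by (simp add: comp_def)
    also have "\<dots> = (\<Sum>i=1..k. if elt \<alpha> i = a then 1 else 0)"
      by (rule sum.reindex_bij_witness[where i = "\<lambda>i. i - 1" and j = "\<lambda>i. i + 1"]) auto
    finally show ?thesis using True by (simp add: grade_def lookup_diag_exp)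
  next
    case False
    have S: "(\<Sum>j=0..n. if 1 \<le> a \<and> a \<le> k \<and> c a = j then 1 else 0 :: nat) = (if 1 \<le> a \<and> a \<le> k then 1 else 0)"
      if c: "1 \<le> a \<Longrightarrow> a \<le> k \<Longrightarrow> c a \<le> n" for c
    proof (cases "1 \<le> a \<and> a \<le> k")
      case True
      thus ?thesis using c by simp
    next
      case False
      thus ?thesis by (intro trans[OF sum.neutral]) auto
    qed
    have "elt \<alpha> (p (a - 1) + 1) \<le> n" if a: "1 \<le> a" "a \<le> k"
    proof -
      have "p (a - 1) < k" using permutes_in_image[OF p, of "a - 1"] a by simp
      thus ?thesis by (intro elt_mem(3)[OF \<alpha>]) auto
    qed
    from S[of "\<lambda>i. elt \<alpha> (p (i - 1) + 1)", OF this] S[of "elt \<alpha>", OF elt_mem(3)[OF \<alpha>]]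
    show ?thesis using False by (simp only: grade_def lookup_diag_exp prod.case if_False)
  qed
qed

section \<open>The subalgebra generated by the minors of the band matrix\<close>

context richardson
begin

definition Q :: "'k::field band_poly set" where
  "Q = Phi0 ` {p. mvars p \<subseteq> V}"

lemma Q_I: "mvars p \<subseteq> V \<Longrightarrow> Phi0 p \<in> Q"
  by (auto simp: Q_def)

lemma Q_const [intro]: "single 0 c \<in> Q"
  using Q_I[of "single 0 c"] by simp

lemma Q_0 [intro]: "0 \<in> Q" and Q_1 [intro]: "1 \<in> Q"
  using Q_const[of 0] Q_const[of 1] by simp_all

lemma Q_add [intro]: "x \<in> Q \<Longrightarrow> y \<in> Q \<Longrightarrow> x + y \<in> Q"
proof -
  assume "x \<in> Q" "y \<in> Q"
  then obtain p q where "mvars p \<subseteq> V" "mvars q \<subseteq> V" "x = Phi0 p" "y = Phi0 q" by (auto simp: Q_def)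
  thus ?thesis using mvars_add[of p q] Q_I[of "p + q"] by (auto simp: Phi.hom_add)
qed

lemma Q_mult [intro]: "x \<in> Q \<Longrightarrow> y \<in> Q \<Longrightarrow> x * y \<in> Q"
proof -
  assume "x \<in> Q" "y \<in> Q"
  then obtain p q where "mvars p \<subseteq> V" "mvars q \<subseteq> V" "x = Phi0 p" "y = Phi0 q" by (auto simp: Q_def)
  thus ?thesis using mvars_mult[of p q] Q_I[of "p * q"] by (auto simp: Phi.hom_mult)
qed

lemma Q_uminus [intro]: "x \<in> Q \<Longrightarrow> - x \<in> Q"
proof -
  assume "x \<in> Q"
  then obtain p where "mvars p \<subseteq> V" "x = Phi0 p" by (auto simp: Q_def)
  thus ?thesis using Q_I[of "- p"] by (auto simp: Phi.hom_uminus)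
qed

lemma Q_diff [intro]: "x \<in> Q \<Longrightarrow> y \<in> Q \<Longrightarrow> x - y \<in> Q"
  using Q_add[OF _ Q_uminus, of x y] by simp

lemma Q_sum: "(\<And>i. i \<in> A \<Longrightarrow> f i \<in> Q) \<Longrightarrow> sum f A \<in> Q"
  by (induction A rule: infinite_finite_induct) auto

lemma Q_minor: "\<alpha> \<in> V \<Longrightarrow> minor k Z0 \<alpha> \<in> Q"
  using Q_I[of "mvar \<alpha>"] by simp

lemma Q_power [intro]: "x \<in> Q \<Longrightarrow> x ^ m \<in> Q"
  by (induction m) auto

lemma homogeneous_minor:
  assumes "\<alpha> \<in> \<I>"
  shows "homogeneous k n (grade k n (set_exp k \<alpha>)) (minor k Z0 \<alpha>)"
  unfolding homogeneous_def
proof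
  fix e assume e: "e \<in> keys (minor k Z0 \<alpha> :: 'k::field band_poly)"
  have \<alpha>: "\<alpha> \<in> V" "\<And>i. 1 \<le> i \<Longrightarrow> i \<le> k \<Longrightarrow> elt \<beta> i \<le> elt \<alpha> i \<and> elt \<alpha> i \<le> elt \<gamma> i"
    using assms by (auto simp: interval_iff)
  obtain p where "p permutes {0..<k}" "e = diag_exp k (\<lambda>i. elt \<alpha> (p (i - 1) + 1))"
    using lead_minor_band(3)[OF \<alpha> e[unfolded Z_def]] by auto
  thus "grade k n e = grade k n (set_exp k \<alpha>)" using grade_diag_exp_permuted[OF \<alpha>(1)] by simp
qed

definition banded :: "((nat \<times> nat) \<Rightarrow>\<^sub>0 nat) \<Rightarrow> bool" where
  "banded e \<longleftrightarrow> (\<forall>i j. lookup e (i, j) \<noteq> 0 \<longrightarrow> 1 \<le> i \<and> i \<le> k \<and> elt \<beta> i \<le> j \<and> j \<le> elt \<gamma> i)"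

lemma banded_add: "banded (a + b) \<longleftrightarrow> banded a \<and> banded b"
  unfolding banded_def lookup_add by auto

lemma banded_minor:
  assumes "\<alpha> \<in> \<I>" and e: "e \<in> keys (minor k Z0 \<alpha> :: 'k::field band_poly)"
  shows "banded e"
proof -
  have \<alpha>: "\<alpha> \<in> V" "\<And>i. 1 \<le> i \<Longrightarrow> i \<le> k \<Longrightarrow> elt \<beta> i \<le> elt \<alpha> i \<and> elt \<alpha> i \<le> elt \<gamma> i"
    using assms by (auto simp: interval_iff)
  obtain p where p: "\<forall>i<k. elt \<beta> (i + 1) \<le> elt \<alpha> (p i + 1) \<and> elt \<alpha> (p i + 1) \<le> elt \<gamma> (i + 1)"
      "e = diag_exp k (\<lambda>i. elt \<alpha> (p (i - 1) + 1))"
    using lead_minor_band(3)[OF \<alpha> e[unfolded Z_def]] by auto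
  have "elt \<beta> i \<le> elt \<alpha> (p (i - 1) + 1) \<and> elt \<alpha> (p (i - 1) + 1) \<le> elt \<gamma> i" if "1 \<le> i" "i \<le> k" for i
    using p(1)[rule_format, of "i - 1"] that by simp
  thus ?thesis unfolding banded_def p(2) lookup_diag_exp by auto
qed

lemma homogeneous_coord_prod:
  assumes "set xs \<subseteq> \<I>"
  shows "homogeneous k n (grade k n (list_exp k xs)) (Phi0 (coord_prod xs) :: 'k::field band_poly) \<and>
    (\<forall>e\<in>keys (Phi0 (coord_prod xs) :: 'k band_poly). banded e)"
  using assms
proof (induction xs)
  case Nil
  then show ?case by (simp add: homogeneous_def banded_def)
next
  case (Cons x xs)
  have "homogeneous k n (grade k n (set_exp k x + list_exp k xs)) (minor k Z0 x * Phi0 (coord_prod xs) :: 'k band_poly)"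
    using homogeneous_mult[OF homogeneous_minor, of x "grade k n (list_exp k xs)" "Phi0 (coord_prod xs) :: 'k band_poly"] Cons
    by (simp add: grade_add fun_eq_iff homogeneous_def)
  moreover have "banded e" if "e \<in> keys (minor k Z0 x * Phi0 (coord_prod xs) :: 'k band_poly)" for e
  proof -
    from subsetD[OF Poly_Mapping.keys_mult that]
    obtain a b where "a \<in> keys (minor k Z0 x :: 'k band_poly)"
      "b \<in> keys (Phi0 (coord_prod xs) :: 'k band_poly)" "e = a + b" by auto
    thus ?thesis using banded_minor[of x a, where ?'k = 'k] Cons by (auto simp: banded_add)
  qed
  ultimately show ?case by (simp add: Phi.hom_mult)
qed

lemma Q_combination:
  assumes "x \<in> (Q :: 'k::field band_poly set)"
  shows "\<exists>L c. finite L \<and> L \<subseteq> Collect std \<and> x = Phi0 (combination L c)"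
proof -
  interpret straightening k n \<beta> \<gamma> "kerPhi :: (nat set, 'k) mpoly set"
    by (rule straightening_kerPhi)
  obtain p where p: "mvars p \<subseteq> V" "x = Phi0 p" using assms by (auto simp: Q_def)
  obtain L c where L: "finite L" "L \<subseteq> Collect std" "p - combination L c \<in> kerPhi"
    using straight_all[OF p(1)] by (auto simp: straight_def)
  hence "Phi0 p = Phi0 (combination L c)" by (simp add: kerPhi_def Phi.hom_minus)
  thus ?thesis using L p by blast
qed

lemma Q_lead:
  assumes "x \<in> (Q :: 'k::field band_poly set)" "x \<noteq> 0"
  shows "\<exists>xs. std xs \<and> lead_at x (list_exp k xs)"
  using assms lead_Phi by (auto simp: Q_def)

lemma combination_in_Q:
  assumes "L \<subseteq> Collect std"
  shows "Phi0 (combination L c) \<in> (Q :: 'k::field band_poly set)"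
  unfolding combination_def Phi.hom_sum Phi.hom_mult
proof (intro Q_sum Q_mult)
  fix xs assume "xs \<in> L"
  hence "set xs \<subseteq> V" using assms standardD(1) by blast
  thus "Phi0 (coord_prod xs) \<in> (Q :: 'k band_poly set)"
    using mvars_coord_prod[of xs] by (intro Q_I) blast
qed auto

text \<open>\<open>Q\<close> is spanned by products of minors, which are homogeneous.\<close>

lemma Q_part:
  assumes "x \<in> (Q :: 'k::field band_poly set)"
  shows "part k n g x \<in> Q"
proof -
  obtain L c where L: "finite L" "L \<subseteq> Collect std" "x = Phi0 (combination L c)"
    using Q_combination[OF assms] by blast
  let ?t = "\<lambda>xs. Phi0 (single 0 (c xs) * coord_prod xs) :: 'k band_poly"
  have hom: "homogeneous k n (grade k n (list_exp k xs)) (?t xs)" if "xs \<in> L" for xs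
  proof -
    have "std xs" using that L by auto
    thus ?thesis
      using homogeneous_coord_prod[OF standardD(3), of xs, where ?'k = 'k] by (simp add: Phi.hom_mult homogeneous_scale)
  qed
  have "part k n g x = (\<Sum>xs\<in>L. part k n g (?t xs))"
    unfolding L(3) combination_def by (simp add: Phi.hom_sum part_sum)
  also have "\<dots> = (\<Sum>xs\<in>L. if grade k n (list_exp k xs) = g then ?t xs else 0)"
    by (intro sum.cong refl) (auto simp: part_homogeneous[OF hom])
  also have "\<dots> = (\<Sum>xs\<in>{xs \<in> L. grade k n (list_exp k xs) = g}. ?t xs)"
    using L(1) by (simp add: sum.inter_filter)
  also have "\<dots> = Phi0 (combination {xs \<in> L. grade k n (list_exp k xs) = g} c)"
    unfolding combination_def by (simp add: Phi.hom_sum)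
  also have "\<dots> \<in> Q" using L by (intro combination_in_Q) auto
  finally show ?thesis .
qed

lemma Q_banded:
  assumes "x \<in> (Q :: 'k::field band_poly set)" "e \<in> keys x"
  shows "banded e"
proof -
  obtain L c where L: "finite L" "L \<subseteq> Collect std" "x = Phi0 (combination L c)"
    using Q_combination[OF assms(1)] by blast
  let ?t = "\<lambda>xs. Phi0 (single 0 (c xs) * coord_prod xs) :: 'k band_poly"
  have "x = (\<Sum>xs\<in>L. ?t xs)" using L(3) by (simp add: combination_def Phi.hom_sum)
  then obtain xs where xs: "xs \<in> L" "e \<in> keys (?t xs)"
    using assms(2) Poly_Mapping.keys_sum[of ?t L] by blast
  have "lookup (single 0 a * p) m = a * lookup p m" for a m and p :: "'k band_poly"
    by (simp add: lookup_mult_sum in_keys_iff)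
  hence "e \<in> keys (Phi0 (coord_prod xs) :: 'k band_poly)"
    using xs(2) by (auto simp: in_keys_iff Phi.hom_mult)
  thus ?thesis using homogeneous_coord_prod[OF standardD(3), of xs, where ?'k = 'k] xs(1) L(2) by auto
qed

text \<open>Within one graded piece the exponents at the two ends of each row are determined by the others,
  so that the lexicographic order is decided by the finitely many interior exponents.\<close>

definition interior :: "(nat \<times> nat) list" where
  "interior = sorted_list_of_set {(i, j). 1 \<le> i \<and> i \<le> k \<and> elt \<beta> i < j \<and> j < elt \<gamma> i}"

definition interior_exps :: "((nat \<times> nat) \<Rightarrow>\<^sub>0 nat) \<Rightarrow> nat list" where
  "interior_exps e = map (lookup e) interior"

lemma set_interior: "set interior = {(i, j). 1 \<le> i \<and> i \<le> k \<and> elt \<beta> i < j \<and> j < elt \<gamma> i}"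
proof -
  have "{(i, j). 1 \<le> i \<and> i \<le> k \<and> elt \<beta> i < j \<and> j < elt \<gamma> i} \<subseteq> {1..k} \<times> {0..n}"
    using elt_mem(3)[OF \<gamma>] by fastforce
  hence "finite {(i, j). 1 \<le> i \<and> i \<le> k \<and> elt \<beta> i < j \<and> j < elt \<gamma> i}"
    by (rule finite_subset) simp
  thus ?thesis unfolding interior_def by simp
qed

text \<open>At the first difference in reading order, a left end \<open>(i, \<beta>(i))\<close> is
  excluded because the rows below do not reach its column, so the column degree would differ; a
  right end is excluded by the row degree.\<close>

lemma interior_lex:
  assumes lt: "e < e'" and gr: "grade k n e = grade k n e'" and b: "banded e" "banded e'"
  shows "(interior_exps e, interior_exps e') \<in> lex less_than"
proof -
  obtain i j where ij: "lookup e (i, j) < lookup e' (i, j)"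
    "\<And>y. y < (i, j) \<Longrightarrow> lookup e y = lookup e' y"
    using lt unfolding less_poly_mapping_iff by force
  have "lookup e' (i, j) \<noteq> 0" using ij(1) by simp
  hence i: "1 \<le> i" "i \<le> k" "elt \<beta> i \<le> j" "j \<le> elt \<gamma> i" using b(2) unfolding banded_def by blast+
  have zero: "lookup d (a, c) = 0" if "banded d" "\<not> (1 \<le> a \<and> a \<le> k \<and> elt \<beta> a \<le> c \<and> c \<le> elt \<gamma> a)" for d a c
    using that unfolding banded_def by blast
  have "j \<noteq> elt \<beta> i"
  proof
    assume j: "j = elt \<beta> i"
    have "(\<Sum>a=1..k. lookup e (a, j)) < (\<Sum>a=1..k. lookup e' (a, j))"
    proof (rule sum_strict_mono_ex1)
      show "\<forall>a\<in>{1..k}. lookup e (a, j) \<le> lookup e' (a, j)"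
      proof
        fix a assume a: "a \<in> {1..k}"
        consider "a < i" | "a = i" | "i < a" by linarith
        thus "lookup e (a, j) \<le> lookup e' (a, j)"
        proof cases
          case 3
          hence "j < elt \<beta> a" using elt_less[OF \<beta>, of i a] i a j by simp
          thus ?thesis using zero[OF b(1), of a j] by simp
        qed (use ij in auto)
      qed
      show "\<exists>a\<in>{1..k}. lookup e (a, j) < lookup e' (a, j)"
        using i ij by (intro bexI[of _ i]) auto
    qed simp
    moreover have "grade k n e (True, j) = grade k n e' (True, j)" using gr by simp
    ultimately show False by (simp add: grade_def)
  qed
  moreover have "j \<noteq> elt \<gamma> i"
  proof
    assume j: "j = elt \<gamma> i"
    have "(\<Sum>c=0..n. lookup e (i, c)) < (\<Sum>c=0..n. lookup e' (i, c))"
    proof (rule sum_strict_mono_ex1)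
      show "\<forall>c\<in>{0..n}. lookup e (i, c) \<le> lookup e' (i, c)"
      proof
        fix c assume c: "c \<in> {0..n}"
        consider "c < j" | "c = j" | "j < c" by linarith
        thus "lookup e (i, c) \<le> lookup e' (i, c)"
        proof cases
          case 3
          thus ?thesis using zero[OF b(1), of i c] j by simp
        qed (use ij in auto)
      qed
      show "\<exists>c\<in>{0..n}. lookup e (i, c) < lookup e' (i, c)"
        using i ij elt_mem(3)[OF \<gamma>, of i] by (intro bexI[of _ j]) auto
    qed simp
    moreover have "grade k n e (False, i) = grade k n e' (False, i)" using gr by simp
    ultimately show False by (simp add: grade_def)
  qed
  ultimately have "(i, j) \<in> set interior" using i by (simp add: set_interior)
  then obtain us vs where uv: "interior = us @ (i, j) # vs" by (meson split_list)
  have "sorted_wrt (<) interior" unfolding interior_def by simp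
  hence us: "y < (i, j)" if "y \<in> set us" for y using that uv by (auto simp: sorted_wrt_append)
  let ?u = "map (lookup e') us"
  have u: "map (lookup e) us = ?u"
    using us ij(2) by auto
  show ?thesis
    unfolding lex_conv interior_exps_def uv mem_Collect_eq prod.case
    by (intro conjI exI[of _ ?u] exI[of _ "lookup e (i, j)"] exI[of _ "lookup e' (i, j)"]
        exI[of _ "map (lookup e) vs"] exI[of _ "map (lookup e') vs"])
      (simp_all add: u ij(1))
qed

lemma interior_exps_shift: "interior_exps (e + set_exp k \<beta> + set_exp k \<gamma>) = interior_exps e"
  unfolding interior_exps_def
  by (rule map_cong) (auto simp: set_interior lookup_add lookup_diag_exp)

end

section \<open>Splicing two subsets\<close>

text \<open>Gluing the first \<open>s\<close> elements of \<open>a\<close> to the last \<open>k -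
  s\<close> elements of \<open>b\<close>; \<open>delta\<close> is the instance with
  \<open>\<beta>\<close> and \<open>\<gamma>\<close>, and the shifted chains below use
  others.\<close>

lemma splice:
  assumes a: "a \<in> ksubsets k n" and b: "b \<in> ksubsets k n"
    and lt: "1 \<le> s \<Longrightarrow> s < k \<Longrightarrow> elt a s < elt b (s + 1)" and s: "s \<le> k"
  shows "delta k a b s \<in> ksubsets k n"
    and "\<And>i. 1 \<le> i \<Longrightarrow> i \<le> k \<Longrightarrow> elt (delta k a b s) i = (if i \<le> s then elt a i else elt b i)"
proof -
  let ?c = "\<lambda>i. if i \<le> s then elt a i else elt b i"
  have im: "?c ` {1..k} = delta k a b s"
  proof -
    have "{1..k} = {1..s} \<union> {s + 1..k}" using s by auto
    hence "?c ` {1..k} = ?c ` {1..s} \<union> ?c ` {s + 1..k}" by (metis image_Un)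
    also have "?c ` {1..s} = elt a ` {1..s}" by (rule image_cong) auto
    also have "?c ` {s + 1..k} = elt b ` {s + 1..k}" by (rule image_cong) auto
    finally show ?thesis by (simp add: delta_def)
  qed
  have mono: "?c i < ?c j" if "1 \<le> i" "i < j" "j \<le> k" for i j
  proof -
    consider "j \<le> s" | "s < i" | "i \<le> s" "s < j" by linarith
    thus ?thesis
    proof cases
      case 1
      thus ?thesis using that elt_less[OF a] by simp
    next
      case 2
      thus ?thesis using that elt_less[OF b] by simp
    next
      case 3
      have "elt a i \<le> elt a s" using elt_le[OF a, of i s] that 3 s by simp
      also have "\<dots> < elt b (s + 1)" using lt that 3 by simp
      also have "\<dots> \<le> elt b j" using elt_le[OF b, of "s + 1" j] that 3 by simp
      finally show ?thesis using 3 by simp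
    qed
  qed
  have range: "1 \<le> ?c i \<and> ?c i \<le> n" if "1 \<le> i" "i \<le> k" for i
    using elt_mem[OF a, of i] elt_mem[OF b, of i] that by simp
  show "delta k a b s \<in> ksubsets k n"
    using elt_of_image(1)[of k ?c n, OF mono range] im by simp
  show "elt (delta k a b s) i = ?c i" if "1 \<le> i" "i \<le> k" for i
    using elt_of_image(2)[of k ?c n, OF mono range that] im by simp
qed

text \<open>The hypothesis \<open>gap\<close> is what a nonempty \<open>\<P>\<^sub>t\<close>
  provides.\<close>

locale richardson_step = richardson +
  fixes t :: nat
  assumes t: "1 \<le> t" "t < k" and gap: "elt \<beta> (t + 1) \<le> elt \<gamma> t"
begin

lemma delta_aux: "1 \<le> s \<Longrightarrow> s < k \<Longrightarrow> elt \<beta> s < elt \<gamma> (s + 1)"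
  using elt_less[OF \<gamma>, of s "s + 1"] \<beta>_le_\<gamma>[of s] by simp

lemma delta_V: "s \<le> k \<Longrightarrow> delta k \<beta> \<gamma> s \<in> V"
  by (rule splice[OF \<beta> \<gamma> delta_aux])

lemma elt_delta: "s \<le> k \<Longrightarrow> 1 \<le> i \<Longrightarrow> i \<le> k \<Longrightarrow> elt (delta k \<beta> \<gamma> s) i = (if i \<le> s then elt \<beta> i else elt \<gamma> i)"
  by (rule splice(2)[OF \<beta> \<gamma> delta_aux])

lemma delta_interval: "s \<le> k \<Longrightarrow> delta k \<beta> \<gamma> s \<in> \<I>"
  using delta_V elt_delta \<beta>_le_\<gamma> by (simp add: interval_iff)

lemma delta_0: "delta k \<beta> \<gamma> 0 = \<gamma>" and delta_k: "delta k \<beta> \<gamma> k = \<beta>"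
  by (rule ksubset_eqI[OF delta_V \<gamma>], simp_all add: elt_delta,
      rule ksubset_eqI[OF delta_V \<beta>], simp_all add: elt_delta)

lemma \<beta>_interval: "\<beta> \<in> \<I>" and \<gamma>_interval: "\<gamma> \<in> \<I>"
  using delta_interval[of k] delta_interval[of 0] by (simp_all add: delta_0 delta_k)

text \<open>The product of the left ends of the rows up to \<open>s\<close> and of the right ends of
  the other rows, see \<open>P_prod\<close>.\<close>

definition P :: "nat \<Rightarrow> 'k::field band_poly" where
  "P s = minor k Z0 (delta k \<beta> \<gamma> s)"

lemma lead_at_coord_prod:
  "set xs \<subseteq> \<I> \<Longrightarrow> lead_at (Phi0 (coord_prod xs) :: 'k::field band_poly) (list_exp k xs)"
  using lead_coord_prod[of xs, where ?'k = 'k] by (simp add: lead_at_def)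

lemma lead_at_P: "s \<le> k \<Longrightarrow> lead_at (P s :: 'k::field band_poly) (set_exp k (delta k \<beta> \<gamma> s))"
  using lead_at_coord_prod[of "[delta k \<beta> \<gamma> s]", where ?'k = 'k] delta_interval
  by (simp add: P_def Phi.hom_mult)

lemma P_Q: "s \<le> k \<Longrightarrow> P s \<in> Q"
  unfolding P_def by (rule Q_minor[OF delta_V])

section \<open>Facet functionals of the leading exponents\<close>

text \<open>For a chain this compares how many entries of row \<open>t\<close> are at most
  \<open>j\<close> with how many entries of row \<open>t + 1\<close> are at most \<open>j +
  1\<close>; increasing columns make it nonnegative.\<close>

definition facet :: "nat \<Rightarrow> ((nat \<times> nat) \<Rightarrow>\<^sub>0 nat) \<Rightarrow> int" where
  "facet j e = int (\<Sum>c=0..j. lookup e (t, c)) - int (\<Sum>c=0..j + 1. lookup e (t + 1, c))"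

lemma facet_add: "facet j (a + b) = facet j a + facet j b"
  by (simp add: facet_def lookup_add sum.distrib)

lemma facet_0 [simp]: "facet j 0 = 0"
  by (simp add: facet_def)

lemma facet_set_exp: "facet j (set_exp k \<alpha>) = of_bool (elt \<alpha> t \<le> j) - of_bool (elt \<alpha> (t + 1) \<le> j + 1)"
proof -
  have S: "(\<Sum>c=0..m. lookup (set_exp k \<alpha>) (i, c)) = of_bool (elt \<alpha> i \<le> m)" if "1 \<le> i" "i \<le> k" for i m
  proof -
    have "(\<Sum>c=0..m. lookup (set_exp k \<alpha>) (i, c)) = (\<Sum>c\<in>{0..m}. if elt \<alpha> i = c then 1 else 0)"
      using that by (simp add: lookup_diag_exp)
    thus ?thesis by simp
  qed
  have "1 \<le> t" "t \<le> k" "1 \<le> t + 1" "t + 1 \<le> k" using t by simp_all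
  thus ?thesis unfolding facet_def by (simp only: S of_nat_of_bool)
qed

lemma facet_list_exp: "facet j (list_exp k xs) = int (length (filter (\<lambda>\<alpha>. elt \<alpha> t \<le> j) xs))
    - int (length (filter (\<lambda>\<alpha>. elt \<alpha> (t + 1) \<le> j + 1) xs))"
  by (induction xs) (auto simp: facet_add facet_set_exp)

lemma facet_nonneg:
  assumes "set xs \<subseteq> V"
  shows "0 \<le> facet j (list_exp k xs)"
  using assms
proof (induction xs)
  case (Cons x xs)
  have "elt x t < elt x (t + 1)" using Cons.prems t by (intro elt_less[of x k n]) auto
  hence "0 \<le> facet j (set_exp k x)" by (auto simp: facet_set_exp)
  thus ?case using Cons by (simp add: facet_add)
qed simp

text \<open>The functionals in this range of \<open>j\<close> see only the divisor \<open>P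
  t\<close>, not the other \<open>P s\<close>.\<close>

lemma facet_delta:
  assumes "s \<le> k" "elt \<beta> (t + 1) \<le> j + 1" "j < elt \<gamma> t"
  shows "facet j (set_exp k (delta k \<beta> \<gamma> s)) = of_bool (s = t)"
proof -
  have "elt \<beta> t < elt \<beta> (t + 1)" "elt \<gamma> t < elt \<gamma> (t + 1)"
    using elt_less[OF \<beta>, of t "t + 1"] elt_less[OF \<gamma>, of t "t + 1"] t by simp_all
  thus ?thesis
    using assms t by (auto simp: facet_set_exp elt_delta)
qed

text \<open>Extend the chain \<open>xs\<close> by \<open>a\<close> in front and
  \<open>\<gamma>\<close> at the end, and move the rows up to \<open>t\<close> one step to the left
  against the others. With \<open>a = \<beta>\<close> the entries that fall out form
  \<open>\<delta>\<^sub>t\<close>, so this divides \<open>P 0 * P k\<close> times the monomial of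
  \<open>xs\<close> by \<open>P t\<close> on the level of leading exponents.\<close>

fun shift :: "nat set \<Rightarrow> nat set list \<Rightarrow> nat set list" where
  "shift a [] = [delta k \<gamma> a t]"
| "shift a (x # xs) = delta k x a t # shift x xs"

fun shiftable :: "nat set \<Rightarrow> nat set list \<Rightarrow> bool" where
  "shiftable a [] \<longleftrightarrow> elt \<gamma> t < elt a (t + 1)"
| "shiftable a (x # xs) \<longleftrightarrow> elt x t < elt a (t + 1) \<and> shiftable x xs"

lemma shift_interval:
  assumes "shiftable a xs" "set xs \<subseteq> \<I>" "a \<in> \<I>"
  shows "set (shift a xs) \<subseteq> \<I>"
proof -
  have sp: "delta k x y t \<in> \<I>"
    if "elt x t < elt y (t + 1)" "x \<in> \<I>" "y \<in> \<I>" for x y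
    using splice[of x k n y t] that t by (auto simp: interval_iff)
  show ?thesis using assms
    by (induction xs arbitrary: a) (auto intro: sp \<gamma>_interval)
qed

lemma set_exp_split: "set_exp k \<alpha> = (\<Sum>i=1..t. single (i, elt \<alpha> i) 1) + (\<Sum>i=t + 1..k. single (i, elt \<alpha> i) 1)"
proof -
  have eq: "{1..k} = {1..t} \<union> {t + 1..k}" using t by auto
  show ?thesis unfolding diag_exp_def eq by (rule sum.union_disjoint) auto
qed

lemma set_exp_splice:
  assumes "elt x t < elt y (t + 1)" "x \<in> V" "y \<in> V"
  shows "set_exp k (delta k x y t) = (\<Sum>i=1..t. single (i, elt x i) 1) + (\<Sum>i=t + 1..k. single (i, elt y i) 1)"
  unfolding set_exp_split
  by (rule arg_cong2[where f = "(+)"]; rule sum.cong)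
     (use splice(2)[of x k n y t] assms t in auto)

lemma list_exp_shift:
  assumes "shiftable a xs" "set xs \<subseteq> V" "a \<in> V"
  shows "list_exp k (shift a xs) = (\<Sum>i=t + 1..k. single (i, elt a i) 1) + list_exp k xs
    + (\<Sum>i=1..t. single (i, elt \<gamma> i) 1)"
  using assms
proof (induction xs arbitrary: a)
  case Nil
  then show ?case using \<gamma> by (simp add: set_exp_splice add.commute)
next
  case (Cons x xs)
  have "set_exp k (delta k x a t) = (\<Sum>i=1..t. single (i, elt x i) 1) + (\<Sum>i=t + 1..k. single (i, elt a i) 1)"
    by (rule set_exp_splice) (use Cons.prems in auto)
  moreover have "list_exp k (shift x xs) = (\<Sum>i=t + 1..k. single (i, elt x i) 1) + list_exp k xs
    + (\<Sum>i=1..t. single (i, elt \<gamma> i) 1)"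
    by (rule Cons.IH) (use Cons.prems in auto)
  ultimately show ?case by (simp only: shift.simps list_exp_simps set_exp_split[of x] ac_simps)
qed

lemma list_exp_shift_\<beta>:
  assumes "shiftable \<beta> xs" "set xs \<subseteq> V"
  shows "set_exp k (delta k \<beta> \<gamma> t) + list_exp k (shift \<beta> xs) = list_exp k xs + set_exp k \<beta> + set_exp k \<gamma>"
proof -
  have "set_exp k (delta k \<beta> \<gamma> t) = (\<Sum>i=1..t. single (i, elt \<beta> i) 1) + (\<Sum>i=t + 1..k. single (i, elt \<gamma> i) 1)"
    by (rule set_exp_splice) (use delta_aux t \<beta> \<gamma> in auto)
  thus ?thesis
    unfolding list_exp_shift[OF assms \<beta>] set_exp_split[of \<beta>] set_exp_split[of \<gamma>] by (simp only: ac_simps)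
qed

text \<open>If the shift failed between two neighbours, with \<open>j + 1\<close> the entry of row
  \<open>t + 1\<close> of the left one, then only the sets to the left could have row
  \<open>t\<close> entry at most \<open>j\<close>, while all of them have row \<open>t + 1\<close>
  entry at most \<open>j + 1\<close>, so the functional at \<open>j\<close> would not be
  positive.\<close>

lemma shiftableI:
  assumes sorted: "sorted_wrt (ksub_le k) xs" and sub: "set xs \<subseteq> \<I>"
    and facet: "\<And>j. elt \<beta> (t + 1) \<le> j + 1 \<Longrightarrow> j < elt \<gamma> t \<Longrightarrow> 1 \<le> facet j (list_exp k xs)"
  shows "shiftable \<beta> xs"
proof -
  \<comment> \<open>The neighbours at the cut are taken in the chain extended by
    \<open>\<beta>\<close> and \<open>\<gamma>\<close>.\<close>
  have step: "elt (hd (vs @ [\<gamma>])) t < elt (last (\<beta> # us)) (t + 1)" if xs: "xs = us @ vs" for us vs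
  proof (rule ccontr)
    let ?p = "last (\<beta> # us)" and ?q = "hd (vs @ [\<gamma>])"
    assume "\<not> ?thesis"
    hence ge: "elt ?p (t + 1) \<le> elt ?q t" by simp
    have p: "?p \<in> \<I>" using \<beta>_interval sub xs by (cases us rule: rev_cases) auto
    have q: "?q \<in> \<I>" using \<gamma>_interval sub xs by (cases vs) auto
    define j where "j = elt ?p (t + 1) - 1"
    have pos: "elt \<beta> (t + 1) \<le> elt ?p (t + 1)" "elt ?q t \<le> elt \<gamma> t"
      using p q t by (simp_all add: interval_iff)
    have pos1: "1 \<le> elt ?p (t + 1)"
      using elt_mem(2)[of ?p k n "t + 1"] p t interval_ksubset[OF p] by simp
    have j: "elt ?p (t + 1) = j + 1" using pos1 by (simp add: j_def)
    have "\<not> elt \<alpha> t \<le> j" if "\<alpha> \<in> set vs" for \<alpha>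
    proof -
      have "ksub_le k ?q \<alpha>"
        using that sorted xs ksub_le_refl by (cases vs) (auto simp: sorted_wrt_append)
      hence "elt ?q t \<le> elt \<alpha> t" using t by (simp add: ksub_le_def)
      thus ?thesis using ge j by simp
    qed
    hence "filter (\<lambda>\<alpha>. elt \<alpha> t \<le> j) vs = []" by (simp add: filter_empty_conv)
    hence low: "length (filter (\<lambda>\<alpha>. elt \<alpha> t \<le> j) xs) \<le> length us" by (simp add: xs)
    have "filter (\<lambda>\<alpha>. elt \<alpha> (t + 1) \<le> j + 1) us = us"
    proof (rule filter_True, rule ballI)
      fix \<alpha> assume \<alpha>: "\<alpha> \<in> set us"
      have "ksub_le k \<alpha> ?p"
        using \<alpha> sorted xs ksub_le_refl by (cases us rule: rev_cases) (auto simp: sorted_wrt_append)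
      from this[unfolded ksub_le_def, rule_format, of "t + 1"]
      show "elt \<alpha> (t + 1) \<le> j + 1" using t j by simp
    qed
    hence "length us \<le> length (filter (\<lambda>\<alpha>. elt \<alpha> (t + 1) \<le> j + 1) xs)" by (simp add: xs)
    with low have "facet j (list_exp k xs) \<le> 0" unfolding facet_list_exp by linarith
    moreover have "1 \<le> facet j (list_exp k xs)"
      by (rule facet) (use pos ge j in auto)
    ultimately show False by simp
  qed
  have "shiftable (last (\<beta> # us)) vs" if "xs = us @ vs" for us vs
    using that
  proof (induction vs arbitrary: us)
    case Nil
    then show ?case using step[of us "[]"] by simp
  next
    case (Cons v vs)
    have "shiftable (last (\<beta> # us @ [v])) vs" by (rule Cons.IH) (use Cons.prems in simp)
    thus ?case using step[of us "v # vs"] Cons.prems by simp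
  qed
  from this[of "[]" xs] show ?thesis by simp
qed

section \<open>Cancelling the other monomials modulo the divisor\<close>

definition den :: "nat list \<Rightarrow> 'k::field band_poly" where
  "den ss = prod_list (map P ss)"

definition good_den :: "nat list \<Rightarrow> bool" where
  "good_den ss \<longleftrightarrow> set ss \<subseteq> {0..k} - {t}"

lemma den_coord_prod: "den ss = Phi0 (coord_prod (map (delta k \<beta> \<gamma>) ss))"
  by (induction ss) (simp_all add: den_def P_def Phi.hom_mult)

lemma good_den_interval: "good_den ss \<Longrightarrow> set (map (delta k \<beta> \<gamma>) ss) \<subseteq> \<I>"
  by (auto simp: good_den_def intro!: delta_interval)

lemma good_den_facet:
  assumes "good_den ss" "elt \<beta> (t + 1) \<le> j + 1" "j < elt \<gamma> t"
  shows "facet j (list_exp k (map (delta k \<beta> \<gamma>) ss)) = 0"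
  using assms(1)
proof (induction ss)
  case (Cons s ss)
  thus ?case using facet_delta[of s j] assms(2,3) by (auto simp: facet_add good_den_def)
qed simp

text \<open>The functional vanishes on the leading exponent of \<open>den ss\<close>, is 1 on that
  of \<open>P t\<close> and nonnegative on that of \<open>y\<close>.\<close>

lemma lead_facet:
  fixes x y :: "'k::field band_poly"
  assumes ss: "good_den ss" and y: "y \<in> Q" and eq: "den ss * x = P t * y"
    and xs: "lead_at x (list_exp k xs)"
    and j: "elt \<beta> (t + 1) \<le> j + 1" "j < elt \<gamma> t"
  shows "1 \<le> facet j (list_exp k xs)"
proof -
  let ?ds = "list_exp k (map (delta k \<beta> \<gamma>) ss)"
  have "lead_at (den ss :: 'k band_poly) ?ds"
    unfolding den_coord_prod by (rule lead_at_coord_prod[OF good_den_interval[OF ss]])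
  hence l: "lead_at (den ss * x) (?ds + list_exp k xs)" using xs by (rule lead_at_mult)
  hence "y \<noteq> 0" unfolding eq lead_at_def by auto
  then obtain ys where ys: "std ys" "lead_at y (list_exp k ys)" using Q_lead[OF y] by blast
  have "lead_at (P t * y) (set_exp k (delta k \<beta> \<gamma> t) + list_exp k ys)"
    using lead_at_P[of t] t ys(2) by (intro lead_at_mult) auto
  hence "?ds + list_exp k xs = set_exp k (delta k \<beta> \<gamma> t) + list_exp k ys"
    using l eq lead_at_unique by metis
  hence "facet j (?ds + list_exp k xs) = facet j (set_exp k (delta k \<beta> \<gamma> t) + list_exp k ys)" by simp
  hence "facet j (list_exp k xs) = 1 + facet j (list_exp k ys)"
    using good_den_facet[OF ss j] facet_delta[of t j] t j by (simp add: facet_add)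
  thus ?thesis using facet_nonneg[OF standardD(1)[OF ys(1)], of j] by simp
qed

text \<open>The leading monomial of \<open>P 0 * P k * x\<close> is that of a multiple of \<open>P
  t\<close> from \<open>Q\<close>. Subtracting the multiple keeps the hypotheses and the homogeneity
  but lowers the leading exponent. The factor \<open>P 0 * P k\<close> that each round introduces
  changes no interior exponent, and these decide the order within a graded piece, so the rounds come
  to an end.\<close>

lemma divide_homogeneous:
  fixes x y :: "'k::field band_poly"
  assumes "good_den ss" "x \<in> Q" "y \<in> Q" "den ss * x = P t * y" "homogeneous k n g x"
  shows "\<exists>N. \<exists>z\<in>Q. (P 0 * P k) ^ N * x = P t * z"
proof (cases "x = 0")
  case True
  thus ?thesis using Q_0 by (intro exI[of _ 0] bexI[of _ 0]) auto
next
  case False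
  then obtain e where "lead_at x e" using lead_at_exists by blast
  thus ?thesis using assms
  proof (induction "interior_exps e" arbitrary: e g x y rule: wf_induct_rule[OF wf_lex[OF wf_less_than]])
    case 1
    note IH = 1(1) and lead = 1(2) and ss = 1(3) and xQ = 1(4) and yQ = 1(5) and eq = 1(6) and hom = 1(7)
    have "x \<noteq> 0" using lead by (auto simp: lead_at_def)
    then obtain xs where xs: "std xs" "lead_at x (list_exp k xs)" using Q_lead[OF xQ] by blast
    have e: "e = list_exp k xs" by (rule lead_at_unique[OF lead xs(2)])
    have sh: "shiftable \<beta> xs"
      by (rule shiftableI[OF standardD(2,3)[OF xs(1)]]) (rule lead_facet[OF ss yQ eq xs(2)])
    let ?zs = "shift \<beta> xs"
    have zs: "set ?zs \<subseteq> \<I>"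
      by (rule shift_interval[OF sh standardD(3)[OF xs(1)] \<beta>_interval])
    define z where "z = (Phi0 (coord_prod ?zs) :: 'k band_poly)"
    have zV: "set ?zs \<subseteq> V" using zs interval_ksubset by blast
    have zQ: "z \<in> Q"
      unfolding z_def using mvars_coord_prod[of ?zs] zV by (intro Q_I) blast
    define c where "c = lookup x e"
    let ?m = "P 0 * P k :: 'k band_poly" and ?w = "P t * z"
    let ?c = "single 0 c :: 'k band_poly"
    define x' where "x' = ?m * x - ?c * ?w"
    define y' where "y' = ?m * y - ?c * (den ss * z)"
    let ?E = "e + set_exp k \<beta> + set_exp k \<gamma>"
    have bg: "?m = Phi0 (coord_prod [\<gamma>, \<beta>])" "?w = Phi0 (coord_prod (delta k \<beta> \<gamma> t # ?zs))"
      by (simp_all add: P_def z_def delta_0 delta_k Phi.hom_mult)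
    have dt: "set (delta k \<beta> \<gamma> t # ?zs) \<subseteq> \<I>"
      using zs delta_interval[of t] t by simp
    have E: "?E = list_exp k [\<gamma>, \<beta>] + e" "?E = list_exp k (delta k \<beta> \<gamma> t # ?zs)"
      using list_exp_shift_\<beta>[OF sh standardD(1)[OF xs(1)]] by (simp_all add: e ac_simps)
    have bgi: "set [\<gamma>, \<beta>] \<subseteq> \<I>" using \<beta>_interval \<gamma>_interval by simp
    have lm: "lookup ?m (list_exp k [\<gamma>, \<beta>]) = 1"
        "\<And>a. a \<in> keys ?m \<Longrightarrow> a \<le> list_exp k [\<gamma>, \<beta>]"
      unfolding bg using lead_coord_prod[OF bgi, where ?'k = 'k] by auto
    have lw: "lookup ?w ?E = 1" "\<And>a. a \<in> keys ?w \<Longrightarrow> a \<le> ?E"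
      unfolding bg E(2) using lead_coord_prod[OF dt, where ?'k = 'k] by auto
    have lmx: "lookup (?m * x) ?E = c" "\<And>a. a \<in> keys (?m * x) \<Longrightarrow> a \<le> ?E"
    proof -
      show "lookup (?m * x) ?E = c"
        unfolding E(1) c_def using lead_at_mult_coeff[of ?m _ x e] lm lead by (simp add: lead_at_def)
      have "lead_at ?m (list_exp k [\<gamma>, \<beta>])" using lm by (simp add: lead_at_def)
      from lead_at_mult[OF this lead] show "\<And>a. a \<in> keys (?m * x) \<Longrightarrow> a \<le> ?E"
        unfolding E(1) by (simp add: lead_at_def)
    qed
    have lc: "lookup (?c * p) a = c * lookup p a" for p :: "'k band_poly" and a
      by (simp add: lookup_mult_sum in_keys_iff)
    have x'Q: "x' \<in> Q"
      unfolding x'_def using P_Q t k_pos xQ zQ by (intro Q_diff Q_mult Q_const) auto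
    have denQ: "den ss \<in> (Q :: 'k band_poly set)"
    proof -
      have "set (map (delta k \<beta> \<gamma>) ss) \<subseteq> V" using good_den_interval[OF ss] interval_ksubset by blast
      thus ?thesis unfolding den_coord_prod using mvars_coord_prod[of "map (delta k \<beta> \<gamma>) ss"] by (intro Q_I) blast
    qed
    have y'Q: "y' \<in> Q"
      unfolding y'_def using P_Q t k_pos yQ zQ denQ by (intro Q_diff Q_mult Q_const) auto
    have eq': "den ss * x' = P t * y'"
    proof -
      have "den ss * x' = ?m * (den ss * x) - P t * (?c * (den ss * z))"
        by (simp add: x'_def algebra_simps)
      thus ?thesis unfolding eq by (simp add: y'_def algebra_simps)
    qed
    define h where "h = (\<lambda>a. grade k n (list_exp k [\<gamma>, \<beta>]) a + g a)"
    have hE: "h = grade k n ?E"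
    proof -
      have "grade k n e = g" using hom lead by (auto simp: homogeneous_def lead_at_def in_keys_iff)
      thus ?thesis unfolding h_def E(1) by (simp only: grade_add fun_eq_iff) simp
    qed
    have homx': "homogeneous k n h x'"
    proof -
      have "homogeneous k n h (?m * x)"
        unfolding h_def by (rule homogeneous_mult[OF _ hom])
          (use homogeneous_coord_prod[OF bgi, where ?'k = 'k] bg in simp)
      moreover have "homogeneous k n h (?c * ?w)"
        unfolding hE E(2) by (rule homogeneous_scale)
          (use homogeneous_coord_prod[OF dt, where ?'k = 'k] bg in simp)
      ultimately show ?thesis
        unfolding x'_def diff_conv_add_uminus by (intro homogeneous_add homogeneous_uminus)
    qed
    show ?case
    proof (cases "x' = 0")
      case True
      hence "(P 0 * P k) ^ 1 * x = P t * (?c * z)" by (simp add: x'_def ac_simps)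
      thus ?thesis using zQ by (intro exI[of _ 1] bexI[of _ "?c * z"]) auto
    next
      case False
      then obtain e' where e': "lead_at x' e'" using lead_at_exists by blast
      have "e' \<noteq> ?E"
        using e' lw(1) lmx(1) by (auto simp: lead_at_def x'_def lookup_minus lc)
      moreover have "e' \<le> ?E"
      proof -
        have "e' \<in> keys x'" using e' by (auto simp: lead_at_def in_keys_iff)
        hence "e' \<in> keys (?m * x) \<or> e' \<in> keys ?w"
          by (auto simp: x'_def in_keys_iff lookup_minus lc)
        thus ?thesis using lw(2) lmx(2) by blast
      qed
      ultimately have lt: "e' < ?E" by simp
      have "(interior_exps e', interior_exps ?E) \<in> lex less_than"
      proof (rule interior_lex[OF lt])
        have "e' \<in> keys x'" using e' by (auto simp: lead_at_def in_keys_iff)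
        thus "grade k n e' = grade k n ?E" "banded e'"
          using homx' hE Q_banded[OF x'Q] by (auto simp: homogeneous_def)
        have "?E \<in> keys ?w" using lw(1) by (simp add: in_keys_iff)
        thus "banded ?E" using homogeneous_coord_prod[OF dt, where ?'k = 'k] unfolding bg(2) by blast
      qed
      hence "(interior_exps e', interior_exps e) \<in> lex less_than" by (simp only: interior_exps_shift)
      from IH[OF this e' ss x'Q y'Q eq' homx']
      obtain N z' where N: "z' \<in> Q" "(P 0 * P k) ^ N * x' = P t * z'" by blast
      have "(P 0 * P k) ^ Suc N * x = ?m ^ N * (?m * x)" by (simp add: ac_simps)
      also have "?m * x = x' + P t * (?c * z)" by (simp add: x'_def algebra_simps)
      also have "?m ^ N * (x' + P t * (?c * z)) = P t * (z' + ?m ^ N * (?c * z))"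
        using N(2) by (simp add: distrib_left algebra_simps)
      finally have "(P 0 * P k) ^ Suc N * x = P t * (z' + ?m ^ N * (?c * z))" .
      moreover have "z' + ?m ^ N * (?c * z) \<in> Q"
        using N(1) zQ P_Q k_pos by (intro Q_add Q_mult Q_power Q_const) auto
      ultimately show ?thesis by blast
    qed
  qed
qed

text \<open>All \<open>P s\<close> are homogeneous, so the equation splits into its graded parts, to
  which the previous lemma applies.\<close>

theorem divide_by_other_monomials:
  fixes x y :: "'k::field band_poly"
  assumes ss: "good_den ss" and x: "x \<in> Q" and y: "y \<in> Q" and eq: "den ss * x = P t * y"
  shows "\<exists>N. \<exists>z\<in>Q. (P 0 * P k) ^ N * x = P t * z"
proof -
  let ?m = "P 0 * P k :: 'k band_poly"
  let ?G = "grade k n ` keys x"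
  let ?hd = "grade k n (list_exp k (map (delta k \<beta> \<gamma>) ss))"
  let ?ht = "grade k n (set_exp k (delta k \<beta> \<gamma> t))"
  have hd: "homogeneous k n ?hd (den ss :: 'k band_poly)"
    unfolding den_coord_prod using homogeneous_coord_prod[OF good_den_interval[OF ss], where ?'k = 'k] by blast
  have ht: "homogeneous k n ?ht (P t :: 'k band_poly)"
    unfolding P_def using homogeneous_minor delta_interval t by (metis less_imp_le)
  have "\<exists>N. \<exists>z\<in>Q. ?m ^ N * part k n g x = P t * z" for g
  proof -
    have "\<exists>y'\<in>Q. den ss * part k n g x = P t * y'"
    proof (cases "\<forall>a. ?ht a \<le> ?hd a + g a")
      case True
      define g' where "g' = (\<lambda>a. ?hd a + g a - ?ht a)"
      have g': "(\<lambda>a. ?hd a + g a) = (\<lambda>a. ?ht a + g' a)" using True by (simp add: g'_def fun_eq_iff)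
      have "den ss * part k n g x = part k n (\<lambda>a. ?hd a + g a) (den ss * x)"
        by (rule part_mult[OF hd, symmetric])
      also have "\<dots> = P t * part k n g' y" unfolding eq g' by (rule part_mult[OF ht])
      finally show ?thesis using Q_part[OF y] by blast
    next
      case False
      have "den ss * part k n g x = part k n (\<lambda>a. ?hd a + g a) (P t * y)"
        unfolding eq[symmetric] by (rule part_mult[OF hd, symmetric])
      also have "\<dots> = 0"
      proof (rule poly_mapping_eqI)
        fix e
        have "grade k n e \<noteq> (\<lambda>a. ?hd a + g a)" if "e \<in> keys (P t * y)"
        proof
          assume gr: "grade k n e = (\<lambda>a. ?hd a + g a)"
          from subsetD[OF Poly_Mapping.keys_mult that] obtain a b
            where "a \<in> keys (P t :: 'k band_poly)" "e = a + b" by auto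
          hence "?ht v \<le> grade k n e v" for v using ht by (auto simp: homogeneous_def grade_add)
          thus False using False gr by simp
        qed
        thus "lookup (part k n (\<lambda>a. ?hd a + g a) (P t * y)) e = lookup 0 e"
          by (auto simp: lookup_part in_keys_iff)
      qed
      finally show ?thesis using Q_0 by (intro bexI[of _ 0]) auto
    qed
    then obtain y' where "y' \<in> Q" "den ss * part k n g x = P t * y'" by blast
    thus ?thesis using divide_homogeneous[OF ss Q_part[OF x] _ _ homogeneous_part] by blast
  qed
  then obtain M z where Mz: "\<And>g. z g \<in> Q" "\<And>g. ?m ^ M g * part k n g x = P t * z g" by metis
  \<comment> \<open>A common exponent for the finitely many graded parts; 0 covers \<open>x =
    0\<close>.\<close>
  define N where "N = Max (insert 0 (M ` ?G))"
  have MN: "M g \<le> N" if "g \<in> ?G" for g unfolding N_def using that by (intro Max_ge) auto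
  have "?m ^ N * x = (\<Sum>g\<in>?G. ?m ^ N * part k n g x)"
    using sum_parts[of x k n] by (simp add: sum_distrib_left[symmetric])
  also have "\<dots> = (\<Sum>g\<in>?G. P t * (?m ^ (N - M g) * z g))"
  proof (rule sum.cong[OF refl])
    fix g assume "g \<in> ?G"
    hence "?m ^ N = ?m ^ (N - M g) * ?m ^ M g" using MN by (simp flip: power_add)
    hence "?m ^ N * part k n g x = ?m ^ (N - M g) * (?m ^ M g * part k n g x)" by (simp add: mult.assoc)
    also have "\<dots> = P t * (?m ^ (N - M g) * z g)" unfolding Mz(2) by (simp add: ac_simps)
    finally show "?m ^ N * part k n g x = P t * (?m ^ (N - M g) * z g)" .
  qed
  also have "\<dots> = P t * (\<Sum>g\<in>?G. ?m ^ (N - M g) * z g)" by (simp add: sum_distrib_left)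
  finally have "?m ^ N * x = P t * (\<Sum>g\<in>?G. ?m ^ (N - M g) * z g)" .
  moreover have "(\<Sum>g\<in>?G. ?m ^ (N - M g) * z g) \<in> Q"
    using Mz(1) P_Q k_pos by (intro Q_sum Q_mult Q_power) auto
  ultimately show ?thesis by blast
qed

end

section \<open>Determinants with triangular outer columns\<close>

text \<open>Where the columns below \<open>s\<close> are upper triangular and those from \<open>s +
  m\<close> on are lower triangular, the triangular columns are fixed one after the other from the
  outside.\<close>

lemma permutes_middle:
  fixes p :: "nat \<Rightarrow> nat"
  assumes p: "p permutes {0..<k}" and sm: "s + m \<le> k"
    and low: "\<And>i. i < k \<Longrightarrow> p i < s \<Longrightarrow> i \<le> p i" and high: "\<And>i. i < k \<Longrightarrow> s + m \<le> p i \<Longrightarrow> p i \<le> i"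
  shows "p permutes {s..<s + m}"
proof (rule permutes_superset[OF p])
  have inj: "inj p" by (rule permutes_inj[OF p])
  have pre: "\<exists>j<k. p j = i" if "i < k" for i
  proof -
    have "i \<in> p ` {0..<k}" using permutes_image[OF p] that by simp
    thus ?thesis by auto
  qed
  have 1: "p i = i" if "i < s" for i
    using that
  proof (induction i rule: less_induct)
    case (less i)
    obtain j where j: "j < k" "p j = i" using pre[of i] less.prems sm by auto
    have "j \<le> i" using low[of j] j less.prems by simp
    show ?case
    proof (cases "j = i")
      case False
      hence "p j = j" using less.IH[of j] \<open>j \<le> i\<close> less.prems by simp
      thus ?thesis using j by simp
    qed (use j in simp)
  qed
  have 2: "p i = i" if "s + m \<le> i" "i < k" for i
    using that
  proof (induction "k - i" arbitrary: i rule: less_induct)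
    case less
    obtain j where j: "j < k" "p j = i" using pre[of i] less.prems by auto
    have "i \<le> j" using high[of j] j less.prems by simp
    show ?case
    proof (cases "j = i")
      case False
      hence "p j = j" using \<open>i \<le> j\<close> less.prems j(1) by (intro less.hyps) auto
      thus ?thesis using j by simp
    qed (use j in simp)
  qed
  fix x assume "x \<in> {0..<k} - {s..<s + m}"
  thus "p x = x" using 1[of x] 2[of x] by (cases "x < s") auto
qed

lemma cminor_middle:
  fixes X :: "nat \<Rightarrow> nat \<Rightarrow> 'r::comm_ring_1"
  assumes s: "1 \<le> s" "s + m \<le> k + 1"
    and low: "\<And>i l. 1 \<le> l \<Longrightarrow> l < s \<Longrightarrow> l < i \<Longrightarrow> i \<le> k \<Longrightarrow> X i (c l) = 0"
    and high: "\<And>i l. s + m \<le> l \<Longrightarrow> l \<le> k \<Longrightarrow> 1 \<le> i \<Longrightarrow> i < l \<Longrightarrow> X i (c l) = 0"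
  shows "cminor k X c = (\<Sum>p | p permutes {s - 1..<s - 1 + m}. signof p * (\<Prod>i = 0..<k. X (i + 1) (c (p i + 1))))"
proof -
  let ?A = "mat k k (\<lambda>(i, j). X (i + 1) (c (j + 1)))"
  have "cminor k X c = (\<Sum>p | p permutes {0..<k}. signof p * (\<Prod>i = 0..<k. ?A $$ (i, p i)))"
    unfolding cminor_def by (rule det_def') simp
  also have "\<dots> = (\<Sum>p | p permutes {0..<k}. signof p * (\<Prod>i = 0..<k. X (i + 1) (c (p i + 1))))"
  proof (intro sum.cong refl arg_cong2[where f = "(*)"] prod.cong)
    fix p i assume "p \<in> {p. p permutes {0..<k}}" "i \<in> {0..<k}"
    moreover from this have "p i < k" using permutes_in_image[of p "{0..<k}" i] by simp
    ultimately show "?A $$ (i, p i) = X (i + 1) (c (p i + 1))" by simp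
  qed
  also have "\<dots> = (\<Sum>p | p permutes {s - 1..<s - 1 + m}. signof p * (\<Prod>i = 0..<k. X (i + 1) (c (p i + 1))))"
  proof (rule sum.mono_neutral_right)
    show "finite {p. p permutes {0..<k}}" by (simp add: finite_permutations)
    show "{p. p permutes {s - 1..<s - 1 + m}} \<subseteq> {p. p permutes {0..<k}}"
    proof (rule Collect_mono, rule impI)
      fix p :: "nat \<Rightarrow> nat" assume "p permutes {s - 1..<s - 1 + m}"
      thus "p permutes {0..<k}" by (rule permutes_subset) (use s in auto)
    qed
    show "\<forall>p\<in>{p. p permutes {0..<k}} - {p. p permutes {s - 1..<s - 1 + m}}.
      signof p * (\<Prod>i = 0..<k. X (i + 1) (c (p i + 1))) = 0"
    proof
      fix p assume p: "p \<in> {p. p permutes {0..<k}} - {p. p permutes {s - 1..<s - 1 + m}}"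
      have "\<exists>i<k. X (i + 1) (c (p i + 1)) = 0"
      proof (rule ccontr)
        assume *: "\<not> ?thesis"
        have "p permutes {s - 1..<s - 1 + m}"
        proof (rule permutes_middle)
          show "p permutes {0..<k}" "s - 1 + m \<le> k" using p s by auto
          fix i assume i: "i < k"
          show "p i < s - 1 \<Longrightarrow> i \<le> p i"
            using low[of "p i + 1" "i + 1"] * i by fastforce
          have "p i < k" using p i permutes_in_image[of p "{0..<k}" i] by simp
          thus "s - 1 + m \<le> p i \<Longrightarrow> p i \<le> i"
            using high[of "p i + 1" "i + 1"] * i s by fastforce
        qed
        thus False using p by simp
      qed
      thus "signof p * (\<Prod>i = 0..<k. X (i + 1) (c (p i + 1))) = 0"
        using prod_zero[of "{0..<k}" "\<lambda>i. X (i + 1) (c (p i + 1))"] by fastforce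
    qed
  qed
  finally show ?thesis .
qed

lemma cminor_triangular:
  fixes X :: "nat \<Rightarrow> nat \<Rightarrow> 'r::comm_ring_1"
  assumes s: "1 \<le> s" "s \<le> k"
    and low: "\<And>i l. 1 \<le> l \<Longrightarrow> l < s \<Longrightarrow> l < i \<Longrightarrow> i \<le> k \<Longrightarrow> X i (c l) = 0"
    and high: "\<And>i l. s < l \<Longrightarrow> l \<le> k \<Longrightarrow> 1 \<le> i \<Longrightarrow> i < l \<Longrightarrow> X i (c l) = 0"
  shows "cminor k X c = (\<Prod>i = 1..k. X i (c i))"
proof -
  have "cminor k X c = (\<Sum>p | p permutes {s - 1..<s - 1 + 1}. signof p * (\<Prod>i = 0..<k. X (i + 1) (c (p i + 1))))"
    by (rule cminor_middle) (use assms in auto)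
  also have "{p. p permutes {s - 1..<s - 1 + 1}} = {id}" by auto
  finally have "cminor k X c = (\<Prod>i = 0..<k. X (i + 1) (c (i + 1)))" by simp
  also have "\<dots> = (\<Prod>i = 1..k. X i (c i))"
    by (rule prod.reindex_bij_witness[where i = "\<lambda>i. i - 1" and j = "\<lambda>i. i + 1"]) auto
  finally show ?thesis .
qed

lemma cminor_two_columns:
  fixes X :: "nat \<Rightarrow> nat \<Rightarrow> 'r::comm_ring_1"
  assumes s: "1 \<le> s" "s + 1 \<le> k"
    and low: "\<And>i l. 1 \<le> l \<Longrightarrow> l < s \<Longrightarrow> l < i \<Longrightarrow> i \<le> k \<Longrightarrow> X i (c l) = 0"
    and high: "\<And>i l. s + 1 < l \<Longrightarrow> l \<le> k \<Longrightarrow> 1 \<le> i \<Longrightarrow> i < l \<Longrightarrow> X i (c l) = 0"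
  shows "cminor k X c = (X s (c s) * X (s + 1) (c (s + 1)) - X s (c (s + 1)) * X (s + 1) (c s))
    * (\<Prod>i\<in>{1..k} - {s, s + 1}. X i (c i))"
proof -
  let ?f = "\<lambda>p. \<Prod>i = 0..<k. X (i + 1) (c (p i + 1))"
  let ?C = "\<Prod>i\<in>{1..k} - {s, s + 1}. X i (c i)"
  let ?\<tau> = "Transposition.transpose (s - 1) s"
  have "cminor k X c = (\<Sum>p | p permutes {s - 1..<s - 1 + 2}. signof p * ?f p)"
    by (rule cminor_middle) (use assms in auto)
  also have "{s - 1..<s - 1 + 2} = {s - 1, s}" using s by auto
  also have "{p. p permutes {s - 1, s}} = {id, ?\<tau>}" by (auto simp: permutes_doubleton_iff)
  also have "(\<Sum>p\<in>{id, ?\<tau>}. signof p * ?f p) = ?f id - ?f ?\<tau>"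
  proof -
    have "id s \<noteq> ?\<tau> s" using s by simp
    hence "id \<noteq> ?\<tau>" by metis
    thus ?thesis using s by (simp add: sign_swap_id)
  qed
  also have "?f id = X s (c s) * X (s + 1) (c (s + 1)) * ?C"
  proof -
    have "?f id = (\<Prod>i = 1..k. X i (c i))"
      by (rule prod.reindex_bij_witness[where i = "\<lambda>i. i - 1" and j = "\<lambda>i. i + 1"]) auto
    also have "\<dots> = X s (c s) * (\<Prod>i\<in>{1..k} - {s}. X i (c i))"
      by (rule prod.remove) (use s in auto)
    also have "(\<Prod>i\<in>{1..k} - {s}. X i (c i)) = X (s + 1) (c (s + 1)) * (\<Prod>i\<in>{1..k} - {s} - {s + 1}. X i (c i))"
      by (rule prod.remove) (use s in auto)
    also have "{1..k} - {s} - {s + 1} = {1..k} - {s, s + 1}" by auto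
    finally show ?thesis by (simp add: mult.assoc)
  qed
  also have "?f ?\<tau> = X s (c (s + 1)) * X (s + 1) (c s) * ?C"
  proof -
    let ?h = "\<lambda>i. X i (c (?\<tau> (i - 1) + 1))"
    have "?f ?\<tau> = (\<Prod>i = 1..k. ?h i)"
      by (rule prod.reindex_bij_witness[where i = "\<lambda>i. i - 1" and j = "\<lambda>i. i + 1"]) auto
    also have "\<dots> = ?h s * (\<Prod>i\<in>{1..k} - {s}. ?h i)"
      by (rule prod.remove) (use s in auto)
    also have "(\<Prod>i\<in>{1..k} - {s}. ?h i) = ?h (s + 1) * (\<Prod>i\<in>{1..k} - {s} - {s + 1}. ?h i)"
      by (rule prod.remove) (use s in auto)
    also have "(\<Prod>i\<in>{1..k} - {s} - {s + 1}. ?h i) = ?C"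
      by (rule prod.cong) (auto simp: transpose_def)
    finally show ?thesis using s by (simp add: mult.assoc transpose_def)
  qed
  finally show ?thesis by (simp add: left_diff_distrib)
qed

section \<open>Inverting the other monomials\<close>

definition to_frac :: "'a::idom \<Rightarrow> 'a fract" where
  "to_frac x = Fract x 1"

lemma to_frac_hom: "comm_ring_hom (to_frac :: 'a::idom \<Rightarrow> 'a fract)"
  by unfold_locales (simp_all add: to_frac_def Zero_fract_def One_fract_def)

lemma to_frac_eq_iff [simp]: "to_frac x = to_frac y \<longleftrightarrow> x = y"
  by (simp add: to_frac_def eq_fract)

context richardson_step
begin

abbreviation fr :: "'k::field band_poly \<Rightarrow> 'k band_poly fract" where
  "fr \<equiv> to_frac"

sublocale fr: comm_ring_hom fr
  by (rule to_frac_hom)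

lemma fr_0_iff [simp]: "fr x = 0 \<longleftrightarrow> x = 0"
  using to_frac_eq_iff[of x 0] by simp

lemma Z0_low: "1 \<le> l \<Longrightarrow> l < i \<Longrightarrow> i \<le> k \<Longrightarrow> Z0 i (elt \<beta> l) = 0"
  using elt_less[OF \<beta>, of l i] by (simp add: Z_def band_def)

lemma Z0_high: "l \<le> k \<Longrightarrow> 1 \<le> i \<Longrightarrow> i < l \<Longrightarrow> Z0 i (elt \<gamma> l) = 0"
  using elt_less[OF \<gamma>, of i l] by (simp add: Z_def band_def)

lemma mvar_nonzero: "mvar x \<noteq> (0 :: ('x, 'k::field) mpoly)"
  unfolding mvar_def by (metis lookup_single_eq lookup_zero zero_neq_one)

lemma Z0_\<beta>: "1 \<le> i \<Longrightarrow> i \<le> k \<Longrightarrow> Z0 i (elt \<beta> i) \<noteq> (0 :: 'k::field band_poly)"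
  and Z0_\<gamma>: "1 \<le> i \<Longrightarrow> i \<le> k \<Longrightarrow> Z0 i (elt \<gamma> i) \<noteq> (0 :: 'k::field band_poly)"
  using \<beta>_le_\<gamma>[of i] by (simp_all add: Z_def band_def mvar_nonzero)

lemma P_prod:
  assumes "s \<le> k"
  shows "P s = (\<Prod>i = 1..k. Z0 i (if i \<le> s then elt \<beta> i else elt \<gamma> i) :: 'k::field band_poly)"
proof -
  have "P s = cminor k Z0 (\<lambda>i. if i \<le> s then elt \<beta> i else elt \<gamma> i)"
    unfolding P_def minor_def by (rule cminor_cong) (use assms in \<open>simp add: elt_delta\<close>)
  also have "\<dots> = (\<Prod>i = 1..k. Z0 i (if i \<le> s then elt \<beta> i else elt \<gamma> i) :: 'k band_poly)"
    by (rule cminor_triangular[where s = "max 1 s"]) (use assms k_pos in \<open>auto simp: Z0_low Z0_high\<close>)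
  finally show ?thesis .
qed

lemma P_nonzero: "s \<le> k \<Longrightarrow> P s \<noteq> (0 :: 'k::field band_poly)"
  by (auto simp: P_prod Z0_\<beta> Z0_\<gamma>)

lemma cminor_Q:
  assumes "\<And>i. 1 \<le> i \<Longrightarrow> i \<le> k \<Longrightarrow> 1 \<le> c i \<and> c i \<le> n"
  shows "cminor k Z0 c \<in> (Q :: 'k::field band_poly set)"
proof (cases "inj_on c {1..k}")
  case True
  have sub: "c ` {1..k} \<subseteq> {1..n}" using assms by auto
  obtain s :: int where "cminor k Z0 c = of_int s * (minor k Z0 (c ` {1..k}) :: 'k band_poly)"
    using cminor_eq_minor(2)[OF True sub, of "Z0 :: nat \<Rightarrow> nat \<Rightarrow> 'k band_poly"] by blast
  moreover have "minor k Z0 (c ` {1..k}) \<in> (Q :: 'k band_poly set)"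
    by (rule Q_minor[OF cminor_eq_minor(1)[OF True sub]])
  moreover have "of_int s = (single 0 (of_int s) :: 'k band_poly)" by simp
  ultimately show ?thesis using Q_mult[OF Q_const] by metis
next
  case False
  thus ?thesis using cminor_not_inj[of c k Z0] Q_0 by metis
qed

lemma den_nonzero: "good_den ss \<Longrightarrow> den ss \<noteq> (0 :: 'k::field band_poly)"
  unfolding den_def good_den_def by (induction ss) (auto simp: P_nonzero)

lemma den_Q: "good_den ss \<Longrightarrow> den ss \<in> (Q :: 'k::field band_poly set)"
  unfolding den_def good_den_def by (induction ss) (auto intro!: P_Q)

lemma den_append: "den (ss @ ss') = den ss * (den ss' :: 'k::field band_poly)"
  by (simp add: den_def)

text \<open>The ring \<open>Q\<close> with all \<open>P s\<close> for \<open>s \<noteq> t\<close>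
  inverted, as a subring of the field of fractions.\<close>

definition Qloc :: "'k::field band_poly fract set" where
  "Qloc = {fr x / fr (den ss) | x ss. x \<in> Q \<and> good_den ss}"

lemma Qloc_frac: "x \<in> Q \<Longrightarrow> good_den ss \<Longrightarrow> fr x / fr (den ss) \<in> Qloc"
  by (auto simp: Qloc_def)

lemma Qloc_fr: "x \<in> Q \<Longrightarrow> fr x \<in> Qloc"
  using Qloc_frac[of x "[]"] by (simp add: den_def good_den_def)

lemma Qloc_over: "x \<in> Q \<Longrightarrow> s \<le> k \<Longrightarrow> s \<noteq> t \<Longrightarrow> fr x / fr (P s) \<in> Qloc"
  using Qloc_frac[of x "[s]"] by (simp add: den_def good_den_def)

lemma Qloc_add: "x \<in> (Qloc :: 'a::field band_poly fract set) \<Longrightarrow> y \<in> Qloc \<Longrightarrow> x + y \<in> Qloc"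
proof -
  assume "x \<in> Qloc" "y \<in> Qloc"
  then obtain a ss b ss' where ab: "a \<in> Q" "b \<in> Q" "good_den ss" "good_den ss'"
    "x = fr a / fr (den ss)" "y = fr b / fr (den ss')" by (auto simp: Qloc_def)
  have d: "fr (den ss :: 'a band_poly) \<noteq> 0" "fr (den ss' :: 'a band_poly) \<noteq> 0"
    using den_nonzero ab(3,4) by simp_all
  have "x + y = fr (a * den ss' + b * den ss) / fr (den (ss @ ss'))"
    unfolding ab(5,6) den_append fr.hom_add fr.hom_mult by (rule add_frac_eq[OF d])
  also have "\<dots> \<in> Qloc"
    using ab by (intro Qloc_frac Q_add Q_mult den_Q) (auto simp: good_den_def)
  finally show ?thesis .
qed

lemma Qloc_mult: "x \<in> Qloc \<Longrightarrow> y \<in> Qloc \<Longrightarrow> x * y \<in> Qloc"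
proof -
  assume "x \<in> Qloc" "y \<in> Qloc"
  then obtain a ss b ss' where ab: "a \<in> Q" "b \<in> Q" "good_den ss" "good_den ss'"
    "x = fr a / fr (den ss)" "y = fr b / fr (den ss')" by (auto simp: Qloc_def)
  have "x * y = fr (a * b) / fr (den (ss @ ss'))"
    unfolding ab(5,6) den_append by (simp only: fr.hom_mult) simp
  also have "\<dots> \<in> Qloc"
    using ab by (intro Qloc_frac Q_mult) (auto simp: good_den_def)
  finally show ?thesis .
qed

lemma Qloc_const: "fr (single 0 c) \<in> Qloc"
  by (rule Qloc_fr[OF Q_const])

lemma Qloc_0: "0 \<in> Qloc" and Qloc_1: "1 \<in> Qloc" and Qloc_m1: "-1 \<in> Qloc"
  using Qloc_const[of 0] Qloc_const[of 1] Qloc_fr[OF Q_uminus[OF Q_1]]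
  by (simp_all add: fr.hom_uminus)


text \<open>Congruence modulo the ideal generated by \<open>P t\<close> in
  \<open>Qloc\<close>.\<close>

definition cong :: "'k::field band_poly fract \<Rightarrow> 'k band_poly fract \<Rightarrow> bool" where
  "cong x y \<longleftrightarrow> x \<in> Qloc \<and> y \<in> Qloc \<and> (\<exists>z\<in>Qloc. x - y = fr (P t) * z)"

lemma cong_refl: "x \<in> Qloc \<Longrightarrow> cong x x"
  unfolding cong_def using Qloc_0 by force

lemma cong_add: "cong x y \<Longrightarrow> cong x' y' \<Longrightarrow> cong (x + x') (y + y')"
proof -
  assume "cong x y" "cong x' y'"
  then obtain z z' where z: "x \<in> Qloc" "y \<in> Qloc" "x' \<in> Qloc" "y' \<in> Qloc" "z \<in> Qloc" "z' \<in> Qloc"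
    "x - y = fr (P t) * z" "x' - y' = fr (P t) * z'" by (auto simp: cong_def)
  have "x + x' - (y + y') = (x - y) + (x' - y')" by simp
  also have "\<dots> = fr (P t) * (z + z')" unfolding z by (simp add: distrib_left)
  finally show ?thesis unfolding cong_def using z Qloc_add by blast
qed

lemma cong_mult: "cong x y \<Longrightarrow> cong x' y' \<Longrightarrow> cong (x * x') (y * y')"
proof -
  assume "cong x y" "cong x' y'"
  then obtain z z' where z: "x \<in> Qloc" "y \<in> Qloc" "x' \<in> Qloc" "y' \<in> Qloc" "z \<in> Qloc" "z' \<in> Qloc"
    "x - y = fr (P t) * z" "x' - y' = fr (P t) * z'" by (auto simp: cong_def)
  have "x * x' - y * y' = x * (x' - y') + (x - y) * y'" by (simp add: algebra_simps)
  also have "\<dots> = fr (P t) * (x * z' + z * y')" unfolding z by (simp add: algebra_simps)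
  finally show ?thesis unfolding cong_def using z Qloc_add Qloc_mult by blast
qed

lemma cong_sum: "(\<And>i. i \<in> A \<Longrightarrow> cong (f i) (g i)) \<Longrightarrow> cong (sum f A) (sum g A)"
  by (induction A rule: infinite_finite_induct) (auto intro: cong_add cong_refl Qloc_0)

lemma cong_prod: "(\<And>i. i \<in> A \<Longrightarrow> cong (f i) (g i)) \<Longrightarrow> cong (prod f A) (prod g A)"
  by (induction A rule: infinite_finite_induct) (auto intro: cong_mult cong_refl Qloc_1)

lemma cong_power: "cong x y \<Longrightarrow> cong (x ^ m) (y ^ m)"
  by (induction m) (auto intro: cong_mult cong_refl Qloc_1)

lemma cong_minor:
  assumes \<alpha>: "\<alpha> \<in> V"
    and XY: "\<And>i j. 1 \<le> i \<Longrightarrow> i \<le> k \<Longrightarrow> 1 \<le> j \<Longrightarrow> j \<le> n \<Longrightarrow> cong (X i j) (Y i j)"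
  shows "cong (minor k X \<alpha>) (minor k Y \<alpha>)"
proof -
  have "cong (signof p * (\<Prod>i = 0..<k. mat k k (\<lambda>(i, j). X (i + 1) (elt \<alpha> (j + 1))) $$ (i, p i)))
      (signof p * (\<Prod>i = 0..<k. mat k k (\<lambda>(i, j). Y (i + 1) (elt \<alpha> (j + 1))) $$ (i, p i)))"
    if p: "p permutes {0..<k}" for p
  proof (intro cong_mult cong_prod)
    show "cong (signof p) (signof p)"
      by (rule cong_refl) (simp add: sign_def Qloc_1 Qloc_m1)
    fix i assume i: "i \<in> {0..<k}"
    hence pi: "p i < k" using permutes_in_image[OF p, of i] by simp
    have "cong (X (i + 1) (elt \<alpha> (p i + 1))) (Y (i + 1) (elt \<alpha> (p i + 1)))"
      using i pi elt_mem[OF \<alpha>, of "p i + 1"] by (intro XY) auto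
    thus "cong (mat k k (\<lambda>(i, j). X (i + 1) (elt \<alpha> (j + 1))) $$ (i, p i))
        (mat k k (\<lambda>(i, j). Y (i + 1) (elt \<alpha> (j + 1))) $$ (i, p i))"
      using i pi by simp
  qed
  thus ?thesis unfolding minor_def cminor_def by (subst (1 2) det_def'[of _ k]) (auto intro!: cong_sum)
qed

lemma cong_peval:
  fixes F :: "(nat set, 'k::field) mpoly"
  assumes "mvars F \<subseteq> V" and "\<And>\<alpha>. \<alpha> \<in> V \<Longrightarrow> cong (f \<alpha>) (g \<alpha>)"
  shows "cong (peval (\<lambda>c. fr (single 0 c)) f F) (peval (\<lambda>c. fr (single 0 c)) g F)"
  unfolding peval_def pmon_def
proof (intro cong_sum cong_mult cong_prod cong_power cong_refl Qloc_const assms(2))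
  fix m x assume "m \<in> keys F" "x \<in> keys m"
  thus "x \<in> V" using assms(1) by (auto simp: mvars_def)
qed

end

section \<open>A matrix adapted to the divisor\<close>

lemma minor_row_transform:
  fixes X Y :: "nat \<Rightarrow> nat \<Rightarrow> 'r::comm_ring_1"
  assumes "\<And>i j. 1 \<le> i \<Longrightarrow> i \<le> k \<Longrightarrow> j \<in> \<alpha> \<Longrightarrow> Y i j = (\<Sum>l = 1..k. G i l * X l j)"
    and upper: "\<And>i l. l < i \<Longrightarrow> G i l = 0" and \<alpha>: "\<alpha> \<in> ksubsets k n"
  shows "minor k Y \<alpha> = (\<Prod>i = 1..k. G i i) * minor k X \<alpha>"
proof -
  let ?G = "mat k k (\<lambda>(i, l). G (i + 1) (l + 1))"
  let ?X = "mat k k (\<lambda>(i, j). X (i + 1) (elt \<alpha> (j + 1)))"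
  have "mat k k (\<lambda>(i, j). Y (i + 1) (elt \<alpha> (j + 1))) = ?G * ?X"
  proof (rule eq_matI)
    fix i j assume "i < dim_row (?G * ?X)" "j < dim_col (?G * ?X)"
    hence ij: "i < k" "j < k" by simp_all
    have "elt \<alpha> (j + 1) \<in> \<alpha>" using elt_mem(1)[OF \<alpha>, of "j + 1"] ij by simp
    hence "Y (i + 1) (elt \<alpha> (j + 1)) = (\<Sum>l = 1..k. G (i + 1) l * X l (elt \<alpha> (j + 1)))"
      using ij by (intro assms(1)) auto
    also have "\<dots> = (\<Sum>l = 0..<k. G (i + 1) (l + 1) * X (l + 1) (elt \<alpha> (j + 1)))"
      by (rule sum.reindex_bij_witness[where i = "\<lambda>i. i + 1" and j = "\<lambda>i. i - 1"]) auto
    finally show "mat k k (\<lambda>(i, j). Y (i + 1) (elt \<alpha> (j + 1))) $$ (i, j) = (?G * ?X) $$ (i, j)"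
      using ij by (simp add: scalar_prod_def)
  qed auto
  hence "minor k Y \<alpha> = det ?G * minor k X \<alpha>"
    unfolding minor_def cminor_def by (simp add: det_mult[of _ k])
  also have "det ?G = (\<Prod>i = 0..<k. G (i + 1) (i + 1))"
    by (subst det_upper_triangular[of _ k]) (auto simp: upper prod_list_diag_prod)
  also have "\<dots> = (\<Prod>i = 1..k. G i i)"
    by (rule prod.reindex_bij_witness[where i = "\<lambda>i. i - 1" and j = "\<lambda>i. i + 1"]) auto
  finally show ?thesis .
qed

context richardson_step
begin

definition swap :: "nat \<Rightarrow> nat" where
  "swap = Transposition.transpose t (t + 1)"

lemma swap_simps: "swap t = t + 1" "swap (t + 1) = t" "swap (Suc t) = t" "i \<noteq> t \<Longrightarrow> i \<noteq> t + 1 \<Longrightarrow> swap i = i"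
  by (simp_all add: swap_def transpose_def)

lemma swap_bij: "bij_betw swap {1..k} {1..k}"
proof -
  have "swap permutes {1..k}"
    unfolding swap_def by (rule permutes_swap_id) (use t in auto)
  thus ?thesis by (rule permutes_imp_bij)
qed

definition zz :: "nat \<Rightarrow> nat \<Rightarrow> 'k::field band_poly fract" where
  "zz i j = fr (Z0 i j)"

lemma zz_0: "\<not> (elt \<beta> i \<le> j \<and> j \<le> elt \<gamma> i) \<Longrightarrow> zz i j = 0"
  by (auto simp: zz_def Z_def band_def)

lemma zz_\<beta>: "1 \<le> i \<Longrightarrow> i \<le> k \<Longrightarrow> zz i (elt \<beta> i) \<noteq> (0 :: 'k::field band_poly fract)"
  and zz_\<gamma>: "1 \<le> i \<Longrightarrow> i \<le> k \<Longrightarrow> zz i (elt \<gamma> i) \<noteq> (0 :: 'k::field band_poly fract)"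
  by (simp_all add: zz_def Z0_\<beta> Z0_\<gamma>)

lemma fr_P: "s \<le> k \<Longrightarrow> fr (P s) = (\<Prod>i = 1..k. zz i (if i \<le> s then elt \<beta> i else elt \<gamma> i))"
  by (simp add: P_prod fr.hom_prod zz_def)

text \<open>Replacing the left end \<open>\<beta>(s)\<close> by \<open>j\<close> in the triangular
  minor \<open>P s\<close> multiplies it by this quotient.\<close>

lemma row_entry:
  assumes "1 \<le> s" "s \<le> k" "1 \<le> j" "j \<le> n" "s \<noteq> t"
  shows "zz s j / zz s (elt \<beta> s) \<in> (Qloc :: 'k::field band_poly fract set)"
proof -
  define c where "c l = (if l < s then elt \<beta> l else if l = s then j else elt \<gamma> l)" for l
  define R where "R = (\<Prod>i\<in>{1..k} - {s}. zz i (c i) :: 'k band_poly fract)"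
  have R: "R \<noteq> 0"
    unfolding R_def using zz_\<beta>[where ?'k = 'k] zz_\<gamma>[where ?'k = 'k] by (auto simp: c_def)
  have "cminor k Z0 c = (\<Prod>i = 1..k. Z0 i (c i) :: 'k band_poly)"
    by (rule cminor_triangular[where s = s]) (use assms in \<open>auto simp: c_def Z0_low Z0_high\<close>)
  hence "fr (cminor k Z0 c) = (\<Prod>i = 1..k. zz i (c i) :: 'k band_poly fract)"
    by (simp add: fr.hom_prod zz_def)
  also have "\<dots> = zz s (c s) * R" unfolding R_def by (rule prod.remove) (use assms in auto)
  finally have 1: "fr (cminor k Z0 c) = zz s j * R" by (simp add: c_def)
  have "fr (P s) = (\<Prod>i = 1..k. zz i (if i \<le> s then elt \<beta> i else elt \<gamma> i) :: 'k band_poly fract)"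
    using assms by (intro fr_P)
  also have "\<dots> = zz s (elt \<beta> s) * (\<Prod>i\<in>{1..k} - {s}. zz i (if i \<le> s then elt \<beta> i else elt \<gamma> i))"
    by (subst prod.remove[of _ s]) (use assms in auto)
  also have "(\<Prod>i\<in>{1..k} - {s}. zz i (if i \<le> s then elt \<beta> i else elt \<gamma> i)) = R"
    unfolding R_def by (rule prod.cong) (auto simp: c_def)
  finally have 2: "fr (P s) = zz s (elt \<beta> s) * R" .
  have eq: "zz s j / zz s (elt \<beta> s) = (fr (cminor k Z0 c) / fr (P s) :: 'k band_poly fract)"
    unfolding 1 2 using R by simp
  have "cminor k Z0 c \<in> (Q :: 'k band_poly set)"
    by (rule cminor_Q) (use assms elt_mem[OF \<beta>] elt_mem[OF \<gamma>] in \<open>auto simp: c_def\<close>)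
  thus ?thesis unfolding eq using assms by (intro Qloc_over)
qed

text \<open>Minors with the left ends as their first \<open>t - 1\<close> columns and the right ends
  as their last \<open>k - t - 1\<close> columns share the factor \<open>R\<close>, the product of
  the entries of \<open>Z\<close> at these ends.\<close>

lemma two_columns:
  assumes "1 \<le> x" "x \<le> n" "1 \<le> y" "y \<le> n"
  obtains q :: "'k::field band_poly" and R where "q \<in> Q" "R \<noteq> 0"
    "fr q = (zz t x * zz (t + 1) y - zz t y * zz (t + 1) x) * R"
    "fr (P (t - 1)) = zz t (elt \<gamma> t) * zz (t + 1) (elt \<gamma> (t + 1)) * R"
    "fr (P t) = zz t (elt \<beta> t) * zz (t + 1) (elt \<gamma> (t + 1)) * R"
    "fr (P (t + 1)) = zz t (elt \<beta> t) * zz (t + 1) (elt \<beta> (t + 1)) * R"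
proof -
  define c where "c l = (if l < t then elt \<beta> l else if l = t then x else if l = t + 1 then y else elt \<gamma> l)" for l
  define q where "q = (cminor k Z0 c :: 'k band_poly)"
  define R where "R = (\<Prod>i\<in>{1..k} - {t, t + 1}. zz i (c i) :: 'k band_poly fract)"
  have R: "R \<noteq> 0"
    unfolding R_def using zz_\<beta>[where ?'k = 'k] zz_\<gamma>[where ?'k = 'k] by (auto simp: c_def)
  have qQ: "q \<in> Q"
    unfolding q_def by (rule cminor_Q) (use assms elt_mem[OF \<beta>] elt_mem[OF \<gamma>] in \<open>auto simp: c_def\<close>)
  have "q = (Z0 t (c t) * Z0 (t + 1) (c (t + 1)) - Z0 t (c (t + 1)) * Z0 (t + 1) (c t))
    * (\<Prod>i\<in>{1..k} - {t, t + 1}. Z0 i (c i))"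
    unfolding q_def by (rule cminor_two_columns) (use t in \<open>auto simp: c_def Z0_low Z0_high\<close>)
  hence e: "fr q = (zz t x * zz (t + 1) y - zz t y * zz (t + 1) x) * R"
    by (simp add: fr.hom_prod fr.hom_mult fr.hom_minus zz_def c_def R_def)
  have PR: "fr (P s) = zz t (if t \<le> s then elt \<beta> t else elt \<gamma> t) *
      zz (t + 1) (if t + 1 \<le> s then elt \<beta> (t + 1) else elt \<gamma> (t + 1)) * R"
    if "s \<in> {t - 1, t, t + 1}" for s
  proof -
    let ?h = "\<lambda>i. zz i (if i \<le> s then elt \<beta> i else elt \<gamma> i) :: 'k band_poly fract"
    have "fr (P s) = (\<Prod>i = 1..k. ?h i)" by (rule fr_P) (use that t in auto)
    also have "\<dots> = ?h t * (\<Prod>i\<in>{1..k} - {t}. ?h i)" by (rule prod.remove) (use t in auto)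
    also have "(\<Prod>i\<in>{1..k} - {t}. ?h i) = ?h (t + 1) * (\<Prod>i\<in>{1..k} - {t} - {t + 1}. ?h i)"
      by (rule prod.remove) (use t in auto)
    also have "(\<Prod>i\<in>{1..k} - {t} - {t + 1}. ?h i) = R"
      unfolding R_def by (rule prod.cong) (use that t in \<open>auto simp: c_def\<close>)
    finally show ?thesis by (simp only: mult.assoc)
  qed
  have n: "\<not> t \<le> t - 1" "\<not> t + 1 \<le> t - 1" "\<not> t + 1 \<le> t" using t by auto
  have "fr (P (t - 1)) = zz t (elt \<gamma> t) * zz (t + 1) (elt \<gamma> (t + 1)) * R"
    using PR[of "t - 1"] n by (simp only: if_False insertI1)
  moreover have "fr (P t) = zz t (elt \<beta> t) * zz (t + 1) (elt \<gamma> (t + 1)) * R" using PR[of t] by simp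
  moreover have "fr (P (t + 1)) = zz t (elt \<beta> t) * zz (t + 1) (elt \<beta> (t + 1)) * R" using PR[of "t + 1"] by simp
  ultimately show thesis by (rule that[OF qQ R e])
qed

text \<open>Scaling the first row makes the minors of the new matrix equal to those of
  \<open>Z\<close>, and not only proportional to them.\<close>

definition scale :: "nat \<Rightarrow> 'k::field band_poly fract" where
  "scale i = (if i = 1 then fr (P k) else 1)"

text \<open>Every row is divided by its left end. In row \<open>t\<close> a multiple of row \<open>t
  + 1\<close> is subtracted first, so that its entries become quotients of minors with denominator
  \<open>P (t + 1)\<close> instead of \<open>P t\<close>.\<close>

definition M :: "nat \<Rightarrow> nat \<Rightarrow> 'k::field band_poly fract" where
  "M i j = scale i * (if i = t
    then (zz t j * zz (t + 1) (elt \<beta> (t + 1)) - zz t (elt \<beta> (t + 1)) * zz (t + 1) j)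
      / (zz t (elt \<beta> t) * zz (t + 1) (elt \<beta> (t + 1)))
    else zz i j / zz i (elt \<beta> i))"

lemma minor_M:
  assumes \<alpha>: "\<alpha> \<in> V"
  shows "minor k M \<alpha> = (fr (minor k Z0 \<alpha>) :: 'k::field band_poly fract)"
proof -
  define G :: "nat \<Rightarrow> nat \<Rightarrow> 'k band_poly fract" where "G i l = scale i * (if l = i then 1 / zz i (elt \<beta> i)
    else if i = t \<and> l = t + 1 then - (zz t (elt \<beta> (t + 1)) / (zz t (elt \<beta> t) * zz (t + 1) (elt \<beta> (t + 1)))) else 0)" for i l
  have "minor k M \<alpha> = (\<Prod>i = 1..k. G i i) * minor k zz \<alpha>"
  proof (rule minor_row_transform[where G = G, OF _ _ \<alpha>])
    show "l < i \<Longrightarrow> G i l = 0" for i l by (auto simp: G_def)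
    fix i j assume i: "1 \<le> i" "i \<le> k"
    show "M i j = (\<Sum>l = 1..k. G i l * zz l j)"
    proof (cases "i = t")
      case False
      have "(\<Sum>l = 1..k. G i l * zz l j) = (\<Sum>l = 1..k. if l = i then G i i * zz i j else 0)"
        by (rule sum.cong) (use False in \<open>auto simp: G_def\<close>)
      thus ?thesis using False i by (simp add: M_def G_def sum.delta')
    next
      case True
      have "(\<Sum>l = 1..k. G i l * zz l j) = (\<Sum>l = 1..k. (if l = t then G t t * zz t j else 0)
          + (if l = t + 1 then G t (t + 1) * zz (t + 1) j else 0))"
        by (rule sum.cong) (use True in \<open>auto simp: G_def\<close>)
      also have "\<dots> = G t t * zz t j + G t (t + 1) * zz (t + 1) j"
        using t by (simp add: sum.distrib sum.delta')
      also have "\<dots> = M t j"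
        using zz_\<beta>[of t, where ?'k = 'k] zz_\<beta>[of "t + 1", where ?'k = 'k] t
        by (simp add: M_def G_def field_simps)
      finally show ?thesis using True by simp
    qed
  qed
  also have "(\<Prod>i = 1..k. G i i) = 1"
  proof -
    have "(\<Prod>i = 1..k. G i i) = (\<Prod>i = 1..k. scale i) * (\<Prod>i = 1..k. 1 / zz i (elt \<beta> i))"
      unfolding prod.distrib[symmetric] by (rule prod.cong) (auto simp: G_def)
    also have "(\<Prod>i = 1..k. scale i) = (fr (P k) :: 'k band_poly fract)"
      using k_pos by (simp add: scale_def prod.delta')
    also have "fr (P k) = (\<Prod>i = 1..k. zz i (elt \<beta> i) :: 'k band_poly fract)"
      unfolding fr_P[OF order_refl] by (rule prod.cong) auto
    also have "(\<Prod>i = 1..k. zz i (elt \<beta> i)) * (\<Prod>i = 1..k. 1 / zz i (elt \<beta> i)) = (1 :: 'k band_poly fract)"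
      unfolding prod.distrib[symmetric] using zz_\<beta>[where ?'k = 'k] by (intro prod.neutral) auto
    finally show ?thesis .
  qed
  also have "1 * minor k zz \<alpha> = (fr (minor k Z0 \<alpha>) :: 'k band_poly fract)"
    using hom_minor[OF to_frac_hom, of k "Z0 :: nat \<Rightarrow> nat \<Rightarrow> 'k band_poly" \<alpha>]
    by (simp add: zz_def[abs_def])
  finally show ?thesis .
qed

lemma scale_Qloc: "scale i \<in> Qloc"
  unfolding scale_def using P_Q[of k] by (auto intro: Qloc_fr Qloc_1)

lemma M_Qloc:
  assumes "1 \<le> i" "i \<le> k" "1 \<le> j" "j \<le> n"
  shows "M i j \<in> (Qloc :: 'k::field band_poly fract set)"
proof (cases "i = t")
  case False
  hence M: "M i j = scale i * (zz i j / zz i (elt \<beta> i) :: 'k band_poly fract)" by (simp add: M_def)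
  show ?thesis unfolding M by (rule Qloc_mult[OF scale_Qloc row_entry[OF assms False]])
next
  case True
  have b: "1 \<le> elt \<beta> (t + 1)" "elt \<beta> (t + 1) \<le> n" using elt_mem[OF \<beta>, of "t + 1"] t by auto
  obtain q :: "'k band_poly" and R where q: "q \<in> Q" "R \<noteq> 0"
    "fr q = (zz t j * zz (t + 1) (elt \<beta> (t + 1)) - zz t (elt \<beta> (t + 1)) * zz (t + 1) j) * R"
    "fr (P (t + 1)) = zz t (elt \<beta> t) * zz (t + 1) (elt \<beta> (t + 1)) * R"
    using two_columns[OF assms(3,4) b] by metis
  have M: "M i j = scale i * (fr q / fr (P (t + 1)))"
    unfolding M_def q(3,4) using True q(2) by simp
  have "fr q / fr (P (t + 1)) \<in> Qloc" using q(1) t by (intro Qloc_over) auto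
  thus ?thesis unfolding M by (rule Qloc_mult[OF scale_Qloc])
qed

definition M' :: "nat \<Rightarrow> nat \<Rightarrow> 'k::field band_poly fract" where
  "M' i j = (if elt \<beta> i \<le> j \<and> j \<le> elt \<gamma> (swap i) then M i j else 0)"

text \<open>Only the entries of row \<open>t + 1\<close> to the right of \<open>\<gamma>(t)\<close>
  leave the exchanged band. The columns to the right of \<open>\<gamma>(t)\<close> vanish in row
  \<open>t\<close>, so that such an entry is the entry \<open>P t / P (t + 1)\<close> in column
  \<open>\<gamma>(t+1)\<close> times an element of \<open>Qloc\<close>.\<close>

lemma cong_M:
  assumes ij: "1 \<le> i" "i \<le> k" "1 \<le> j" "j \<le> n"
  shows "cong (M i j) (M' i j :: 'k::field band_poly fract)"
proof (cases "elt \<beta> i \<le> j \<and> j \<le> elt \<gamma> (swap i)")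
  case True
  thus ?thesis by (simp add: M'_def cong_refl M_Qloc[OF ij])
next
  case False
  have M'0: "M' i j = (0 :: 'k band_poly fract)" unfolding M'_def using False by (rule if_not_P)
  have less: "elt \<beta> t < elt \<beta> (t + 1)" "elt \<gamma> t < elt \<gamma> (t + 1)"
    using elt_less[OF \<beta>, of t "t + 1"] elt_less[OF \<gamma>, of t "t + 1"] t by auto
  consider "M i j = (0 :: 'k band_poly fract)" | "i = t + 1" "elt \<gamma> t < j"
  proof (cases "i = t")
    case i: True
    hence "\<not> (elt \<beta> t \<le> j \<and> j \<le> elt \<gamma> (t + 1))" using False by (simp add: swap_simps)
    hence "zz t j = (0 :: 'k band_poly fract)" "zz (t + 1) j = (0 :: 'k band_poly fract)"
      using less by (auto intro!: zz_0)
    thus ?thesis using that(1) i by (simp add: M_def)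
  next
    case i: False
    show ?thesis
    proof (cases "i = t + 1 \<and> elt \<gamma> t < j")
      case False
      hence "zz i j = (0 :: 'k band_poly fract)"
        using i \<open>\<not> (elt \<beta> i \<le> j \<and> j \<le> elt \<gamma> (swap i))\<close> by (intro zz_0) (cases "i = t + 1"; auto simp: swap_simps)
      thus ?thesis using that(1) i by (simp add: M_def)
    qed (use that in auto)
  qed
  thus ?thesis
  proof cases
    case 1
    thus ?thesis by (simp add: M'0 cong_refl Qloc_0)
  next
    case 2
    have g: "1 \<le> elt \<gamma> t" "elt \<gamma> t \<le> n" using elt_mem[OF \<gamma>, of t] t by auto
    obtain q :: "'k band_poly" and R where q: "q \<in> Q" "R \<noteq> 0"
      "fr q = (zz t (elt \<gamma> t) * zz (t + 1) j - zz t j * zz (t + 1) (elt \<gamma> t)) * R"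
      "fr (P (t - 1)) = zz t (elt \<gamma> t) * zz (t + 1) (elt \<gamma> (t + 1)) * R"
      "fr (P t) = zz t (elt \<beta> t) * zz (t + 1) (elt \<gamma> (t + 1)) * R"
      "fr (P (t + 1)) = zz t (elt \<beta> t) * zz (t + 1) (elt \<beta> (t + 1)) * R"
      using two_columns[OF g ij(3,4)] by metis
    have "zz t j = (0 :: 'k band_poly fract)" using 2 by (intro zz_0) auto
    hence "zz (t + 1) j / zz (t + 1) (elt \<beta> (t + 1)) = fr (P t) * (fr q / fr (P (t - 1)) * (1 / fr (P (t + 1))))"
      unfolding q(3-6) using q(2) zz_\<beta>[of t, where ?'k = 'k] zz_\<beta>[of "t + 1", where ?'k = 'k]
        zz_\<gamma>[of t, where ?'k = 'k] zz_\<gamma>[of "t + 1", where ?'k = 'k] t by (simp add: field_simps)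
    hence "M i j = fr (P t) * (scale i * (fr q / fr (P (t - 1)) * (fr 1 / fr (P (t + 1)))))"
      using 2 by (simp add: M_def)
    hence "M i j - M' i j = fr (P t) * (scale i * (fr q / fr (P (t - 1)) * (fr 1 / fr (P (t + 1)))))"
      unfolding M'0 by simp
    moreover have "scale i * (fr q / fr (P (t - 1)) * (fr 1 / fr (P (t + 1)))) \<in> Qloc"
      using q(1) t Q_1 by (intro Qloc_mult scale_Qloc Qloc_over) auto
    moreover have "M' i j \<in> (Qloc :: 'k band_poly fract set)" by (simp add: M'0 Qloc_0)
    ultimately show ?thesis unfolding cong_def using M_Qloc[OF ij] by blast
  qed
qed

text \<open>Modulo \<open>P t\<close> the minors of \<open>Z\<close> are those of \<open>M'\<close>,
  which is a specialization of the exchanged band matrix, so a relation among the minors of the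
  latter holds for the former.\<close>

theorem Phi_swap_zero:
  fixes F :: "(nat set, 'k::field) mpoly"
  assumes F: "mvars F \<subseteq> V" "Phi swap F = 0"
  shows "\<exists>ss. \<exists>q\<in>Q. good_den ss \<and> den ss * Phi0 F = P t * q"
proof -
  let ?h = "\<lambda>c. fr (single 0 c) :: 'k band_poly fract"
  have h: "comm_ring_hom ?h"
  proof -
    interpret c: comm_ring_hom "\<lambda>c. single 0 c :: 'k band_poly" by (rule const_hom)
    show ?thesis by unfold_locales (simp_all add: c.hom_add c.hom_mult fr.hom_add fr.hom_mult)
  qed
  have "fr (Phi0 F) = peval ?h (\<lambda>\<alpha>. fr (minor k Z0 \<alpha>)) F"
    unfolding Phi_def msubst_eq_peval by (rule hom_peval[OF to_frac_hom])
  also have "\<dots> = peval ?h (minor k M) F"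
    by (rule peval_cong) (use F in \<open>auto simp: minor_M\<close>)
  finally have 1: "fr (Phi0 F) = peval ?h (minor k M) F" .
  \<comment> \<open>The specialization of the exchanged band matrix to \<open>M'\<close>.\<close>
  let ?\<chi> = "peval ?h (\<lambda>(i, j). M' i j) :: 'k band_poly \<Rightarrow> _"
  have \<chi>: "comm_ring_hom ?\<chi>" by (rule peval_hom[OF h])
  interpret \<chi>: comm_ring_hom ?\<chi> by (rule \<chi>)
  have "?\<chi> (minor k (Z swap) \<alpha>) = minor k M' \<alpha>" for \<alpha>
  proof -
    have "?\<chi> (Z swap i j) = M' i j" for i j
      by (simp add: Z_def band_def M'_def peval_mvar[OF h] peval_0)
    thus ?thesis by (simp add: hom_minor[OF \<chi>])
  qed
  hence "peval ?h (minor k M') F = ?\<chi> (Phi swap F)"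
    unfolding Phi_def msubst_eq_peval hom_peval[OF \<chi>] by (simp add: peval_const[OF h])
  hence 2: "peval ?h (minor k M') F = 0" using F(2) by simp
  have "cong (peval ?h (minor k M) F) (peval ?h (minor k M') F)"
    by (rule cong_peval[OF F(1)]) (rule cong_minor, assumption, rule cong_M)
  then obtain z where "z \<in> Qloc" "fr (Phi0 F) = fr (P t) * z"
    unfolding 1[symmetric] 2 by (auto simp: cong_def)
  then obtain q ss where q: "q \<in> Q" "good_den ss" "fr (Phi0 F) = fr (P t) * (fr q / fr (den ss))"
    by (auto simp: Qloc_def)
  have "fr (den ss :: 'k band_poly) \<noteq> 0" using den_nonzero[OF q(2)] by simp
  hence "fr (den ss) * fr (Phi0 F) = fr (P t) * fr q" unfolding q(3) by simp
  hence "fr (den ss * Phi0 F) = fr (P t * q)" by (simp only: fr.hom_mult)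
  hence "den ss * Phi0 F = P t * q" by simp
  thus ?thesis using q by blast
qed

section \<open>Values of the swapped evaluation\<close>

text \<open>Row \<open>t + 1\<close> of the exchanged band contains no column of
  \<open>\<delta>\<^sub>t\<close>.\<close>

lemma Phi_swap_delta: "Phi swap (mvar (delta k \<beta> \<gamma> t) :: (nat set, 'k::field) mpoly) = 0"
proof -
  have less: "elt \<gamma> t < elt \<gamma> (t + 1)" using elt_less[OF \<gamma>, of t "t + 1"] t by simp
  have "minor k (Z swap) (delta k \<beta> \<gamma> t) = (0 :: 'k band_poly)"
    unfolding minor_def
  proof (rule cminor_zeroI, rule bexI)
    fix p assume p: "bij_betw p {1..k} {1..k}"
    show "t + 1 \<in> {1..k}" using t by simp
    hence "p (t + 1) \<in> {1..k}" using p by (auto simp: bij_betw_def)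
    hence pt: "1 \<le> p (t + 1)" "p (t + 1) \<le> k" by auto
    show "Z swap (t + 1) (elt (delta k \<beta> \<gamma> t) (p (t + 1))) = (0 :: 'k band_poly)"
    proof (cases "p (t + 1) \<le> t")
      case True
      thus ?thesis using elt_less[OF \<beta>, of "p (t + 1)" "t + 1"] pt t
        by (simp add: elt_delta Z_def band_def)
    next
      case False
      thus ?thesis using elt_less[OF \<gamma>, of t "p (t + 1)"] pt t
        by (simp add: elt_delta Z_def band_def swap_simps)
    qed
  qed
  thus ?thesis by simp
qed

lemma gap_bounds: "1 \<le> i \<Longrightarrow> i \<le> k \<Longrightarrow> elt \<beta> i \<le> elt \<gamma> (swap i)"
  using gap \<beta>_le_\<gamma>[of i] delta_aux[of t] t
  by (cases "i = t"; cases "i = t + 1") (auto simp: swap_simps)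

lemma Phi_swap_\<beta>: "Phi swap (mvar \<beta> :: (nat set, 'k::field) mpoly) \<noteq> 0"
proof -
  have "minor k (Z swap) \<beta> = (\<Prod>i = 1..k. Z swap i (elt \<beta> i) :: 'k band_poly)"
    unfolding minor_def
  proof (rule cminor_triangular[where s = k])
    fix i l assume "1 \<le> l" "l < k" "l < i" "i \<le> k"
    thus "Z swap i (elt \<beta> l) = (0 :: 'k band_poly)"
      using elt_less[OF \<beta>, of l i] by (simp add: Z_def band_def)
  qed (use k_pos in auto)
  also have "\<dots> \<noteq> 0" using gap_bounds by (auto simp: Z_def band_def mvar_nonzero)
  finally show ?thesis by simp
qed

text \<open>After exchanging rows \<open>t\<close> and \<open>t + 1\<close> the columns
  \<open>\<gamma>\<close> become lower triangular.\<close>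

lemma Phi_swap_\<gamma>: "Phi swap (mvar \<gamma> :: (nat set, 'k::field) mpoly) \<noteq> 0"
proof -
  \<comment> \<open>The same matrix with rows \<open>t\<close> and \<open>t + 1\<close> exchanged
    back, so that row \<open>i\<close> ends at \<open>\<gamma>(i)\<close>.\<close>
  let ?W = "\<lambda>i. Z swap (swap i) :: nat \<Rightarrow> 'k band_poly"
  let ?A = "mat k k (\<lambda>(i, j). Z swap (i + 1) (elt \<gamma> (j + 1)) :: 'k band_poly)"
  have "cminor k ?W (elt \<gamma>) = (\<Prod>i = 1..k. ?W i (elt \<gamma> i))"
  proof (rule cminor_triangular[where s = 1])
    fix i l assume il: "1 < l" "l \<le> k" "1 \<le> i" "i < l"
    have "swap (swap i) = i" by (simp add: swap_def)
    thus "?W i (elt \<gamma> l) = 0" using elt_less[OF \<gamma>, of i l] il by (simp add: Z_def band_def)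
  qed (use k_pos in auto)
  also have "\<dots> \<noteq> 0"
  proof -
    have "?W i (elt \<gamma> i) \<noteq> 0" if "1 \<le> i" "i \<le> k" for i
    proof -
      have "swap (swap i) = i" by (simp add: swap_def)
      moreover have "swap i \<in> {1..k}" using swap_bij that by (auto simp: bij_betw_def)
      ultimately show ?thesis using gap_bounds[of "swap i"] by (simp add: Z_def band_def mvar_nonzero)
    qed
    thus ?thesis by simp
  qed
  also have "cminor k ?W (elt \<gamma>) = - minor k (Z swap) \<gamma>"
  proof -
    have "mat k k (\<lambda>(i, j). ?W (i + 1) (elt \<gamma> (j + 1))) = swaprows (t - 1) t ?A"
      using t by (intro eq_matI) (auto simp: swap_def transpose_def)
    thus ?thesis
      unfolding cminor_def minor_def using t by (simp add: det_swaprows[of _ k])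
  qed
  finally show ?thesis by simp
qed

end

section \<open>Prime elements of a localization\<close>

locale localizing = cring R for R (structure) +
  fixes S
  assumes S_carrier: "S \<subseteq> carrier R" and S_one: "\<one> \<in> S" and S_mult: "\<And>s t. s \<in> S \<Longrightarrow> t \<in> S \<Longrightarrow> s \<otimes> t \<in> S"
begin

lemma S_closed [simp, intro]: "s \<in> S \<Longrightarrow> s \<in> carrier R"
  using S_carrier by blast

lemma loc_relI:
  assumes "a \<in> carrier R" "b \<in> carrier R" "s \<in> S" "t \<in> S" "u \<in> S" "u \<otimes> (a \<otimes> t) = u \<otimes> (b \<otimes> s)"
  shows "((a, s), (b, t)) \<in> loc_rel R S"
  using assms by (auto simp: loc_rel_def)

lemma loc_rel_equiv: "equiv (carrier R \<times> S) (loc_rel R S)"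
proof (rule equivI)
  show "loc_rel R S \<subseteq> (carrier R \<times> S) \<times> (carrier R \<times> S)"
    by (auto simp: loc_rel_def)
  show "refl_on (carrier R \<times> S) (loc_rel R S)"
    using S_one by (auto simp: refl_on_def loc_rel_def)
  show "sym (loc_rel R S)"
    by (rule symI) (auto simp: loc_rel_def eq_commute)
  show "trans (loc_rel R S)"
  proof (rule transI)
    fix x y z assume xy: "(x, y) \<in> loc_rel R S" and yz: "(y, z) \<in> loc_rel R S"
    obtain a s where [simp]: "x = (a, s)" by (cases x) auto
    obtain b t where [simp]: "y = (b, t)" by (cases y) auto
    obtain c r where [simp]: "z = (c, r)" by (cases z) auto
    obtain u where u: "u \<in> S" "u \<otimes> (a \<otimes> t) = u \<otimes> (b \<otimes> s)" using xy by (auto simp: loc_rel_def)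
    obtain v where v: "v \<in> S" "v \<otimes> (b \<otimes> r) = v \<otimes> (c \<otimes> t)" using yz by (auto simp: loc_rel_def)
    have c: "a \<in> carrier R" "b \<in> carrier R" "c \<in> carrier R" "s \<in> S" "t \<in> S" "r \<in> S"
      using xy yz by (auto simp: loc_rel_def)
    have cr: "a \<in> carrier R" "b \<in> carrier R" "c \<in> carrier R" "s \<in> carrier R" "t \<in> carrier R" "r \<in> carrier R"
      "u \<in> carrier R" "v \<in> carrier R" using c u(1) v(1) by auto
    have "(u \<otimes> v \<otimes> t) \<otimes> (a \<otimes> r) = (u \<otimes> (a \<otimes> t)) \<otimes> (v \<otimes> r)" using cr by algebra
    also have "\<dots> = (v \<otimes> (b \<otimes> r)) \<otimes> (u \<otimes> s)" unfolding u(2) using cr by algebra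
    also have "\<dots> = (u \<otimes> v \<otimes> t) \<otimes> (c \<otimes> s)" unfolding v(2) using cr by algebra
    finally show "(x, z) \<in> loc_rel R S"
      using c u(1) v(1) by (auto intro!: loc_relI[where u = "u \<otimes> v \<otimes> t"] S_mult)
  qed
qed

lemma loc_frac_eq_iff:
  assumes "a \<in> carrier R" "s \<in> S" "b \<in> carrier R" "t \<in> S"
  shows "loc_frac R S a s = loc_frac R S b t \<longleftrightarrow> (\<exists>u\<in>S. u \<otimes> (a \<otimes> t) = u \<otimes> (b \<otimes> s))"
  unfolding loc_frac_def using eq_equiv_class_iff[OF loc_rel_equiv, of "(a, s)" "(b, t)"] assms
  by (auto simp: loc_rel_def)

lemma mem_loc_frac:
  assumes "a \<in> carrier R" "s \<in> S"
  shows "(b, t) \<in> loc_frac R S a s \<longleftrightarrow> b \<in> carrier R \<and> t \<in> S \<and> (\<exists>u\<in>S. u \<otimes> (a \<otimes> t) = u \<otimes> (b \<otimes> s))"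
  using assms by (auto simp: loc_frac_def loc_rel_def)

lemma localization_carrier:
  "X \<in> carrier (localization R S) \<longleftrightarrow> (\<exists>a\<in>carrier R. \<exists>s\<in>S. X = loc_frac R S a s)"
  by (auto simp: localization_def loc_frac_def quotient_def)

lemma localization_one: "\<one>\<^bsub>localization R S\<^esub> = loc_frac R S \<one> \<one>"
  and localization_zero: "\<zero>\<^bsub>localization R S\<^esub> = loc_frac R S \<zero> \<one>"
  by (simp_all add: localization_def)

lemma localization_mult:
  assumes "a \<in> carrier R" "s \<in> S" "b \<in> carrier R" "t \<in> S"
  shows "loc_frac R S a s \<otimes>\<^bsub>localization R S\<^esub> loc_frac R S b t = loc_frac R S (a \<otimes> b) (s \<otimes> t)"
proof -
  let ?X = "loc_frac R S a s" and ?Y = "loc_frac R S b t"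
  have eq: "loc_frac R S (a' \<otimes> b') (s' \<otimes> t') = loc_frac R S (a \<otimes> b) (s \<otimes> t)"
    if X: "(a', s') \<in> ?X" and Y: "(b', t') \<in> ?Y" for a' s' b' t'
  proof -
    obtain u where u: "a' \<in> carrier R" "s' \<in> S" "u \<in> S" "u \<otimes> (a \<otimes> s') = u \<otimes> (a' \<otimes> s)"
      using X mem_loc_frac assms by auto
    obtain v where v: "b' \<in> carrier R" "t' \<in> S" "v \<in> S" "v \<otimes> (b \<otimes> t') = v \<otimes> (b' \<otimes> t)"
      using Y mem_loc_frac assms by auto
    have cr: "a \<in> carrier R" "s \<in> carrier R" "b \<in> carrier R" "t \<in> carrier R" "a' \<in> carrier R" "s' \<in> carrier R"
      "b' \<in> carrier R" "t' \<in> carrier R" "u \<in> carrier R" "v \<in> carrier R"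
      using assms u v by auto
    have "(u \<otimes> v) \<otimes> ((a' \<otimes> b') \<otimes> (s \<otimes> t)) = (u \<otimes> (a' \<otimes> s)) \<otimes> (v \<otimes> (b' \<otimes> t))" using cr by algebra
    also have "\<dots> = (u \<otimes> v) \<otimes> ((a \<otimes> b) \<otimes> (s' \<otimes> t'))"
      unfolding u(4)[symmetric] v(4)[symmetric] using cr by algebra
    finally show ?thesis
      using assms u v by (subst loc_frac_eq_iff) (auto intro: S_mult)
  qed
  have in_class: "(a, s) \<in> ?X" "(b, t) \<in> ?Y"
    using assms S_one mem_loc_frac by blast+
  have "?X \<otimes>\<^bsub>localization R S\<^esub> ?Y = (\<Union>(a, s)\<in>?X. \<Union>(b, t)\<in>?Y. loc_frac R S (a \<otimes> b) (s \<otimes> t))"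
    by (simp add: localization_def)
  also have "\<dots> = loc_frac R S (a \<otimes> b) (s \<otimes> t)"
    using eq in_class by blast
  finally show ?thesis .
qed

text \<open>Primality of \<open>p / 1\<close> is stated with cleared denominators, so that it can be
  checked in \<open>R\<close>.\<close>

theorem ring_prime_localization:
  assumes p: "p \<in> carrier R"
    and nonzero: "\<And>u. u \<in> S \<Longrightarrow> u \<otimes> p \<noteq> \<zero>"
    and nonunit: "\<And>u c. u \<in> S \<Longrightarrow> c \<in> carrier R \<Longrightarrow> u \<noteq> c \<otimes> p"
    and prime: "\<And>u a b c. u \<in> S \<Longrightarrow> a \<in> carrier R \<Longrightarrow> b \<in> carrier R \<Longrightarrow> c \<in> carrier R \<Longrightarrow> u \<otimes> (a \<otimes> b) = c \<otimes> p \<Longrightarrow>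
      (\<exists>v\<in>S. \<exists>d\<in>carrier R. v \<otimes> a = d \<otimes> p) \<or> (\<exists>v\<in>S. \<exists>d\<in>carrier R. v \<otimes> b = d \<otimes> p)"
  shows "ring_prime\<^bsub>localization R S\<^esub> (loc_frac R S p \<one>)"
  unfolding ring_prime_def Divisibility.prime_def
proof (intro conjI ballI impI)
  let ?L = "localization R S"
  show "loc_frac R S p \<one> \<noteq> \<zero>\<^bsub>?L\<^esub>"
  proof
    assume "loc_frac R S p \<one> = \<zero>\<^bsub>?L\<^esub>"
    then obtain u where "u \<in> S" "u \<otimes> (p \<otimes> \<one>) = u \<otimes> (\<zero> \<otimes> \<one>)"
      unfolding localization_zero using p S_one by (subst (asm) loc_frac_eq_iff) auto
    thus False using nonzero[of u] p by simp
  qed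
  show "loc_frac R S p \<one> \<notin> Units ?L"
  proof
    assume "loc_frac R S p \<one> \<in> Units ?L"
    then obtain X where "X \<in> carrier ?L" "X \<otimes>\<^bsub>?L\<^esub> loc_frac R S p \<one> = \<one>\<^bsub>?L\<^esub>" by (auto simp: Units_def)
    then obtain c s where c: "c \<in> carrier R" "s \<in> S" "loc_frac R S c s \<otimes>\<^bsub>?L\<^esub> loc_frac R S p \<one> = loc_frac R S \<one> \<one>"
      by (auto simp: localization_carrier localization_one)
    hence "loc_frac R S (c \<otimes> p) (s \<otimes> \<one>) = loc_frac R S \<one> \<one>" using p S_one by (simp add: localization_mult)
    then obtain u where u: "u \<in> S" "u \<otimes> ((c \<otimes> p) \<otimes> \<one>) = u \<otimes> (\<one> \<otimes> (s \<otimes> \<one>))"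
      using c p S_one S_mult by (subst (asm) loc_frac_eq_iff) auto
    hence "u \<otimes> s = (u \<otimes> c) \<otimes> p" using c p by (simp add: m_assoc)
    thus False using nonunit[of "u \<otimes> s" "u \<otimes> c"] u c S_mult by auto
  qed
  fix X Y assume X: "X \<in> carrier ?L" and Y: "Y \<in> carrier ?L"
    and div: "loc_frac R S p \<one> divides\<^bsub>?L\<^esub> (X \<otimes>\<^bsub>?L\<^esub> Y)"
  obtain a s where a: "a \<in> carrier R" "s \<in> S" "X = loc_frac R S a s" using X by (auto simp: localization_carrier)
  obtain b t where b: "b \<in> carrier R" "t \<in> S" "Y = loc_frac R S b t" using Y by (auto simp: localization_carrier)
  obtain c r where c: "c \<in> carrier R" "r \<in> S" "X \<otimes>\<^bsub>?L\<^esub> Y = loc_frac R S p \<one> \<otimes>\<^bsub>?L\<^esub> loc_frac R S c r"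
    using div by (auto simp: factor_def localization_carrier)
  have "loc_frac R S (a \<otimes> b) (s \<otimes> t) = loc_frac R S (p \<otimes> c) (\<one> \<otimes> r)"
    using c(3) unfolding a(3) b(3) using a b c p S_one by (simp add: localization_mult)
  then obtain u where u: "u \<in> S" "u \<otimes> ((a \<otimes> b) \<otimes> (\<one> \<otimes> r)) = u \<otimes> ((p \<otimes> c) \<otimes> (s \<otimes> t))"
    using a b c p S_one S_mult by (subst (asm) loc_frac_eq_iff) auto
  have cr: "a \<in> carrier R" "s \<in> carrier R" "b \<in> carrier R" "t \<in> carrier R" "c \<in> carrier R" "r \<in> carrier R" "u \<in> carrier R"
    using a b c u by auto
  have "(u \<otimes> r) \<otimes> (a \<otimes> b) = u \<otimes> ((a \<otimes> b) \<otimes> (\<one> \<otimes> r))" using cr by algebra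
  also have "\<dots> = (u \<otimes> c \<otimes> s \<otimes> t) \<otimes> p" unfolding u(2) using cr p by algebra
  finally have eq: "(u \<otimes> r) \<otimes> (a \<otimes> b) = (u \<otimes> c \<otimes> s \<otimes> t) \<otimes> p" .
  have div_frac: "loc_frac R S p \<one> divides\<^bsub>?L\<^esub> loc_frac R S e w"
    if ew: "e \<in> carrier R" "w \<in> S" and v: "v \<in> S" and d: "d \<in> carrier R" and vd: "v \<otimes> e = d \<otimes> p" for e w v d
  proof -
    have cr': "e \<in> carrier R" "w \<in> carrier R" "v \<in> carrier R" "d \<in> carrier R" using ew v d by auto
    have "e \<otimes> (\<one> \<otimes> (v \<otimes> w)) = (v \<otimes> e) \<otimes> w" using cr' by algebra
    also have "\<dots> = (p \<otimes> d) \<otimes> w" unfolding vd using cr' p by algebra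
    finally have "\<one> \<otimes> (e \<otimes> (\<one> \<otimes> (v \<otimes> w))) = \<one> \<otimes> ((p \<otimes> d) \<otimes> w)" by simp
    hence "loc_frac R S e w = loc_frac R S (p \<otimes> d) (\<one> \<otimes> (v \<otimes> w))"
      using ew v d p S_one S_mult by (subst loc_frac_eq_iff) auto
    also have "\<dots> = loc_frac R S p \<one> \<otimes>\<^bsub>?L\<^esub> loc_frac R S d (v \<otimes> w)"
      using ew v d p S_one S_mult by (simp add: localization_mult)
    finally have "loc_frac R S e w = loc_frac R S p \<one> \<otimes>\<^bsub>?L\<^esub> loc_frac R S d (v \<otimes> w)" .
    moreover have "loc_frac R S d (v \<otimes> w) \<in> carrier ?L"
      using ew v d S_mult localization_carrier by blast
    ultimately show ?thesis unfolding factor_def by blast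
  qed
  have "(\<exists>v\<in>S. \<exists>d\<in>carrier R. v \<otimes> a = d \<otimes> p) \<or> (\<exists>v\<in>S. \<exists>d\<in>carrier R. v \<otimes> b = d \<otimes> p)"
    by (rule prime[OF _ a(1) b(1) _ eq]) (use cr u c S_mult in auto)
  thus "loc_frac R S p \<one> divides\<^bsub>?L\<^esub> X \<or> loc_frac R S p \<one> divides\<^bsub>?L\<^esub> Y"
    unfolding a(3) b(3) using div_frac a b by blast
qed

end

section \<open>The quotient rings\<close>

text \<open>Whether \<open>I\<close> is the whole kernel is left open: evaluation on the exchanged
  band matrix kills more than the Pluecker ideal.\<close>

lemma quotient_hom:
  assumes I: "ideal I R" and h: "h \<in> Ring.ring_hom R S" and S: "ring S"
    and ker: "\<And>x. x \<in> I \<Longrightarrow> h x = \<zero>\<^bsub>S\<^esub>"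
  shows "\<exists>\<phi>\<in>Ring.ring_hom (R Quot I) S. \<forall>x\<in>carrier R. \<phi> (I +>\<^bsub>R\<^esub> x) = h x"
proof -
  interpret ideal I R by (rule I)
  interpret S: ring S by (rule S)
  interpret h: ring_hom_ring R S h by (rule ring_hom_ringI2[OF ring_axioms S h])
  define \<phi> where "\<phi> X = h (SOME x. x \<in> carrier R \<and> I +>\<^bsub>R\<^esub> x = X)" for X
  have val: "\<phi> (I +>\<^bsub>R\<^esub> x) = h x" if x: "x \<in> carrier R" for x
  proof -
    let ?y = "SOME y. y \<in> carrier R \<and> I +>\<^bsub>R\<^esub> y = I +>\<^bsub>R\<^esub> x"
    have y: "?y \<in> carrier R" "I +>\<^bsub>R\<^esub> ?y = I +>\<^bsub>R\<^esub> x"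
      using someI[of "\<lambda>y. y \<in> carrier R \<and> I +>\<^bsub>R\<^esub> y = I +>\<^bsub>R\<^esub> x" x] x by auto
    hence "?y \<ominus>\<^bsub>R\<^esub> x \<in> I" using quotient_eq_iff_same_a_r_cos[OF I y(1) x] by simp
    hence "h (?y \<ominus>\<^bsub>R\<^esub> x) = \<zero>\<^bsub>S\<^esub>" by (rule ker)
    hence "h ?y \<ominus>\<^bsub>S\<^esub> h x = \<zero>\<^bsub>S\<^esub>" using x y by (simp add: a_minus_def)
    hence "h ?y = h x" using x y by (simp add: S.r_right_minus_eq)
    thus ?thesis by (simp add: \<phi>_def)
  qed
  have rep: "\<exists>x\<in>carrier R. X = I +>\<^bsub>R\<^esub> x" if "X \<in> carrier (R Quot I)" for X
    using that by (auto simp: FactRing_def A_RCOSETS_def')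
  note \<pi> = rcos_ring_hom
  have "\<phi> \<in> Ring.ring_hom (R Quot I) S"
  proof (rule ring_hom_memI)
    fix X assume "X \<in> carrier (R Quot I)"
    then obtain x where x: "x \<in> carrier R" "X = I +>\<^bsub>R\<^esub> x" using rep by blast
    thus "\<phi> X \<in> carrier S" by (simp add: val)
    fix Y assume "Y \<in> carrier (R Quot I)"
    then obtain y where y: "y \<in> carrier R" "Y = I +>\<^bsub>R\<^esub> y" using rep by blast
    show "\<phi> (X \<otimes>\<^bsub>R Quot I\<^esub> Y) = \<phi> X \<otimes>\<^bsub>S\<^esub> \<phi> Y"
      unfolding x(2) y(2) using x(1) y(1) by (simp add: ring_hom_mult[OF \<pi>, symmetric] val)
    show "\<phi> (X \<oplus>\<^bsub>R Quot I\<^esub> Y) = \<phi> X \<oplus>\<^bsub>S\<^esub> \<phi> Y"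
      unfolding x(2) y(2) using x(1) y(1) by (simp add: ring_hom_add[OF \<pi>, symmetric] val)
  next
    show "\<phi> \<one>\<^bsub>R Quot I\<^esub> = \<one>\<^bsub>S\<^esub>" by (simp add: ring_hom_one[OF \<pi>, symmetric] val)
  qed
  thus ?thesis using val by blast
qed

lemma comm_ring_hom_in_ring_hom:
  assumes "comm_ring_hom h"
  shows "h \<in> Ring.ring_hom (mpoly_ring W) (mpoly_ring UNIV)"
proof -
  interpret comm_ring_hom h by fact
  show ?thesis by (rule ring_hom_memI) (simp_all add: hom_distribs)
qed

lemma plucker_ideal_ideal: "ideal (plucker_ideal k n) (mpoly_ring (ksubsets k n) :: (nat set, 'k::field) mpoly ring)"
proof -
  let ?R = "mpoly_ring (ksubsets k n) :: (nat set, 'k) mpoly ring"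
  let ?S = "mpoly_ring UNIV :: (nat \<times> nat, 'k) mpoly ring"
  have "ring_hom_ring ?R ?S (msubst (generic_minor k))"
    by (rule ring_hom_ringI2) (simp_all add: cring.axioms(1) mpoly_ring_cring comm_ring_hom_in_ring_hom msubst_hom)
  from ring_hom_ring.kernel_is_ideal[OF this] show ?thesis
    by (simp add: plucker_ideal_def a_kernel_def')
qed

context richardson
begin

abbreviation RR :: "'k::field richardson_elt ring" where
  "RR \<equiv> richardson_ring k n \<beta> \<gamma>"

text \<open>The class in the Richardson ring of a polynomial in the Pluecker coordinates.\<close>

definition \<eta> :: "(nat set, 'k::field) mpoly \<Rightarrow> 'k richardson_elt" where
  "\<eta> F = richardson_ideal k n \<beta> \<gamma> +>\<^bsub>plucker_ring k n\<^esub> (plucker_ideal k n +>\<^bsub>mpoly_ring V\<^esub> F)"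

lemma \<eta>_coord: "richardson_coord k n \<beta> \<gamma> \<alpha> = \<eta> (mvar \<alpha>)"
  by (simp add: richardson_coord_def plucker_coord_def \<eta>_def)

lemma plucker_ring_cring: "cring (plucker_ring k n :: 'k::field plucker_elt ring)"
  unfolding plucker_ring_def by (rule ideal.quotient_is_cring[OF plucker_ideal_ideal mpoly_ring_cring])

lemma plucker_hom: "(+>\<^bsub>mpoly_ring V\<^esub>) (plucker_ideal k n) \<in> Ring.ring_hom (mpoly_ring V) (plucker_ring k n :: 'k::field plucker_elt ring)"
  unfolding plucker_ring_def by (rule ideal.rcos_ring_hom[OF plucker_ideal_ideal])

lemma plucker_coord_closed: "\<alpha> \<in> V \<Longrightarrow> plucker_coord k n \<alpha> \<in> carrier (plucker_ring k n :: 'k::field plucker_elt ring)"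
  unfolding plucker_coord_def by (rule ring_hom_closed[OF plucker_hom]) simp

lemma richardson_ideal_ideal: "ideal (richardson_ideal k n \<beta> \<gamma>) (plucker_ring k n :: 'k::field plucker_elt ring)"
  unfolding richardson_ideal_def
  by (rule ring.genideal_ideal) (use plucker_ring_cring plucker_coord_closed in \<open>auto simp: cring_def\<close>)

lemma richardson_ring_cring: "cring (RR :: 'k::field richardson_elt ring)"
  unfolding richardson_ring_def by (rule ideal.quotient_is_cring[OF richardson_ideal_ideal plucker_ring_cring])

lemma \<eta>_hom: "\<eta> \<in> Ring.ring_hom (mpoly_ring V) (RR :: 'k::field richardson_elt ring)"
proof -
  have "(+>\<^bsub>plucker_ring k n\<^esub>) (richardson_ideal k n \<beta> \<gamma>)
      \<in> Ring.ring_hom (plucker_ring k n) (RR :: 'k richardson_elt ring)"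
    unfolding richardson_ring_def by (rule ideal.rcos_ring_hom[OF richardson_ideal_ideal])
  from ring_hom_trans[OF plucker_hom this] show ?thesis by (simp add: \<eta>_def[abs_def] comp_def)
qed

lemma \<eta>_surj:
  assumes "x \<in> carrier (RR :: 'k::field richardson_elt ring)"
  shows "\<exists>F. mvars F \<subseteq> V \<and> x = \<eta> F"
proof -
  obtain y where y: "y \<in> carrier (plucker_ring k n :: 'k plucker_elt ring)" "x = richardson_ideal k n \<beta> \<gamma> +>\<^bsub>plucker_ring k n\<^esub> y"
    using assms by (auto simp: richardson_ring_def FactRing_def A_RCOSETS_def')
  obtain F where "F \<in> carrier (mpoly_ring V)" "y = plucker_ideal k n +>\<^bsub>mpoly_ring V\<^esub> (F :: (nat set, 'k) mpoly)"
    using y(1) by (auto simp: plucker_ring_def FactRing_def A_RCOSETS_def')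
  thus ?thesis using y(2) by (auto simp: \<eta>_def)
qed

lemma \<eta>_zero_iff:
  assumes "mvars F \<subseteq> V"
  shows "\<eta> F = \<zero>\<^bsub>RR\<^esub> \<longleftrightarrow>
    plucker_ideal k n +>\<^bsub>mpoly_ring V\<^esub> (F :: (nat set, 'k::field) mpoly) \<in> richardson_ideal k n \<beta> \<gamma>"
proof -
  let ?x = "plucker_ideal k n +>\<^bsub>mpoly_ring V\<^esub> F"
  have x: "?x \<in> carrier (plucker_ring k n)" using assms by (intro ring_hom_closed[OF plucker_hom]) simp
  have "\<zero>\<^bsub>RR\<^esub> = (richardson_ideal k n \<beta> \<gamma> :: 'k plucker_elt set)"
    by (simp add: richardson_ring_def FactRing_def)
  thus ?thesis
    using ideal.rcos_const_imp_mem[OF richardson_ideal_ideal x] plucker_ring_cring[where ?'k = 'k]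
      ring.a_rcos_zero[OF _ richardson_ideal_ideal, of ?x]
    by (auto simp: \<eta>_def cring_def)
qed

text \<open>The evaluation descends to the Pluecker ring, where its kernel contains the coordinates
  outside the interval and hence the ideal that they generate.\<close>

lemma Phi_zero_of_\<eta>:
  fixes F :: "(nat set, 'k::field) mpoly"
  assumes F: "mvars F \<subseteq> V" "\<eta> F = \<zero>\<^bsub>RR\<^esub>" and \<sigma>: "bij_betw \<sigma> {1..k} {1..k}"
  shows "Phi \<sigma> F = 0"
proof -
  let ?A = "plucker_ring k n :: 'k plucker_elt ring"
  let ?U = "mpoly_ring UNIV :: 'k band_poly ring"
  have U: "ring ?U" by (simp add: cring.axioms(1) mpoly_ring_cring)
  have "\<exists>\<phi>\<in>Ring.ring_hom ?A ?U. \<forall>x\<in>carrier (mpoly_ring V). \<phi> (plucker_ideal k n +>\<^bsub>mpoly_ring V\<^esub> x) = Phi \<sigma> x"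
    unfolding plucker_ring_def
    by (rule quotient_hom[OF plucker_ideal_ideal _ U]) (simp_all add: comm_ring_hom_in_ring_hom Phi_hom Phi_plucker)
  then obtain \<phi> where \<phi>: "\<phi> \<in> Ring.ring_hom ?A ?U"
    "\<And>x. mvars x \<subseteq> V \<Longrightarrow> \<phi> (plucker_ideal k n +>\<^bsub>mpoly_ring V\<^esub> x) = Phi \<sigma> x" by auto
  have A: "ring ?A" using plucker_ring_cring[where ?'k = 'k] by (simp add: cring_def)
  have K: "ideal (a_kernel ?A ?U \<phi>) ?A"
    by (rule ring_hom_ring.kernel_is_ideal[OF ring_hom_ringI2[OF A U \<phi>(1)]])
  have "plucker_coord k n ` (V - \<I>) \<subseteq> a_kernel ?A ?U \<phi>"
  proof
    fix x :: "'k plucker_elt" assume "x \<in> plucker_coord k n ` (V - \<I>)"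
    then obtain \<alpha> where \<alpha>: "\<alpha> \<in> V - \<I>" "x = plucker_coord k n \<alpha>" by blast
    have "\<phi> (plucker_coord k n \<alpha>) = minor k (Z \<sigma>) \<alpha>"
      unfolding plucker_coord_def using \<alpha>(1) by (subst \<phi>(2)) simp_all
    also have "\<dots> = 0" by (rule minor_outside[OF \<alpha>(1) \<sigma>])
    finally show "x \<in> a_kernel ?A ?U \<phi>" using \<alpha> plucker_coord_closed[where ?'k = 'k] by (simp add: a_kernel_def')
  qed
  hence "richardson_ideal k n \<beta> \<gamma> \<subseteq> a_kernel ?A ?U \<phi>"
    unfolding richardson_ideal_def by (rule ring.genideal_minimal[OF A K])
  hence "plucker_ideal k n +>\<^bsub>mpoly_ring V\<^esub> F \<in> a_kernel ?A ?U \<phi>"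
    using F \<eta>_zero_iff[OF F(1)] by blast
  thus ?thesis using \<phi>(2)[OF F(1)] by (simp add: a_kernel_def')
qed

lemma \<eta>_add: "mvars F \<subseteq> V \<Longrightarrow> mvars G \<subseteq> V \<Longrightarrow> \<eta> (F + G) = \<eta> F \<oplus>\<^bsub>RR\<^esub> \<eta> (G :: (nat set, 'k::field) mpoly)"
  and \<eta>_mult: "mvars F \<subseteq> V \<Longrightarrow> mvars G \<subseteq> V \<Longrightarrow> \<eta> (F * G) = \<eta> F \<otimes>\<^bsub>RR\<^esub> \<eta> (G :: (nat set, 'k::field) mpoly)"
  and \<eta>_one: "\<eta> (1 :: (nat set, 'k::field) mpoly) = \<one>\<^bsub>RR\<^esub>"
  using ring_hom_add[OF \<eta>_hom, of F G] ring_hom_mult[OF \<eta>_hom, of F G] ring_hom_one[OF \<eta>_hom[where ?'k = 'k]]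
  by simp_all

lemma \<eta>_closed: "mvars F \<subseteq> V \<Longrightarrow> \<eta> (F :: (nat set, 'k::field) mpoly) \<in> carrier (RR)"
  by (rule ring_hom_closed[OF \<eta>_hom]) simp

lemma \<eta>_0: "\<eta> (0 :: (nat set, 'k::field) mpoly) = \<zero>\<^bsub>RR\<^esub>"
  using ring_hom_zero[OF \<eta>_hom[where ?'k = 'k]] richardson_ring_cring mpoly_ring_cring
  by (fastforce simp: cring_def)

text \<open>The Richardson ring is the subring \<open>Q\<close> of a polynomial ring.\<close>

lemma \<eta>_kernel:
  fixes F :: "(nat set, 'k::field) mpoly"
  assumes F: "mvars F \<subseteq> V"
  shows "\<eta> F = \<zero>\<^bsub>RR\<^esub> \<longleftrightarrow> Phi0 F = 0"
proof
  assume "\<eta> F = \<zero>\<^bsub>RR\<^esub>"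
  thus "Phi0 F = 0" using Phi_zero_of_\<eta>[OF F _ bij_betw_ident] by blast
next
  \<comment> \<open>The converse is the instance of \<open>Phi_kernel\<close> for the polynomials that
    vanish in the Richardson ring.\<close>
  let ?N = "{F :: (nat set, 'k) mpoly. mvars F \<subseteq> V \<and> \<eta> F = \<zero>\<^bsub>RR\<^esub>}"
  interpret RR: cring "RR :: 'k richardson_elt ring" by (rule richardson_ring_cring)
  have "straightening k n \<beta> \<gamma> ?N"
  proof
    show "0 \<in> ?N" by (simp add: \<eta>_0)
    fix p q :: "(nat set, 'k) mpoly"
    show "p \<in> ?N \<Longrightarrow> q \<in> ?N \<Longrightarrow> p + q \<in> ?N"
      using mvars_add[of p q] by (auto simp: \<eta>_add)
    show "mvars p \<subseteq> V \<Longrightarrow> q \<in> ?N \<Longrightarrow> p * q \<in> ?N"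
      using mvars_mult[of p q] \<eta>_closed[of p] by (auto simp: \<eta>_mult)
    show "p \<in> ?N" if p: "p \<in> plucker_ideal k n"
    proof -
      have "mvars p \<subseteq> V" using p by (simp add: plucker_ideal_iff)
      moreover have "plucker_ideal k n +>\<^bsub>mpoly_ring V\<^esub> p = plucker_ideal k n"
        using ring.a_rcos_zero[OF _ plucker_ideal_ideal p] mpoly_ring_cring by (auto simp: cring_def)
      moreover have "(plucker_ideal k n :: (nat set, 'k) mpoly set) \<in> richardson_ideal k n \<beta> \<gamma>"
        using additive_subgroup.zero_closed[OF ideal.axioms(1)[OF richardson_ideal_ideal[where ?'k = 'k]]]
        by (simp add: plucker_ring_def FactRing_def)
      ultimately show ?thesis using \<eta>_zero_iff[of p] by simp
    qed
  next
    fix \<alpha> assume \<alpha>: "\<alpha> \<in> V - \<I>"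
    have "plucker_coord k n \<alpha> \<in> (richardson_ideal k n \<beta> \<gamma> :: 'k plucker_elt set)"
      unfolding richardson_ideal_def
      using ring.genideal_self[of "plucker_ring k n :: 'k plucker_elt ring"
          "plucker_coord k n ` (V - \<I>)"] plucker_ring_cring[where ?'k = 'k] \<alpha>
          plucker_coord_closed[where ?'k = 'k] by (auto simp: cring_def)
    thus "mvar \<alpha> \<in> ?N" using \<alpha> \<eta>_zero_iff[of "mvar \<alpha> :: (nat set, 'k) mpoly"] by (simp add: plucker_coord_def)
  qed
  moreover have "\<And>q. q \<in> ?N \<Longrightarrow> Phi0 q = 0" using Phi_zero_of_\<eta>[OF _ _ bij_betw_ident] by blast
  moreover assume "Phi0 F = 0"
  ultimately show "\<eta> F = \<zero>\<^bsub>RR\<^esub>" using Phi_kernel[of ?N F] F by blast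
qed

lemma \<eta>_eq_iff:
  fixes F G :: "(nat set, 'k::field) mpoly"
  assumes F: "mvars F \<subseteq> V" and G: "mvars G \<subseteq> V"
  shows "\<eta> F = \<eta> G \<longleftrightarrow> Phi0 F = Phi0 G"
proof -
  interpret RR: cring "RR :: 'k richardson_elt ring" by (rule richardson_ring_cring)
  have FG: "mvars (F - G) \<subseteq> V" using mvars_add[of F "- G"] F G by auto
  have "\<eta> F = \<eta> (F - G) \<oplus>\<^bsub>RR\<^esub> \<eta> G"
    using \<eta>_add[OF FG G] by simp
  hence "\<eta> F = \<eta> G \<longleftrightarrow> \<eta> (F - G) = \<zero>\<^bsub>RR\<^esub>"
    using \<eta>_closed[OF FG] \<eta>_closed[OF G] RR.add.l_cancel_one by simp
  thus ?thesis unfolding \<eta>_kernel[OF FG] by (simp add: Phi.hom_minus)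
qed

end

section \<open>The prime element\<close>

context richardson_step
begin

abbreviation E :: "'k::field richardson_elt set" where
  "E \<equiv> extremal_monomials k n \<beta> \<gamma>"

lemma mvars_power: "mvars p \<subseteq> W \<Longrightarrow> mvars (p ^ i) \<subseteq> W" for p :: "('x, 'k::comm_ring_1) mpoly"
proof (induction i)
  case (Suc i)
  thus ?case using mvars_mult[of p "p ^ i"] by auto
qed simp

lemma mvars_mult_subset: "mvars p \<subseteq> W \<Longrightarrow> mvars q \<subseteq> W \<Longrightarrow> mvars (p * q) \<subseteq> W" for p q :: "('x, 'k::comm_ring_1) mpoly"
  using mvars_mult[of p q] by blast

lemma \<eta>_power:
  fixes F :: "(nat set, 'k::field) mpoly"
  assumes F: "mvars F \<subseteq> V"
  shows "\<eta> (F ^ i) = \<eta> F [^]\<^bsub>RR\<^esub> i"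
proof -
  interpret R: cring "RR :: 'k richardson_elt ring" by (rule richardson_ring_cring)
  show ?thesis
  proof (induction i)
    case 0
    show ?case by (simp add: \<eta>_one)
  next
    case (Suc i)
    have "\<eta> (F ^ Suc i) = \<eta> (F ^ i * F)" by (simp add: mult.commute)
    also have "\<dots> = \<eta> (F ^ i) \<otimes>\<^bsub>RR\<^esub> \<eta> F" by (rule \<eta>_mult[OF mvars_power[OF F] F])
    finally show ?case using Suc by simp
  qed
qed

text \<open>Representatives of the inverted elements.\<close>

definition extremal :: "nat \<Rightarrow> nat \<Rightarrow> (nat set, 'k::field) mpoly" where
  "extremal i j = mvar \<beta> ^ i * mvar \<gamma> ^ j"

lemma mvars_extremal: "mvars (extremal i j :: (nat set, 'k::field) mpoly) \<subseteq> V"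
  unfolding extremal_def using \<beta> \<gamma> by (intro mvars_mult_subset mvars_power) simp_all

lemma E_iff: "s \<in> (E :: 'k::field richardson_elt set) \<longleftrightarrow> (\<exists>i j. s = \<eta> (extremal i j))"
proof -
  have "\<eta> (extremal i j :: (nat set, 'k) mpoly) = richardson_coord k n \<beta> \<gamma> \<beta> [^]\<^bsub>RR\<^esub> i \<otimes>\<^bsub>RR\<^esub> richardson_coord k n \<beta> \<gamma> \<gamma> [^]\<^bsub>RR\<^esub> j" for i j
    unfolding extremal_def \<eta>_coord using \<beta> \<gamma>
    by (subst \<eta>_mult) (simp_all add: \<eta>_power mvars_power)
  thus ?thesis unfolding extremal_monomials_def by auto
qed

lemma Phi0_extremal: "Phi0 (extremal i j) = P k ^ i * P 0 ^ j"
  by (simp add: extremal_def Phi.hom_mult Phi.hom_power P_def delta_0 delta_k)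

lemma localizing_E: "localizing (RR :: 'k::field richardson_elt ring) E"
proof (intro localizing.intro localizing_axioms.intro)
  show "cring (RR :: 'k richardson_elt ring)" by (rule richardson_ring_cring)
  show "E \<subseteq> carrier (RR :: 'k richardson_elt ring)"
  proof
    fix s assume "s \<in> (E :: 'k richardson_elt set)"
    then obtain i j where "s = \<eta> (extremal i j)" by (auto simp: E_iff)
    thus "s \<in> carrier RR" by (simp add: \<eta>_closed[OF mvars_extremal])
  qed
  show "\<one>\<^bsub>RR\<^esub> \<in> (E :: 'k richardson_elt set)"
    unfolding E_iff by (rule exI[of _ 0], rule exI[of _ 0]) (simp add: extremal_def \<eta>_one)
  fix s t assume "s \<in> (E :: 'k richardson_elt set)" "t \<in> (E :: 'k richardson_elt set)"
  then obtain i j i' j' where "s = \<eta> (extremal i j)" "t = \<eta> (extremal i' j')" by (auto simp: E_iff)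
  hence "s \<otimes>\<^bsub>RR\<^esub> t = \<eta> (extremal i j * extremal i' j')"
    using \<eta>_mult[OF mvars_extremal mvars_extremal, where ?'k = 'k] by simp
  also have "extremal i j * extremal i' j' = (extremal (i + i') (j + j') :: (nat set, 'k) mpoly)"
    by (simp add: extremal_def power_add ac_simps)
  finally show "s \<otimes>\<^bsub>RR\<^esub> t \<in> E" by (auto simp: E_iff)
qed

lemma divisible_of_Phi_swap_zero:
  fixes F :: "(nat set, 'k::field) mpoly"
  assumes F: "mvars F \<subseteq> V" "Phi swap F = 0"
  shows "\<exists>v\<in>E. \<exists>d\<in>carrier RR. v \<otimes>\<^bsub>RR\<^esub> \<eta> F = d \<otimes>\<^bsub>RR\<^esub> \<eta> (mvar (delta k \<beta> \<gamma> t))"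
proof -
  obtain ss q where q: "q \<in> Q" "good_den ss" "den ss * Phi0 F = P t * q"
    using Phi_swap_zero[OF F] by blast
  obtain N z where z: "z \<in> Q" "(P 0 * P k) ^ N * Phi0 F = P t * z"
    using divide_by_other_monomials[OF q(2) Q_I[OF F(1)] q(1,3)] by blast
  obtain H where H: "mvars H \<subseteq> V" "z = Phi0 (H :: (nat set, 'k) mpoly)" using z(1) by (auto simp: Q_def)
  let ?d = "mvar (delta k \<beta> \<gamma> t) :: (nat set, 'k) mpoly"
  have d: "mvars ?d \<subseteq> V" using delta_V[of t] t by simp
  have "Phi0 (extremal N N * F) = Phi0 (H * ?d)"
    using z(2) unfolding H(2) by (simp add: Phi.hom_mult Phi0_extremal power_mult_distrib P_def[of t] ac_simps)
  hence "\<eta> (extremal N N * F) = \<eta> (H * ?d)"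
    by (subst \<eta>_eq_iff) (intro mvars_mult_subset mvars_extremal F H d)+
  hence "\<eta> (extremal N N) \<otimes>\<^bsub>RR\<^esub> \<eta> F = \<eta> H \<otimes>\<^bsub>RR\<^esub> \<eta> ?d"
    by (simp only: \<eta>_mult[OF mvars_extremal F(1)] \<eta>_mult[OF H(1) d])
  thus ?thesis using \<eta>_closed[OF H(1)] E_iff by blast
qed

text \<open>If a product is divisible by the coordinate of \<open>\<delta>\<^sub>t\<close>, then
  \<open>Phi swap\<close> kills one of the factors, as it takes values in a domain; that factor is
  divisible up to inverted elements. Since \<open>Phi swap\<close> kills no inverted element, the
  coordinate is not a unit.\<close>

theorem delta_prime:
  "ring_prime\<^bsub>open_richardson_ring k n \<beta> \<gamma>\<^esub>
    (open_richardson_coord k n \<beta> \<gamma> (delta k \<beta> \<gamma> t) :: 'k::field open_richardson_elt)"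
proof -
  let ?d = "mvar (delta k \<beta> \<gamma> t) :: (nat set, 'k) mpoly"
  have d: "mvars ?d \<subseteq> V" using delta_V[of t] t by simp
  interpret L: localizing "RR :: 'k richardson_elt ring" E by (rule localizing_E)
  have nz: "Phi swap (extremal i j :: (nat set, 'k) mpoly) \<noteq> 0" for i j
    using Phi_swap_\<beta>[where ?'k = 'k] Phi_swap_\<gamma>[where ?'k = 'k]
    by (simp add: extremal_def Phi.hom_mult Phi.hom_power del: Phi_mvar)
  have diff: "Phi swap F = Phi swap G" if "\<eta> F = \<eta> G" "mvars F \<subseteq> V" "mvars G \<subseteq> V" for F G :: "(nat set, 'k) mpoly"
  proof -
    have FG: "mvars (F - G) \<subseteq> V" using mvars_add[of F "- G"] that by auto
    have "Phi0 (F - G) = 0" using that by (simp add: \<eta>_eq_iff Phi.hom_minus)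
    hence "\<eta> (F - G) = \<zero>\<^bsub>RR\<^esub>" using \<eta>_kernel[OF FG] by simp
    hence "Phi swap (F - G) = 0" by (rule Phi_zero_of_\<eta>[OF FG _ swap_bij])
    thus ?thesis by (simp add: Phi.hom_minus)
  qed
  have "ring_prime\<^bsub>localization RR E\<^esub> (loc_frac RR E (\<eta> ?d) \<one>\<^bsub>RR\<^esub>)"
  proof (rule L.ring_prime_localization)
    show "\<eta> ?d \<in> carrier RR" by (rule \<eta>_closed[OF d])
  next
    fix u assume "u \<in> (E :: 'k richardson_elt set)"
    then obtain i j where u: "u = \<eta> (extremal i j)" by (auto simp: E_iff)
    show "u \<otimes>\<^bsub>RR\<^esub> \<eta> ?d \<noteq> \<zero>\<^bsub>RR\<^esub>"
    proof
      assume "u \<otimes>\<^bsub>RR\<^esub> \<eta> ?d = \<zero>\<^bsub>RR\<^esub>"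
      hence "\<eta> (extremal i j * ?d) = \<zero>\<^bsub>RR\<^esub>" unfolding u by (simp only: \<eta>_mult[OF mvars_extremal d])
      hence "Phi0 (extremal i j * ?d) = 0"
        using \<eta>_kernel[OF mvars_mult_subset[OF mvars_extremal d]] by blast
      hence "P k ^ i * P 0 ^ j * P t = (0 :: 'k band_poly)"
        by (simp add: Phi.hom_mult Phi0_extremal P_def[of t])
      thus False using P_nonzero[of k, where ?'k = 'k] P_nonzero[of 0, where ?'k = 'k] P_nonzero[of t, where ?'k = 'k] t by simp
    qed
    fix c assume "c \<in> carrier (RR :: 'k richardson_elt ring)"
    then obtain C where C: "mvars C \<subseteq> V" "c = \<eta> C" using \<eta>_surj by blast
    show "u \<noteq> c \<otimes>\<^bsub>RR\<^esub> \<eta> ?d"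
    proof
      assume "u = c \<otimes>\<^bsub>RR\<^esub> \<eta> ?d"
      hence "\<eta> (extremal i j) = \<eta> (C * ?d)" unfolding u C(2) by (simp only: \<eta>_mult[OF C(1) d])
      from diff[OF this mvars_extremal mvars_mult_subset[OF C(1) d]]
      show False using nz[of i j] Phi_swap_delta[where ?'k = 'k] by (simp add: Phi.hom_mult del: Phi_mvar)
    qed
  next
    fix u a b c
    assume u: "u \<in> (E :: 'k richardson_elt set)" and a: "a \<in> carrier RR" and b: "b \<in> carrier RR"
      and c: "c \<in> carrier RR" and eq: "u \<otimes>\<^bsub>RR\<^esub> (a \<otimes>\<^bsub>RR\<^esub> b) = c \<otimes>\<^bsub>RR\<^esub> \<eta> ?d"
    obtain i j where u: "u = \<eta> (extremal i j)" using u by (auto simp: E_iff)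
    obtain F where F: "mvars F \<subseteq> V" "a = \<eta> F" using \<eta>_surj[OF a] by blast
    obtain G where G: "mvars G \<subseteq> V" "b = \<eta> G" using \<eta>_surj[OF b] by blast
    obtain C where C: "mvars C \<subseteq> V" "c = \<eta> C" using \<eta>_surj[OF c] by blast
    have FG: "mvars (F * G) \<subseteq> V" by (rule mvars_mult_subset[OF F(1) G(1)])
    have "\<eta> (extremal i j * (F * G)) = \<eta> (C * ?d)"
      using eq unfolding u F(2) G(2) C(2)
      by (simp only: \<eta>_mult[OF mvars_extremal FG] \<eta>_mult[OF F(1) G(1)] \<eta>_mult[OF C(1) d])
    from diff[OF this mvars_mult_subset[OF mvars_extremal FG] mvars_mult_subset[OF C(1) d]]
    have "Phi swap F = 0 \<or> Phi swap G = 0"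
      using nz[of i j] Phi_swap_delta[where ?'k = 'k] by (simp add: Phi.hom_mult del: Phi_mvar)
    thus "(\<exists>v\<in>E. \<exists>d\<in>carrier RR. v \<otimes>\<^bsub>RR\<^esub> a = d \<otimes>\<^bsub>RR\<^esub> \<eta> ?d) \<or> (\<exists>v\<in>E. \<exists>d\<in>carrier RR. v \<otimes>\<^bsub>RR\<^esub> b = d \<otimes>\<^bsub>RR\<^esub> \<eta> ?d)"
      unfolding F(2) G(2) using divisible_of_Phi_swap_zero F(1) G(1) by blast
  qed
  thus ?thesis by (simp add: open_richardson_ring_def open_richardson_coord_def \<eta>_coord)
qed

end

theorem corollary15:
  fixes k n t :: nat and \<beta> \<gamma> :: "nat set"
  assumes "1 \<le> k" and "k \<le> n"
    and "\<beta> \<in> ksubsets k n" and "\<gamma> \<in> ksubsets k n" and "ksub_le k \<beta> \<gamma>"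
    and "1 \<le> t" and "t \<le> k - 1"
    and "Pset k n \<beta> \<gamma> t \<noteq> {}"
  shows "ring_prime\<^bsub>open_richardson_ring k n \<beta> \<gamma>\<^esub>
    (open_richardson_coord k n \<beta> \<gamma> (delta k \<beta> \<gamma> t) :: 'k::field open_richardson_elt)"
proof -
  have "elt \<beta> (t + 1) \<le> elt \<gamma> t"
    using assms(8) unfolding Pset_def by auto
  then interpret richardson_step k n \<beta> \<gamma> t
    using assms by unfold_locales auto
  show ?thesis by (rule delta_prime)
qed

end
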